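(* Let $q>1$. Assume the following. (1) The weight $w$ is bounded and Lipschitz. (2) $\mathcal Z\subset\mathbb R^d$ is compact and there are $\rho_Z,\eta_Z>0$ such that for every $z\in\mathcal Z$ there is a unit vector $\xi_z$ with $\{z+tv:0<t<\rho_Z,\ \|v\|=1,\ \|v-\xi_z\|<\eta_Z\}\subset\mathcal Z$. (3) The law of $Z$ has a density $p_Z$ on $\mathcal Z$ with $0<c_Z\le p_Z(z)\le C_Z<\infty$ for all $z\in\mathcal Z$. (4) There is $M_w<\infty$ with $\mu_i^w(\overline\Omega_L)\le M_w$ almost surely. (5) $K_Z:\mathbb R^d\to[0,\infty)$ and $K_U:\mathbb R^2\to[0,\infty)$ are bounded, Lipschitz, integrate to one, are supported in the closed unit balls of $\mathbb R^d$ and $\mathbb R^2$ respectively, and there are $\rho_{K,Z},\rho_{K,U},k_Z,k_U>0$ with $K_Z(x)\ge k_Z$ whenever $\|x\|\le\rho_{K,Z}$ and $K_U(y)\ge k_U$ whenever $\|y\|\le\rho_{K,U}$. (6) The positive bandwidths $h_Z=h_{Z,n}$, $h_U=h_{U,n}$ satisfy $h_Z\downarrow0$, $h_U\downarrow0$, $nh_Z^d/\log n\to\infty$. (7) $\omega_{\mathrm{OT},q}(r):=\sup_{\|z-z'\|\le r}\mathrm{OT}_q^q(\Lambda_z^w,\Lambda_{z'}^w)\to0$ as $r\downarrow0$, and $\mathfrak b_{U,q}(h_U)\to0$. If, for some $\beta>0$ and $L_{\mathrm{OT}}<\infty$, $\mathrm{OT}_q^q(\Lambda_z^w,\Lambda_{z'}^w)\le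 L_{\mathrm{OT}}\|z-z'\|^\beta$ for all $z,z'\in\mathcal Z$, and $\mathfrak b_{U,q}(h_U)=O(h_U^q)$, then the choices $$h_Z\asymp\left(\frac{\log n}{n}\right)^{1/(2\beta+d)},\qquad h_U^q\lesssim\left(\frac{\log n}{n}\right)^{\beta/(2\beta+d)}$$ give $$\sup_{z\in\mathcal Z}\mathrm{OT}_q^q\bigl(\widehat\Lambda_{z,n}^{w,h_U},\Lambda_z^w\bigr)=O_P\left[\left(\frac{\log n}{n}\right)^{\beta/(2\beta+d)}\right],$$ or equivalently $$\sup_{z\in\mathcal Z}\mathrm{OT}_q\bigl(\widehat\Lambda_{z,n}^{w,h_U},\Lambda_z^w\bigr)=O_P\left[\left(\frac{\log n}{n}\right)^{\beta/(q(2\beta+d))}\right].$$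
   Context: Fix $L>0$ and let $\Omega_L=\{(b,t):0\le b<t\le L\}$, $\overline\Omega_L=\{(b,t):0\le b\le t\le L\}$, $\Delta_L=\{(b,b):0\le b\le L\}$. $\|\cdot\|$ is the Euclidean norm. A persistence diagram $D$ supported in $\Omega_L$ is identified with a locally finite counting measure $\mu_D=\sum_{x\in D}a_x\delta_x$, $a_x\in\mathbb N$. A weight is a measurable $w:\overline\Omega_L\to[0,\infty)$ with $w=0$ on $\Delta_L$; $\mu_D^w(A)=\int_Aw\,d\mu_D$ for Borel $A\subseteq\overline\Omega_L$. $(Z_i,D_i)$, $i=1,\dots,n$, are i.i.d. copies of $(Z,D)$, with $Z\in\mathcal Z\subset\mathbb R^d$ and $D$ a random persistence diagram. Put $\mu_i^w=\mu_{D_i}^w$ and $\Lambda_z^w(A)=\mathbb E[\mu_i^w(A)\mid Z_i=z]$ (no Lebesgue density is assumed). For $h>0$ define $c_{Z,h}(z)=\int_{\mathcal Z}h^{-d}K_Z((z'-z)/h)\,dz'$, $c_{U,h}(u)=\int_{\overline\Omega_L}h^{-2}K_U((v-u)/h)\,dv$, $\kappa_{Z,h}(z,z')=h^{-d}K_Z((z'-z)/h)/c_{Z,h}(z)$, $\kappa_{U,h}(u,v)=h^{-2}K_U((v-u)/h)/c_{U,h}(u)$. Set $Y^w_{i,h_U}(u)=\int_{\overline\Omega_L}\kappa_{U,h_U}(u,v)\,d\mu_i^w(v)$, $\widehat\lambda_{w,n}(z,u)=\sum_i\kappa_{Z,h_Z}(z,Z_i)Y^w_{i,h_U}(u)/\sum_i\kappa_{Z,h_Z}(z,Z_i)$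 (zero if the denominator is zero), and $\widehat\Lambda_{z,n}^{w,h_U}(A)=\int_A\widehat\lambda_{w,n}(z,u)\,du$. Partial optimal transport: for finite measures $\nu,\xi$ on $\overline\Omega_L$, $\mathrm{adm}(\nu,\xi)$ is the set of finite positive measures $\pi$ on $\overline\Omega_L\times\overline\Omega_L$ with $\pi(A\times\overline\Omega_L)=\nu(A)$ and $\pi(\overline\Omega_L\times A)=\xi(A)$ for every Borel $A\subseteq\Omega_L$ (no constraint on $\Delta_L$), and $\mathrm{OT}_q(\nu,\xi)=\{\inf_{\pi\in\mathrm{adm}(\nu,\xi)}\int\|u-v\|^q\,d\pi(u,v)\}^{1/q}$. With $r_{U,h}(v)=\int_{\overline\Omega_L}\kappa_{U,h}(u,v)\,du$ and $d_{\Delta_L,2}(v)$ the Euclidean distance from $v$ to $\Delta_L$, $\mathfrak b_{U,q}(h)=\sup_{z\in\mathcal Z}\int_{\overline\Omega_L}|r_{U,h}(v)-1|\,d_{\Delta_L,2}(v)^q\,d\Lambda_z^w(v)$. $a_n\lesssim b_n$ means $a_n\le Cb_n$ for a constant $C$; $a_n\asymp b_n$ means both $a_n\lesssim b_n$ and $b_n\lesssim a_n$. *)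

theory Defs
  imports "HOL-Probability.Probability" "HOL-Library.Landau_Symbols"
begin

definition Omega :: "real \<Rightarrow> (real \<times> real) set" where
  "Omega L = {(b, t). 0 \<le> b \<and> b < t \<and> t \<le> L}"

definition Omega_bar :: "real \<Rightarrow> (real \<times> real) set" where
  "Omega_bar L = {(b, t). 0 \<le> b \<and> b \<le> t \<and> t \<le> L}"

definition Diag :: "real \<Rightarrow> (real \<times> real) set" where
  "Diag L = {(b, b) | b. 0 \<le> b \<and> b \<le> L}"

abbreviation borel_bar :: "real \<Rightarrow> (real \<times> real) measure" where
  "borel_bar L \<equiv> restrict_space borel (Omega_bar L)"

text \<open>A diagram is encoded by its multiplicity function, which vanishes off the points of the
  diagram. Local finiteness refers to \<open>Omega L\<close>, so points may accumulate at the diagonal.\<close>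

definition diagrams :: "real \<Rightarrow> (real \<times> real \<Rightarrow> nat) set" where
  "diagrams L = {D. {x. D x \<noteq> 0} \<subseteq> Omega L \<and>
     (\<forall>C. compact C \<and> C \<subseteq> Omega L \<longrightarrow> finite {x \<in> C. D x \<noteq> 0})}"

definition dgm_measure :: "real \<Rightarrow> (real \<times> real \<Rightarrow> nat) \<Rightarrow> (real \<times> real) measure" where
  "dgm_measure L D =
     distr (density (count_space (Omega_bar L)) (\<lambda>x. of_nat (D x))) (borel_bar L) (\<lambda>x. x)"

definition weighted_dgm ::
    "real \<Rightarrow> (real \<times> real \<Rightarrow> real) \<Rightarrow> (real \<times> real \<Rightarrow> nat) \<Rightarrow> (real \<times> real) measure" where
  "weighted_dgm L w D = density (dgm_measure L D) (\<lambda>x. ennreal (w x))"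

text \<open>The usual point-process \<open>\<sigma>\<close>-algebra, generated by the counts \<open>D \<mapsto> \<mu>\<^sub>D(A)\<close>.\<close>

definition diagram_space :: "real \<Rightarrow> (real \<times> real \<Rightarrow> nat) measure" where
  "diagram_space L = sigma (diagrams L)
     {{D \<in> diagrams L. emeasure (dgm_measure L D) A \<in> B} | A B.
        A \<in> sets (borel_bar L) \<and> B \<in> sets borel}"

definition is_weight :: "real \<Rightarrow> (real \<times> real \<Rightarrow> real) \<Rightarrow> bool" where
  "is_weight L w \<longleftrightarrow> w \<in> borel_measurable (borel_bar L) \<and>
     (\<forall>x\<in>Omega_bar L. 0 \<le> w x) \<and> (\<forall>x\<in>Diag L. w x = 0)"

definition iid_copies ::
    "'w measure \<Rightarrow> 'x measure \<Rightarrow> (nat \<Rightarrow> 'w \<Rightarrow> 'x) \<Rightarrow> ('w \<Rightarrow> 'x) \<Rightarrow> bool" where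
  "iid_copies M N Xs X \<longleftrightarrow> X \<in> measurable M N \<and>
     prob_space.indep_vars M (\<lambda>_. N) Xs UNIV \<and>
     (\<forall>i. distr M N (Xs i) = distr M N X)"

text \<open>\<open>\<Lambda> z (A)\<close> is a version of \<open>\<EE>[\<mu>(A) | Z = z]\<close> that is a finite measure in \<open>A\<close> for
  every \<open>z\<close> in \<open>S\<close>; such a version is fixed, since suprema over all of \<open>S\<close> depend on it.\<close>

definition cond_expected_measure ::
    "'w measure \<Rightarrow> 'x measure \<Rightarrow> 'y measure \<Rightarrow> ('w \<Rightarrow> 'x) \<Rightarrow> ('w \<Rightarrow> 'y measure)
      \<Rightarrow> ('x \<Rightarrow> 'y measure) \<Rightarrow> bool" where
  "cond_expected_measure M S N Z \<mu> \<Lambda> \<longleftrightarrow>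
     (\<forall>z\<in>space S. finite_measure (\<Lambda> z) \<and> sets (\<Lambda> z) = sets N) \<and>
     (\<forall>A\<in>sets N. (\<lambda>z. emeasure (\<Lambda> z) A) \<in> borel_measurable S \<and>
        (AE \<omega> in M. emeasure (\<Lambda> (Z \<omega>)) A =
           nn_cond_exp M (vimage_algebra (space M) Z S) (\<lambda>\<omega>. emeasure (\<mu> \<omega>) A) \<omega>))"

definition cone_condition :: "'a::euclidean_space set \<Rightarrow> bool" where
  "cone_condition S \<longleftrightarrow> (\<exists>\<rho>>0. \<exists>\<eta>>0. \<forall>z\<in>S. \<exists>\<xi>. norm \<xi> = 1 \<and>
     {z + t *\<^sub>R v | t v. 0 < t \<and> t < \<rho> \<and> norm v = 1 \<and> norm (v - \<xi>) < \<eta>} \<subseteq> S)"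

definition admissible_kernel :: "('a::euclidean_space \<Rightarrow> real) \<Rightarrow> bool" where
  "admissible_kernel K \<longleftrightarrow>
     (\<forall>x. 0 \<le> K x) \<and> bounded (range K) \<and> (\<exists>C. C-lipschitz_on UNIV K) \<and>
     integrable lborel K \<and> (LINT x|lborel. K x) = 1 \<and>
     {x. K x \<noteq> 0} \<subseteq> cball 0 1 \<and>
     (\<exists>\<rho>>0. \<exists>k>0. \<forall>x. norm x \<le> \<rho> \<longrightarrow> k \<le> K x)"

definition kernel_const ::
    "('a::euclidean_space \<Rightarrow> real) \<Rightarrow> 'a set \<Rightarrow> real \<Rightarrow> 'a \<Rightarrow> real" where
  "kernel_const K S h z = (LINT z':S|lborel. K ((z' - z) /\<^sub>R h) / h ^ DIM('a))"

definition kernel_corr ::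
    "('a::euclidean_space \<Rightarrow> real) \<Rightarrow> 'a set \<Rightarrow> real \<Rightarrow> 'a \<Rightarrow> 'a \<Rightarrow> real" where
  "kernel_corr K S h z z' = (K ((z' - z) /\<^sub>R h) / h ^ DIM('a)) / kernel_const K S h z"

definition smoothed_dgm ::
    "real \<Rightarrow> (real \<times> real \<Rightarrow> real) \<Rightarrow> (real \<times> real \<Rightarrow> real) \<Rightarrow> real
      \<Rightarrow> (real \<times> real \<Rightarrow> nat) \<Rightarrow> real \<times> real \<Rightarrow> real" where
  "smoothed_dgm L w KU h D u = (LINT v|weighted_dgm L w D. kernel_corr KU (Omega_bar L) h u v)"

text \<open>The convention that the estimator is zero when the denominator vanishes is that of
  division in HOL.\<close>

definition lambda_hat ::
    "real \<Rightarrow> (real \<times> real \<Rightarrow> real) \<Rightarrow> 'a::euclidean_space set \<Rightarrow> ('a \<Rightarrow> real)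
      \<Rightarrow> (real \<times> real \<Rightarrow> real) \<Rightarrow> real \<Rightarrow> real \<Rightarrow> nat \<Rightarrow> (nat \<Rightarrow> 'a)
      \<Rightarrow> (nat \<Rightarrow> real \<times> real \<Rightarrow> nat) \<Rightarrow> 'a \<Rightarrow> real \<times> real \<Rightarrow> real" where
  "lambda_hat L w S KZ KU hZ hU n z D z0 u =
     (\<Sum>i<n. kernel_corr KZ S hZ z0 (z i) * smoothed_dgm L w KU hU (D i) u) /
     (\<Sum>i<n. kernel_corr KZ S hZ z0 (z i))"

definition Lambda_hat ::
    "real \<Rightarrow> (real \<times> real \<Rightarrow> real) \<Rightarrow> 'a::euclidean_space set \<Rightarrow> ('a \<Rightarrow> real)
      \<Rightarrow> (real \<times> real \<Rightarrow> real) \<Rightarrow> real \<Rightarrow> real \<Rightarrow> nat \<Rightarrow> (nat \<Rightarrow> 'a)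
      \<Rightarrow> (nat \<Rightarrow> real \<times> real \<Rightarrow> nat) \<Rightarrow> 'a \<Rightarrow> (real \<times> real) measure" where
  "Lambda_hat L w S KZ KU hZ hU n z D z0 =
     density (restrict_space lborel (Omega_bar L))
       (\<lambda>u. ennreal (lambda_hat L w S KZ KU hZ hU n z D z0 u))"

definition epowr :: "ennreal \<Rightarrow> real \<Rightarrow> ennreal" where
  "epowr x p = (if x = \<infinity> then \<infinity> else ennreal (enn2real x powr p))"

definition adm ::
    "real \<Rightarrow> (real \<times> real) measure \<Rightarrow> (real \<times> real) measure
      \<Rightarrow> ((real \<times> real) \<times> (real \<times> real)) measure set" where
  "adm L \<nu> \<xi> = {\<pi>. finite_measure \<pi> \<and> sets \<pi> = sets (borel_bar L \<Otimes>\<^sub>M borel_bar L) \<and>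
     (\<forall>A\<in>sets borel. A \<subseteq> Omega L \<longrightarrow>
        emeasure \<pi> (A \<times> Omega_bar L) = emeasure \<nu> A \<and>
        emeasure \<pi> (Omega_bar L \<times> A) = emeasure \<xi> A)}"

definition OT ::
    "real \<Rightarrow> real \<Rightarrow> (real \<times> real) measure \<Rightarrow> (real \<times> real) measure \<Rightarrow> ennreal" where
  "OT L q \<nu> \<xi> =
     epowr (INF \<pi>\<in>adm L \<nu> \<xi>. \<integral>\<^sup>+ (u, v). ennreal (norm (u - v) powr q) \<partial>\<pi>) (1 / q)"

definition omega_OT ::
    "real \<Rightarrow> real \<Rightarrow> 'a::euclidean_space set \<Rightarrow> ('a \<Rightarrow> (real \<times> real) measure) \<Rightarrow> real \<Rightarrow> ennreal" where
  "omega_OT L q S \<Lambda> r =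
     (SUP (z, z')\<in>{(z, z'). z \<in> S \<and> z' \<in> S \<and> norm (z - z') \<le> r}. epowr (OT L q (\<Lambda> z) (\<Lambda> z')) q)"

definition r_U :: "real \<Rightarrow> (real \<times> real \<Rightarrow> real) \<Rightarrow> real \<Rightarrow> real \<times> real \<Rightarrow> real" where
  "r_U L KU h v = (LINT u:Omega_bar L|lborel. kernel_corr KU (Omega_bar L) h u v)"

definition bias_U ::
    "real \<Rightarrow> real \<Rightarrow> (real \<times> real \<Rightarrow> real) \<Rightarrow> 'a set \<Rightarrow> ('a \<Rightarrow> (real \<times> real) measure)
      \<Rightarrow> real \<Rightarrow> ennreal" where
  "bias_U L q KU S \<Lambda> h =
     (SUP z\<in>S. \<integral>\<^sup>+ v. ennreal (\<bar>r_U L KU h v - 1\<bar> * infdist v (Diag L) powr q) \<partial>\<Lambda> z)"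

text \<open>Stated with a measurable cover of the exceptional event, i.e. in outer probability, because
  a supremum over uncountably many \<open>z\<close> is not measurable a priori. For measurable \<open>X n\<close> this is
  the usual notion.\<close>

definition bigO_prob :: "'w measure \<Rightarrow> (nat \<Rightarrow> 'w \<Rightarrow> ennreal) \<Rightarrow> (nat \<Rightarrow> real) \<Rightarrow> bool" where
  "bigO_prob M X a \<longleftrightarrow>
     (\<forall>\<epsilon>>0. \<exists>C>0. \<forall>\<^sub>F n in sequentially. \<exists>B\<in>sets M.
        {\<omega> \<in> space M. X n \<omega> > ennreal (C * a n)} \<subseteq> B \<and> emeasure M B \<le> ennreal \<epsilon>)"

end

theory Submission
  imports Defs
begin

text \<open>The \<open>q\<close>-th power of the partial transport distance, the infimum \<open>partial_ot\<close> of the coupling costs, is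
  convex and satisfies a triangle inequality up to the factor \<open>3 powr q\<close> (\<open>partial_ot_triangle\<close>). The proof compares
  the estimator at \<open>z\<close> with \<open>\<Lambda> z\<close> through the mixture, with the same Nadaraya-Watson weights, of the smoothed
  conditional means \<open>\<Lambda> (Zs i)\<close> at the sampled covariates. Mixing over the sampled points instead of integrating
  over the covariate space keeps all mixtures finite, and the mass bound on \<open>\<Lambda>\<close> is needed only at sampled points,
  where it holds almost surely.

  Three errors arise. First, weights vanish unless \<open>Zs i\<close> is within \<open>hZ\<close> of \<open>z\<close>, so by convexity
  (\<open>partial_ot_mixture_le\<close>) and the Hoelder assumption replacing \<open>\<Lambda> (Zs i)\<close> by \<open>\<Lambda> z\<close> costs a multiple of
  \<open>hZ powr \<beta>\<close>. Second, smoothing moves mass by at most \<open>hU\<close>, except that the edge-corrected kernel does not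
  preserve mass exactly; the discrepancy is exchanged with the diagonal (\<open>partial_ot_smoothing_le\<close>). This costs a
  multiple of \<open>hU powr q\<close> plus the edge bias, which is of the same order. Third, there is the stochastic error.

  The stochastic error is treated by a multiscale bound (\<open>partial_ot_dyadic\<close>): the transport cost between two measures
  is at most a weighted sum over dyadic levels \<open>j\<close> of the total discrepancy over the \<open>4 ^ j\<close> cells of that level, with
  weights of order \<open>2 powr (- j * q)\<close>. The total discrepancy of a level is a maximum over sign patterns of sums of
  independent variables, the weighted scores, which are centred because \<open>\<Lambda>\<close> is the conditional mean
  (\<open>expectation_score\<close>), and which have variance of order \<open>hZ ^ d\<close>. With \<open>r = sqrt (ln n / (n * hZ ^ d))\<close>, an
  exponential inequality and a union bound over sign patterns, levels and a net of covariates
  (\<open>exceptional_event\<close>) show that the discrepancy of level \<open>j\<close> is at most a multiple of \<open>2 ^ j * r\<close>, with high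
  probability and simultaneously for all \<open>z\<close>. As \<open>q > 1\<close>, the weighted sum over the levels is a convergent geometric
  series, and the levels are cut off where the mesh is of order \<open>r\<close>. So the stochastic error is of order \<open>r\<close>.

  Altogether the error is of order \<open>r + hZ powr \<beta> + hU powr q\<close> (\<open>estimator_rate\<close>), and the prescribed bandwidths make
  each term of the order of the claimed rate (\<open>balanced_rate\<close>).\<close>

section \<open>Finite sums of measures\<close>

text \<open>The pieces of a coupling are added up as measures on one fixed measurable space \<open>N\<close>.\<close>

definition sum_measure :: "'a measure \<Rightarrow> 'i set \<Rightarrow> ('i \<Rightarrow> 'a measure) \<Rightarrow> 'a measure" where
  "sum_measure N I \<mu> = measure_of (space N) (sets N) (\<lambda>A. \<Sum>i\<in>I. emeasure (\<mu> i) A)"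

lemma sets_sum_measure [simp, measurable_cong]: "sets (sum_measure N I \<mu>) = sets N"
  and space_sum_measure [simp]: "space (sum_measure N I \<mu>) = space N"
  by (simp_all add: sum_measure_def)

lemma emeasure_sum_measure:
  assumes "\<And>i. i \<in> I \<Longrightarrow> sets (\<mu> i) = sets N" and A: "A \<in> sets N"
  shows "emeasure (sum_measure N I \<mu>) A = (\<Sum>i\<in>I. emeasure (\<mu> i) A)"
  unfolding sum_measure_def
proof (rule emeasure_measure_of_sigma[OF sets.sigma_algebra_axioms _ _ A])
  show "positive (sets N) (\<lambda>A. \<Sum>i\<in>I. emeasure (\<mu> i) A)"
    by (simp add: positive_def)
  show "countably_additive (sets N) (\<lambda>A. \<Sum>i\<in>I. emeasure (\<mu> i) A)"
  proof (rule countably_additiveI)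
    fix B :: "nat \<Rightarrow> _"
    assume B: "range B \<subseteq> sets N" "disjoint_family B" "\<Union> (range B) \<in> sets N"
    have "(\<Sum>n. \<Sum>i\<in>I. emeasure (\<mu> i) (B n)) = (\<Sum>i\<in>I. \<Sum>n. emeasure (\<mu> i) (B n))"
      by (rule suminf_sum) simp
    also have "\<dots> = (\<Sum>i\<in>I. emeasure (\<mu> i) (\<Union>n. B n))"
      using B assms by (intro sum.cong refl suminf_emeasure) auto
    finally show "(\<Sum>n. \<Sum>i\<in>I. emeasure (\<mu> i) (B n)) = (\<Sum>i\<in>I. emeasure (\<mu> i) (\<Union>n. B n))" .
  qed
qed

lemma nn_integral_sum_measure:
  assumes sets: "\<And>i. i \<in> I \<Longrightarrow> sets (\<mu> i) = sets N" and "f \<in> borel_measurable N"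
  shows "(\<integral>\<^sup>+x. f x \<partial>sum_measure N I \<mu>) = (\<Sum>i\<in>I. \<integral>\<^sup>+x. f x \<partial>\<mu> i)"
proof -
  have m: "f \<in> borel_measurable (\<mu> i)" if "f \<in> borel_measurable N" "i \<in> I" for f i
    using that(1) measurable_cong_sets[OF sets[OF that(2)] refl] by auto
  have m': "f \<in> borel_measurable (sum_measure N I \<mu>)" if "f \<in> borel_measurable N" for f
    using that measurable_cong_sets[OF sets_sum_measure refl] by auto
  show ?thesis
    using assms(2)
  proof (induct rule: borel_measurable_induct)
    case (cong f g)
    have "(\<integral>\<^sup>+x. f x \<partial>\<mu> i) = (\<integral>\<^sup>+x. g x \<partial>\<mu> i)" if "i \<in> I" for i
      using cong(3) sets_eq_imp_space_eq[OF sets[OF that]] by (intro nn_integral_cong) simp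
    moreover have "(\<integral>\<^sup>+x. f x \<partial>sum_measure N I \<mu>) = (\<integral>\<^sup>+x. g x \<partial>sum_measure N I \<mu>)"
      using cong(3) by (intro nn_integral_cong) simp
    ultimately show ?case using cong(4) by simp
  next
    case (set A)
    then show ?case using sets by (simp add: emeasure_sum_measure)
  next
    case (mult u c)
    then show ?case
      using m[OF mult(2)] m'[OF mult(2)] by (simp add: nn_integral_cmult sum_distrib_left)
  next
    case (add u v)
    then show ?case
      using m[OF add(1)] m'[OF add(1)] m[OF add(4)] m'[OF add(4)]
      by (simp add: nn_integral_add sum.distrib)
  next
    case (seq U)
    have 1: "(\<integral>\<^sup>+x. (SUP n. U n) x \<partial>\<mu> i) = (SUP n. \<integral>\<^sup>+x. U n x \<partial>\<mu> i)" if "i \<in> I" for i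
      unfolding SUP_apply using seq(4) m[OF seq(1) that]
      by (intro nn_integral_monotone_convergence_SUP) auto
    have 2: "(\<integral>\<^sup>+x. (SUP n. U n) x \<partial>sum_measure N I \<mu>) = (SUP n. \<integral>\<^sup>+x. U n x \<partial>sum_measure N I \<mu>)"
      unfolding SUP_apply using seq(4) m'[OF seq(1)]
      by (intro nn_integral_monotone_convergence_SUP) auto
    have "(\<Sum>i\<in>I. SUP n. \<integral>\<^sup>+x. U n x \<partial>\<mu> i) = (SUP n. \<Sum>i\<in>I. \<integral>\<^sup>+x. U n x \<partial>\<mu> i)"
      using seq(4) by (intro ennreal_SUP_sum[symmetric] incseq_nn_integral) auto
    then show ?case using 1 2 seq(3) by simp
  qed
qed

section \<open>The half-open triangle and its boundary\<close>

lemma Omega_borel [measurable]: "Omega L \<in> sets borel"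
proof -
  have "Omega L = {u. 0 \<le> fst u} \<inter> {u. fst u < snd u} \<inter> {u. snd u \<le> L}"
    by (auto simp: Omega_def)
  also have "\<dots> \<in> sets borel"
    by (intro sets.Int borel_closed borel_open closed_Collect_le open_Collect_less continuous_intros)
  finally show ?thesis .
qed

lemma closed_Omega_bar: "closed (Omega_bar L)"
proof -
  have "Omega_bar L = {u. 0 \<le> fst u} \<inter> {u. fst u \<le> snd u} \<inter> {u. snd u \<le> L}"
    by (auto simp: Omega_bar_def)
  then show ?thesis by (auto intro!: closed_Int closed_Collect_le continuous_intros)
qed

lemma Omega_bar_borel [measurable]: "Omega_bar L \<in> sets borel"
  using closed_Omega_bar by auto

lemma Diag_eq: "Diag L = Omega_bar L - Omega L"
  by (auto simp: Diag_def Omega_bar_def Omega_def)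

lemma Omega_subset: "Omega L \<subseteq> Omega_bar L"
  by (auto simp: Omega_bar_def Omega_def)

lemma Diag_subset: "Diag L \<subseteq> Omega_bar L"
  by (auto simp: Diag_eq)

lemma Diag_borel [measurable]: "Diag L \<in> sets borel"
  unfolding Diag_eq by measurable

lemma space_borel_bar [simp]: "space (borel_bar L) = Omega_bar L"
  by (simp add: space_restrict_space)

lemma sets_borel_bar: "A \<in> sets (borel_bar L) \<longleftrightarrow> A \<in> sets borel \<and> A \<subseteq> Omega_bar L"
  by (subst sets_restrict_space_iff) (auto)

lemma Omega_borel_bar [measurable]: "Omega L \<in> sets (borel_bar L)"
  using Omega_subset by (simp add: sets_borel_bar)

lemma Diag_borel_bar [measurable]: "Diag L \<in> sets (borel_bar L)"
  using Diag_subset by (simp add: sets_borel_bar)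

lemma Omega_bar_borel_bar [measurable]: "Omega_bar L \<in> sets (borel_bar L)"
  by (simp add: sets_borel_bar)

lemma id_borel_bar [measurable]: "(\<lambda>x. x) \<in> borel_bar L \<rightarrow>\<^sub>M borel"
  by (rule measurable_restrict_space1) simp

section \<open>The transport cost and its couplings\<close>

text \<open>The infimum inside \<open>OT\<close>: working with it instead of its \<open>q\<close>-th root makes the cost additive
  over pieces of a coupling.\<close>

definition transport_cost :: "real \<Rightarrow> ((real \<times> real) \<times> (real \<times> real)) measure \<Rightarrow> ennreal" where
  "transport_cost q \<pi> = (\<integral>\<^sup>+x. ennreal (norm (fst x - snd x) powr q) \<partial>\<pi>)"

definition partial_ot :: "real \<Rightarrow> real \<Rightarrow> (real \<times> real) measure \<Rightarrow> (real \<times> real) measure \<Rightarrow> ennreal"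
  where "partial_ot L q \<nu> \<xi> = (INF \<pi>\<in>adm L \<nu> \<xi>. transport_cost q \<pi>)"

lemma OT_eq: "OT L q \<nu> \<xi> = epowr (partial_ot L q \<nu> \<xi>) (1 / q)"
  by (simp add: OT_def partial_ot_def transport_cost_def case_prod_unfold)

lemma epowr_OT: "q > 0 \<Longrightarrow> epowr (OT L q \<nu> \<xi>) q = partial_ot L q \<nu> \<xi>"
  by (auto simp: OT_eq epowr_def powr_powr top_unique ennreal_enn2real_if)

lemma partial_ot_less_coupling:
  assumes "partial_ot L q \<nu> \<xi> \<le> ennreal t" "0 \<le> t" "e > 0"
  obtains \<pi> where "\<pi> \<in> adm L \<nu> \<xi>" "transport_cost q \<pi> \<le> ennreal (t + e)"
proof -
  have "(INF \<pi>\<in>adm L \<nu> \<xi>. transport_cost q \<pi>) < ennreal (t + e)"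
    using assms by (subst le_less_trans[of _ "ennreal t"])
      (simp_all add: partial_ot_def ennreal_less_iff)
  then obtain \<pi> where "\<pi> \<in> adm L \<nu> \<xi>" "transport_cost q \<pi> < ennreal (t + e)"
    unfolding INF_less_iff by blast
  then show ?thesis by (intro that) (auto simp: less_imp_le)
qed

lemma measurable_transport_cost [measurable]:
  "(\<lambda>x. ennreal (norm (fst x - snd x) powr q)) \<in> borel_measurable (borel_bar L \<Otimes>\<^sub>M borel_bar L)"
proof -
  have 1: "(\<lambda>x. fst x) \<in> borel_bar L \<Otimes>\<^sub>M borel_bar L \<rightarrow>\<^sub>M borel"
    using measurable_compose[OF measurable_fst id_borel_bar] by simp
  have 2: "(\<lambda>x. snd x) \<in> borel_bar L \<Otimes>\<^sub>M borel_bar L \<rightarrow>\<^sub>M borel"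
    using measurable_compose[OF measurable_snd id_borel_bar] by simp
  note [measurable] = 1 2
  show ?thesis by measurable
qed

lemma measurable_id_borel_bar_pair:
  "(\<lambda>x. x) \<in> borel_bar L \<Otimes>\<^sub>M borel_bar L \<rightarrow>\<^sub>M borel"
proof -
  have 1: "(\<lambda>x. fst x) \<in> borel_bar L \<Otimes>\<^sub>M borel_bar L \<rightarrow>\<^sub>M borel"
    using measurable_compose[OF measurable_fst id_borel_bar] by simp
  have 2: "(\<lambda>x. snd x) \<in> borel_bar L \<Otimes>\<^sub>M borel_bar L \<rightarrow>\<^sub>M borel"
    using measurable_compose[OF measurable_snd id_borel_bar] by simp
  note [measurable] = 1 2
  have "(\<lambda>x. (fst x, snd x)) \<in> borel_bar L \<Otimes>\<^sub>M borel_bar L \<rightarrow>\<^sub>M borel \<Otimes>\<^sub>M borel" by measurable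
  then show ?thesis by (simp add: borel_prod)
qed

text \<open>A coupling may be assembled from finitely many scaled pieces; only the sums of their marginals
  inside \<open>Omega L\<close> matter, since couplings are not constrained on the diagonal.\<close>

lemma partial_ot_le_sum:
  assumes fin: "finite I" and c: "\<And>i. i \<in> I \<Longrightarrow> 0 \<le> c i"
    and \<pi>: "\<And>i. i \<in> I \<Longrightarrow> finite_measure (\<pi> i)"
      "\<And>i. i \<in> I \<Longrightarrow> sets (\<pi> i) = sets (borel_bar L \<Otimes>\<^sub>M borel_bar L)"
    and \<nu>: "finite_measure \<nu>" "finite_measure \<xi>"
    and 1: "\<And>A. A \<in> sets borel \<Longrightarrow> A \<subseteq> Omega L \<Longrightarrow>
       measure \<nu> A = (\<Sum>i\<in>I. c i * measure (\<pi> i) (A \<times> Omega_bar L))"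
    and 2: "\<And>A. A \<in> sets borel \<Longrightarrow> A \<subseteq> Omega L \<Longrightarrow>
       measure \<xi> A = (\<Sum>i\<in>I. c i * measure (\<pi> i) (Omega_bar L \<times> A))"
    and t: "(\<Sum>i\<in>I. ennreal (c i) * transport_cost q (\<pi> i)) \<le> t"
  shows "partial_ot L q \<nu> \<xi> \<le> t"
proof -
  let ?N = "borel_bar L \<Otimes>\<^sub>M borel_bar L"
  define \<pi>' where "\<pi>' = sum_measure ?N I (\<lambda>i. scale_measure (ennreal (c i)) (\<pi> i))"
  have em: "emeasure \<pi>' B = ennreal (\<Sum>i\<in>I. c i * measure (\<pi> i) B)" if "B \<in> sets ?N" for B
  proof -
    have "emeasure \<pi>' B = (\<Sum>i\<in>I. ennreal (c i) * emeasure (\<pi> i) B)"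
      unfolding \<pi>'_def using \<pi> that by (subst emeasure_sum_measure) auto
    also have "\<dots> = (\<Sum>i\<in>I. ennreal (c i * measure (\<pi> i) B))"
      using \<pi>(1) c by (intro sum.cong refl) (simp add: finite_measure.emeasure_eq_measure ennreal_mult)
    also have "\<dots> = ennreal (\<Sum>i\<in>I. c i * measure (\<pi> i) B)"
      using c by (intro sum_ennreal) auto
    finally show ?thesis .
  qed
  have sp: "space \<pi>' = space ?N" and st: "sets \<pi>' = sets ?N" by (simp_all add: \<pi>'_def)
  have "finite_measure \<pi>'"
    by (intro finite_measureI) (simp only: sp em[OF sets.top], simp)
  moreover have "emeasure \<pi>' (A \<times> Omega_bar L) = emeasure \<nu> A"
    "emeasure \<pi>' (Omega_bar L \<times> A) = emeasure \<xi> A" if A: "A \<in> sets borel" "A \<subseteq> Omega L" for A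
  proof -
    have "A \<in> sets (borel_bar L)" using A Omega_subset by (auto simp: sets_borel_bar)
    then have "A \<times> Omega_bar L \<in> sets ?N" "Omega_bar L \<times> A \<in> sets ?N" by auto
    then show "emeasure \<pi>' (A \<times> Omega_bar L) = emeasure \<nu> A"
      "emeasure \<pi>' (Omega_bar L \<times> A) = emeasure \<xi> A"
      using \<nu> 1[OF A] 2[OF A] by (simp_all add: em finite_measure.emeasure_eq_measure)
  qed
  ultimately have "\<pi>' \<in> adm L \<nu> \<xi>" by (simp add: adm_def st)
  moreover have "transport_cost q \<pi>' \<le> t"
  proof -
    have "transport_cost q \<pi>' = (\<Sum>i\<in>I. ennreal (c i) * transport_cost q (\<pi> i))"
      unfolding transport_cost_def \<pi>'_def using \<pi>
      by (subst nn_integral_sum_measure) (simp_all add: nn_integral_scale_measure cong: measurable_cong_sets)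
    then show ?thesis using t by simp
  qed
  ultimately show ?thesis unfolding partial_ot_def by (blast intro: INF_lower2)
qed

section \<open>Dyadic cells\<close>

lemma nn_integral_pair_times:
  assumes "sigma_finite_measure N" "f \<in> borel_measurable M" "g \<in> borel_measurable N"
  shows "(\<integral>\<^sup>+x. f (fst x) * g (snd x) \<partial>(M \<Otimes>\<^sub>M N)) = (\<integral>\<^sup>+x. f x \<partial>M) * (\<integral>\<^sup>+y. g y \<partial>N)"
proof -
  interpret sigma_finite_measure N by fact
  note [measurable] = assms(2,3)
  have "(\<integral>\<^sup>+x. f (fst x) * g (snd x) \<partial>(M \<Otimes>\<^sub>M N)) = (\<integral>\<^sup>+x. \<integral>\<^sup>+y. f x * g y \<partial>N \<partial>M)"
    by (subst nn_integral_fst[symmetric]) auto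
  also have "\<dots> = (\<integral>\<^sup>+x. f x * (\<integral>\<^sup>+y. g y \<partial>N) \<partial>M)"
    by (simp add: nn_integral_cmult)
  also have "\<dots> = (\<integral>\<^sup>+x. f x \<partial>M) * (\<integral>\<^sup>+y. g y \<partial>N)"
    by (simp add: nn_integral_multc)
  finally show ?thesis .
qed

text \<open>Used to bound the costs of the pieces of a coupling over disjoint cells by the cost of the
  whole coupling.\<close>

lemma sum_set_nn_integral_le:
  assumes "finite I" "disjoint_family_on B I" "\<And>i. i \<in> I \<Longrightarrow> B i \<in> sets M" "f \<in> borel_measurable M"
  shows "(\<Sum>i\<in>I. \<integral>\<^sup>+x. indicator (B i) x * f x \<partial>M) \<le> (\<integral>\<^sup>+x. f x \<partial>M)"
proof -
  have "(\<Sum>i\<in>I. \<integral>\<^sup>+x. indicator (B i) x * f x \<partial>M) = (\<integral>\<^sup>+x. (\<Sum>i\<in>I. indicator (B i) x * f x) \<partial>M)"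
    using assms by (intro nn_integral_sum[symmetric]) auto
  also have "\<dots> = (\<integral>\<^sup>+x. indicator (\<Union>i\<in>I. B i) x * f x \<partial>M)"
    using assms(1,2) by (intro nn_integral_cong)
      (simp add: indicator_UN_disjoint flip: sum_distrib_right)
  also have "\<dots> \<le> (\<integral>\<^sup>+x. f x \<partial>M)"
    by (intro nn_integral_mono) (auto simp: indicator_def)
  finally show ?thesis .
qed

lemma powr_add_le:
  fixes a b c q :: real
  assumes "0 \<le> a" "0 \<le> b" "0 \<le> c" "0 < q"
  shows "(a + b + c) powr q \<le> 3 powr q * (a powr q + b powr q + c powr q)"
proof -
  define m where "m = max a (max b c)"
  have "(a + b + c) powr q \<le> (3 * m) powr q"
    using assms by (intro powr_mono2) (auto simp: m_def)
  also have "\<dots> = 3 powr q * m powr q" by (rule powr_mult)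
  also have "m powr q \<le> a powr q + b powr q + c powr q"
    by (auto simp: m_def max_def)
  finally show ?thesis by simp
qed

definition cell_index :: "real \<Rightarrow> nat \<Rightarrow> real \<times> real \<Rightarrow> int \<times> int" where
  "cell_index L j u = (\<lfloor>2 ^ j * fst u / (2 * L)\<rfloor>, \<lfloor>2 ^ j * snd u / (2 * L)\<rfloor>)"

definition cell_indices :: "nat \<Rightarrow> (int \<times> int) set" where
  "cell_indices j = {0..<2 ^ j} \<times> {0..<2 ^ j}"

text \<open>The dyadic squares of side \<open>2 * L / 2 ^ j\<close>, cut down to \<open>Omega L\<close>. With side \<open>2 * L\<close> instead
  of \<open>L\<close> the closed upper boundary needs no squares of its own, and there are exactly \<open>4 ^ j\<close>.\<close>

definition cell :: "real \<Rightarrow> nat \<Rightarrow> int \<times> int \<Rightarrow> (real \<times> real) set" where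
  "cell L j k = {u \<in> Omega L. cell_index L j u = k}"

lemma finite_cell_indices [simp]: "finite (cell_indices j)"
  by (simp add: cell_indices_def)

lemma card_cell_indices: "card (cell_indices j) = 4 ^ j"
  by (simp add: cell_indices_def nat_power_eq flip: power_mult_distrib)

lemma cell_subset: "cell L j k \<subseteq> Omega L"
  by (auto simp: cell_def)

lemma disjoint_cells: "disjoint_family_on (cell L j) I"
  by (auto simp: disjoint_family_on_def cell_def)

lemma cell_borel [measurable]: "cell L j k \<in> sets borel"
proof -
  have m: "(\<lambda>u. \<lfloor>fst u * c\<rfloor>) \<in> (borel :: (real \<times> real) measure) \<rightarrow>\<^sub>M count_space UNIV"
    "(\<lambda>u. \<lfloor>snd u * c\<rfloor>) \<in> (borel :: (real \<times> real) measure) \<rightarrow>\<^sub>M count_space UNIV" for c :: real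
    by (intro measurable_compose[OF _ measurable_real_floor] borel_measurable_continuous_onI
        continuous_intros)+
  have e: "2 ^ j * x / (2 * L) = x * (2 ^ j / (2 * L))" for x by simp
  have "cell L j k = Omega L \<inter> ((\<lambda>u. \<lfloor>fst u * (2 ^ j / (2 * L))\<rfloor>) -` {fst k} \<inter> space borel) \<inter>
      ((\<lambda>u. \<lfloor>snd u * (2 ^ j / (2 * L))\<rfloor>) -` {snd k} \<inter> space borel)"
    by (auto simp: cell_def cell_index_def e)
  also have "\<dots> \<in> sets borel"
    by (intro sets.Int Omega_borel measurable_sets[OF m(1)] measurable_sets[OF m(2)]) simp_all
  finally show ?thesis .
qed

lemma cell_borel_bar [measurable]: "cell L j k \<in> sets (borel_bar L)"
  using cell_subset Omega_subset by (fastforce simp: sets_borel_bar)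

lemma cell_index_mem:
  assumes "L > 0" "u \<in> Omega L"
  shows "cell_index L j u \<in> cell_indices j"
proof -
  have "0 \<le> fst u" "fst u \<le> L" "0 \<le> snd u" "snd u \<le> L" using assms(2) by (auto simp: Omega_def)
  moreover have "\<lfloor>2 ^ j * x / (2 * L)\<rfloor> \<in> {0..<2 ^ j}" if x: "0 \<le> x" "x \<le> L" for x
  proof -
    have "2 ^ j * x / (2 * L) < 2 ^ j"
      using x assms(1) by (simp add: field_simps)
    then show ?thesis using x assms(1) by (simp add: floor_less_iff)
  qed
  ultimately show ?thesis by (auto simp: cell_index_def cell_indices_def)
qed

lemma Omega_eq_UN_cell: "L > 0 \<Longrightarrow> Omega L = (\<Union>k\<in>cell_indices j. cell L j k)"
  using cell_index_mem by (auto simp: cell_def)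

lemma cell_diam:
  assumes "L > 0" "u \<in> cell L j k" "v \<in> cell L j k"
  shows "norm (u - v) \<le> 4 * L / 2 ^ j"
proof -
  have *: "\<bar>x - y\<bar> \<le> 2 * L / 2 ^ j" if "\<lfloor>2 ^ j * x / (2 * L)\<rfloor> = \<lfloor>2 ^ j * y / (2 * L)\<rfloor>" for x y :: real
  proof -
    have "\<bar>2 ^ j * x / (2 * L) - 2 ^ j * y / (2 * L)\<bar> < 1" using that by linarith
    also have "2 ^ j * x / (2 * L) - 2 ^ j * y / (2 * L) = (x - y) * (2 ^ j / (2 * L))"
      by (simp add: left_diff_distrib diff_divide_distrib mult.commute)
    finally have "\<bar>x - y\<bar> * (2 ^ j / (2 * L)) < 1" using assms(1) by (simp add: abs_mult)
    then show ?thesis using assms(1) by (simp add: field_simps)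
  qed
  have "norm (u - v) \<le> \<bar>fst u - fst v\<bar> + \<bar>snd u - snd v\<bar>"
    using norm_Pair_le[of "fst u - fst v" "snd u - snd v"] by (simp add: fst_diff[symmetric] snd_diff[symmetric] del: fst_diff snd_diff)
  also have "\<dots> \<le> 2 * L / 2 ^ j + 2 * L / 2 ^ j"
    using assms by (intro add_mono *) (auto simp: cell_def cell_index_def)
  finally show ?thesis by simp
qed

text \<open>The grids are nested, since \<open>\<lfloor>x / m\<rfloor> = \<lfloor>x\<rfloor> div m\<close> for positive integers \<open>m\<close>.\<close>

lemma cell_index_coarser:
  assumes "i \<le> j" "cell_index L j u = cell_index L j v"
  shows "cell_index L i u = cell_index L i v"
proof -
  have *: "\<lfloor>2 ^ i * x / (2 * L)\<rfloor> = \<lfloor>2 ^ j * x / (2 * L)\<rfloor> div 2 ^ (j - i)" for x :: real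
  proof -
    have "2 ^ i * x / (2 * L) = (2 ^ j * x / (2 * L)) / real_of_int (2 ^ (j - i))"
      using assms(1) power_add[of "2::real" i "j - i"] by (simp add: field_simps)
    then show ?thesis by (simp only: floor_divide_real_eq_div zero_le_power zero_le_numeral)
  qed
  show ?thesis using assms(2) by (simp add: cell_index_def *)
qed

lemma measure_eq_sum_cells:
  assumes "L > 0" "finite_measure \<nu>" "sets \<nu> = sets (borel_bar L)" "A \<in> sets borel" "A \<subseteq> Omega L"
  shows "measure \<nu> A = (\<Sum>k\<in>cell_indices j. measure \<nu> (A \<inter> cell L j k))"
proof -
  interpret finite_measure \<nu> by fact
  have "A \<inter> cell L j k \<in> sets \<nu>" for k
    using assms(3-5) Omega_subset by (auto simp: sets_borel_bar)
  then have "measure \<nu> (\<Union>k\<in>cell_indices j. A \<inter> cell L j k)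
      = (\<Sum>k\<in>cell_indices j. measure \<nu> (A \<inter> cell L j k))"
    by (intro finite_measure_finite_Union) (auto simp: disjoint_family_on_def cell_def)
  also have "(\<Union>k\<in>cell_indices j. A \<inter> cell L j k) = A"
    using Omega_eq_UN_cell[OF assms(1), of j] assms(5) by auto
  finally show ?thesis .
qed

section \<open>Composing couplings\<close>

text \<open>Two couplings are composed through a set \<open>Q\<close> of the middle space by making them independent
  there. This avoids disintegrating them, at the price of an error of the size of \<open>Q\<close>.\<close>

definition glue :: "real \<Rightarrow> (real \<times> real) set \<Rightarrow> ((real \<times> real) \<times> (real \<times> real)) measure
    \<Rightarrow> ((real \<times> real) \<times> (real \<times> real)) measure \<Rightarrow> ((real \<times> real) \<times> (real \<times> real)) measure" where
  "glue L Q \<pi>1 \<pi>2 = distr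
     (density (\<pi>1 \<Otimes>\<^sub>M \<pi>2)
       (\<lambda>x. indicator (Omega_bar L \<times> Q) (fst x) * indicator (Q \<times> Omega_bar L) (snd x)))
     (borel_bar L \<Otimes>\<^sub>M borel_bar L) (\<lambda>x. (fst (fst x), snd (snd x)))"

context
  fixes L :: real and Q :: "(real \<times> real) set" and \<pi>1 \<pi>2 :: "((real \<times> real) \<times> (real \<times> real)) measure"
  assumes Q: "Q \<in> sets (borel_bar L)"
    and fin: "finite_measure \<pi>1" "finite_measure \<pi>2"
    and s1: "sets \<pi>1 = sets (borel_bar L \<Otimes>\<^sub>M borel_bar L)"
    and s2: "sets \<pi>2 = sets (borel_bar L \<Otimes>\<^sub>M borel_bar L)"
begin

lemma nn_integral_glue:
  assumes "f \<in> borel_measurable (borel_bar L \<Otimes>\<^sub>M borel_bar L)"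
  shows "(\<integral>\<^sup>+x. f x \<partial>glue L Q \<pi>1 \<pi>2) = (\<integral>\<^sup>+x. indicator (Omega_bar L \<times> Q) (fst x) *
    indicator (Q \<times> Omega_bar L) (snd x) * f (fst (fst x), snd (snd x)) \<partial>(\<pi>1 \<Otimes>\<^sub>M \<pi>2))"
proof -
  note [measurable_cong] = s1 s2
  note [measurable] = Q assms
  have 1: "(\<lambda>x. indicator (Omega_bar L \<times> Q) (fst x) * indicator (Q \<times> Omega_bar L) (snd x) :: ennreal)
      \<in> borel_measurable (\<pi>1 \<Otimes>\<^sub>M \<pi>2)" by measurable
  have 2: "(\<lambda>x. f (fst (fst x), snd (snd x))) \<in> borel_measurable (\<pi>1 \<Otimes>\<^sub>M \<pi>2)" by measurable
  show ?thesis
    unfolding glue_def by (subst nn_integral_distr, measurable, simp add: nn_integral_density[OF 1 2])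
qed

lemma emeasure_glue:
  assumes "A \<in> sets (borel_bar L)" "B \<in> sets (borel_bar L)"
  shows "emeasure (glue L Q \<pi>1 \<pi>2) (A \<times> B) = emeasure \<pi>1 (A \<times> Q) * emeasure \<pi>2 (Q \<times> B)"
proof -
  note [measurable_cong] = s1 s2
  note [measurable] = Q assms
  have AB: "A \<subseteq> Omega_bar L" "B \<subseteq> Omega_bar L" using assms by (auto simp: sets_borel_bar)
  have "emeasure (glue L Q \<pi>1 \<pi>2) (A \<times> B) = (\<integral>\<^sup>+x. indicator (A \<times> B) x \<partial>glue L Q \<pi>1 \<pi>2)"
    by (intro nn_integral_indicator[symmetric]) (simp add: glue_def)
  also have "\<dots> = (\<integral>\<^sup>+x. indicator (A \<times> Q) (fst x) * indicator (Q \<times> B) (snd x) \<partial>(\<pi>1 \<Otimes>\<^sub>M \<pi>2))"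
    by (subst nn_integral_glue) (use AB in \<open>auto intro!: nn_integral_cong simp: indicator_def\<close>)
  also have "\<dots> = emeasure \<pi>1 (A \<times> Q) * emeasure \<pi>2 (Q \<times> B)"
    using fin by (subst nn_integral_pair_times) (simp_all add: finite_measure_def)
  finally show ?thesis .
qed

lemma finite_glue: "finite_measure (glue L Q \<pi>1 \<pi>2)"
proof (rule finite_measureI)
  have "space (glue L Q \<pi>1 \<pi>2) = Omega_bar L \<times> Omega_bar L"
    by (simp add: glue_def space_pair_measure)
  then show "emeasure (glue L Q \<pi>1 \<pi>2) (space (glue L Q \<pi>1 \<pi>2)) \<noteq> \<infinity>"
    using fin by (simp add: emeasure_glue finite_measure.emeasure_eq_measure flip: ennreal_mult)
qed

lemma measure_glue:
  assumes "A \<in> sets (borel_bar L)" "B \<in> sets (borel_bar L)"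
  shows "measure (glue L Q \<pi>1 \<pi>2) (A \<times> B) = measure \<pi>1 (A \<times> Q) * measure \<pi>2 (Q \<times> B)"
  using emeasure_glue[OF assms] by (simp add: measure_def enn2real_mult)

lemma transport_cost_glue:
  assumes \<delta>: "\<And>u v. u \<in> Q \<Longrightarrow> v \<in> Q \<Longrightarrow> norm (u - v) \<le> \<delta>" "0 \<le> \<delta>" and q: "q > 0"
  shows "transport_cost q (glue L Q \<pi>1 \<pi>2) \<le> ennreal (3 powr q) *
    ((\<integral>\<^sup>+x. indicator (Omega_bar L \<times> Q) x * ennreal (norm (fst x - snd x) powr q) \<partial>\<pi>1)
        * emeasure \<pi>2 (Q \<times> Omega_bar L)
     + ennreal (\<delta> powr q) * (emeasure \<pi>1 (Omega_bar L \<times> Q) * emeasure \<pi>2 (Q \<times> Omega_bar L))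
     + emeasure \<pi>1 (Omega_bar L \<times> Q)
        * (\<integral>\<^sup>+x. indicator (Q \<times> Omega_bar L) x * ennreal (norm (fst x - snd x) powr q) \<partial>\<pi>2))"
proof -
  note [measurable_cong] = s1 s2
  note [measurable] = Q
  let ?c = "\<lambda>x::(real \<times> real) \<times> (real \<times> real). ennreal (norm (fst x - snd x) powr q)"
  let ?a = "\<lambda>x. indicator (Omega_bar L \<times> Q) x :: ennreal"
  let ?b = "\<lambda>x. indicator (Q \<times> Omega_bar L) x :: ennreal"
  have [measurable]: "?a \<in> borel_measurable \<pi>1" "?b \<in> borel_measurable \<pi>2"
    "?c \<in> borel_measurable \<pi>1" "?c \<in> borel_measurable \<pi>2" by measurable
  have sf: "sigma_finite_measure \<pi>2" using fin(2) by (simp add: finite_measure_def)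
  have pt: "?a x * ?b y * ?c (fst x, snd y) \<le> ennreal (3 powr q) *
     (?a x * ?c x * ?b y + ennreal (\<delta> powr q) * (?a x * ?b y) + ?a x * (?b y * ?c y))" for x y
  proof (cases "x \<in> Omega_bar L \<times> Q \<and> y \<in> Q \<times> Omega_bar L")
    case True
    have "norm (fst x - snd y) \<le> norm (fst x - snd x) + norm (snd x - fst y) + norm (fst y - snd y)"
      using norm_triangle_ineq[of "fst x - snd x" "snd x - snd y"]
        norm_triangle_ineq[of "snd x - fst y" "fst y - snd y"] by simp
    also have "norm (snd x - fst y) \<le> \<delta>" using True by (intro \<delta>) auto
    finally have "norm (fst x - snd y) powr q \<le> (norm (fst x - snd x) + \<delta> + norm (fst y - snd y)) powr q"
      using q by (intro powr_mono2) auto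
    also have "\<dots> \<le> 3 powr q * (norm (fst x - snd x) powr q + \<delta> powr q + norm (fst y - snd y) powr q)"
      using q \<delta> by (intro powr_add_le) auto
    finally have "ennreal (norm (fst x - snd y) powr q) \<le>
       ennreal (3 powr q * (norm (fst x - snd x) powr q + \<delta> powr q + norm (fst y - snd y) powr q))"
      by (rule ennreal_leI)
    then show ?thesis using True by (simp add: ennreal_mult ennreal_plus)
  qed (auto simp: indicator_def)
  have "transport_cost q (glue L Q \<pi>1 \<pi>2) = (\<integral>\<^sup>+x. ?a (fst x) * ?b (snd x) * ?c (fst (fst x), snd (snd x)) \<partial>(\<pi>1 \<Otimes>\<^sub>M \<pi>2))"
    unfolding transport_cost_def by (subst nn_integral_glue) simp_all
  also have "\<dots> \<le> (\<integral>\<^sup>+x. ennreal (3 powr q) * (?a (fst x) * ?c (fst x) * ?b (snd x)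
      + ennreal (\<delta> powr q) * (?a (fst x) * ?b (snd x)) + ?a (fst x) * (?b (snd x) * ?c (snd x))) \<partial>(\<pi>1 \<Otimes>\<^sub>M \<pi>2))"
    by (intro nn_integral_mono pt)
  also have "\<dots> = ennreal (3 powr q) * ((\<integral>\<^sup>+x. ?a (fst x) * ?c (fst x) * ?b (snd x) \<partial>(\<pi>1 \<Otimes>\<^sub>M \<pi>2))
      + ennreal (\<delta> powr q) * (\<integral>\<^sup>+x. ?a (fst x) * ?b (snd x) \<partial>(\<pi>1 \<Otimes>\<^sub>M \<pi>2))
      + (\<integral>\<^sup>+x. ?a (fst x) * (?b (snd x) * ?c (snd x)) \<partial>(\<pi>1 \<Otimes>\<^sub>M \<pi>2)))"
    by (simp add: nn_integral_cmult nn_integral_add)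
  also have "(\<integral>\<^sup>+x. ?a (fst x) * ?c (fst x) * ?b (snd x) \<partial>(\<pi>1 \<Otimes>\<^sub>M \<pi>2))
      = (\<integral>\<^sup>+x. ?a x * ?c x \<partial>\<pi>1) * emeasure \<pi>2 (Q \<times> Omega_bar L)"
    by (subst nn_integral_pair_times[OF sf, of "\<lambda>x. ?a x * ?c x"]) simp_all
  also have "(\<integral>\<^sup>+x. ?a (fst x) * ?b (snd x) \<partial>(\<pi>1 \<Otimes>\<^sub>M \<pi>2))
      = emeasure \<pi>1 (Omega_bar L \<times> Q) * emeasure \<pi>2 (Q \<times> Omega_bar L)"
    by (subst nn_integral_pair_times[OF sf]) simp_all
  also have "(\<integral>\<^sup>+x. ?a (fst x) * (?b (snd x) * ?c (snd x)) \<partial>(\<pi>1 \<Otimes>\<^sub>M \<pi>2))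
      = emeasure \<pi>1 (Omega_bar L \<times> Q) * (\<integral>\<^sup>+x. ?b x * ?c x \<partial>\<pi>2)"
    by (subst nn_integral_pair_times[OF sf, of _ _ "\<lambda>x. ?b x * ?c x"]) simp_all
  finally show ?thesis by (simp add: mult_ac)
qed

end

lemma density_indicator_pair:
  assumes "finite_measure \<pi>" "sets \<pi> = sets N" "B \<in> sets N"
  shows "finite_measure (density \<pi> (indicator B))"
    and "C \<in> sets N \<Longrightarrow> measure (density \<pi> (indicator B)) C = measure \<pi> (B \<inter> C)"
proof -
  interpret finite_measure \<pi> by fact
  have B: "B \<in> sets \<pi>" using assms by simp
  have e: "emeasure (density \<pi> (indicator B)) C = emeasure \<pi> (B \<inter> C)" if "C \<in> sets \<pi>" for C
    using B that by (simp add: emeasure_density indicator_inter_arith[symmetric])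
  show "finite_measure (density \<pi> (indicator B))"
    by (rule finite_measureI) (simp add: e)
  show "measure (density \<pi> (indicator B)) C = measure \<pi> (B \<inter> C)" if "C \<in> sets N"
    using e[of C] that assms(2) by (simp add: measure_def)
qed

lemma transport_cost_density_indicator:
  assumes "sets \<pi> = sets (borel_bar L \<Otimes>\<^sub>M borel_bar L)" "B \<in> sets (borel_bar L \<Otimes>\<^sub>M borel_bar L)"
  shows "transport_cost q (density \<pi> (indicator B)) =
    (\<integral>\<^sup>+x. indicator B x * ennreal (norm (fst x - snd x) powr q) \<partial>\<pi>)"
proof -
  note [measurable_cong] = assms(1)
  note [measurable] = assms(2)
  show ?thesis unfolding transport_cost_def by (subst nn_integral_density) simp_all
qed

lemma adm_measure:
  assumes "\<pi> \<in> adm L \<nu> \<xi>" "A \<in> sets borel" "A \<subseteq> Omega L"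
  shows "measure \<pi> (A \<times> Omega_bar L) = measure \<nu> A" "measure \<pi> (Omega_bar L \<times> A) = measure \<xi> A"
  using assms by (auto simp: adm_def measure_def)

text \<open>The mesh of the grid can be chosen so fine that the gluing error is negligible.\<close>

lemma exists_level:
  fixes c q e m :: real
  assumes "0 < q" "0 < e" "0 \<le> m" "0 < c"
  shows "\<exists>j. (c / 2 ^ j) powr q * m \<le> e"
proof -
  have "(\<lambda>j. (c * (1/2) ^ j) powr q * m) \<longlonglongrightarrow> (c * 0) powr q * m"
    using assms by (intro tendsto_intros LIMSEQ_power_zero tendsto_powr') auto
  then have "\<forall>\<^sub>F j in sequentially. (c * (1/2) ^ j) powr q * m < e"
    using assms by (intro order_tendstoD(2)) auto
  then obtain j where "(c * (1/2) ^ j) powr q * m < e"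
    by (auto simp: eventually_sequentially)
  then show ?thesis by (intro exI[of _ j]) (simp add: power_divide)
qed

text \<open>The diagonal takes part as one further cell.\<close>

lemma measure_times_cells:
  assumes L: "L > 0" and f: "finite_measure \<pi>" and s: "sets \<pi> = sets (borel_bar L \<Otimes>\<^sub>M borel_bar L)"
    and A: "A \<in> sets (borel_bar L)"
  shows "measure \<pi> (A \<times> Omega_bar L) =
      measure \<pi> (A \<times> Diag L) + (\<Sum>k\<in>cell_indices j. measure \<pi> (A \<times> cell L j k))"
    and "measure \<pi> (Omega_bar L \<times> A) =
      measure \<pi> (Diag L \<times> A) + (\<Sum>k\<in>cell_indices j. measure \<pi> (cell L j k \<times> A))"
proof -
  interpret finite_measure \<pi> by fact
  let ?U = "\<lambda>k. cell L j k" and ?K = "cell_indices j"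
  have O: "Omega_bar L = Diag L \<union> (\<Union>k\<in>?K. ?U k)"
    using Omega_eq_UN_cell[OF L, of j] Omega_subset by (auto simp: Diag_eq)
  have S: "A \<times> Diag L \<in> sets \<pi>" "Diag L \<times> A \<in> sets \<pi>"
    "A \<times> ?U k \<in> sets \<pi>" "?U k \<times> A \<in> sets \<pi>" for k
    using A by (simp_all add: s)
  have d: "disjoint_family_on (\<lambda>k. A \<times> ?U k) ?K" "disjoint_family_on (\<lambda>k. ?U k \<times> A) ?K"
    by (auto simp: disjoint_family_on_def cell_def)
  have "A \<times> Diag L \<inter> (\<Union>k\<in>?K. A \<times> ?U k) = {}" "Diag L \<times> A \<inter> (\<Union>k\<in>?K. ?U k \<times> A) = {}"
    by (auto simp: Diag_eq cell_def)
  then have "measure \<pi> (A \<times> Diag L \<union> (\<Union>k\<in>?K. A \<times> ?U k)) =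
      measure \<pi> (A \<times> Diag L) + measure \<pi> (\<Union>k\<in>?K. A \<times> ?U k)"
    "measure \<pi> (Diag L \<times> A \<union> (\<Union>k\<in>?K. ?U k \<times> A)) =
      measure \<pi> (Diag L \<times> A) + measure \<pi> (\<Union>k\<in>?K. ?U k \<times> A)"
    using S by (auto intro!: finite_measure_Union)
  moreover have "measure \<pi> (\<Union>k\<in>?K. A \<times> ?U k) = (\<Sum>k\<in>?K. measure \<pi> (A \<times> ?U k))"
    "measure \<pi> (\<Union>k\<in>?K. ?U k \<times> A) = (\<Sum>k\<in>?K. measure \<pi> (?U k \<times> A))"
    using S d by (auto intro!: finite_measure_finite_Union)
  moreover have "A \<times> Omega_bar L = A \<times> Diag L \<union> (\<Union>k\<in>?K. A \<times> ?U k)"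
    "Omega_bar L \<times> A = Diag L \<times> A \<union> (\<Union>k\<in>?K. ?U k \<times> A)"
    by (subst O; auto)+
  ultimately show "measure \<pi> (A \<times> Omega_bar L) =
      measure \<pi> (A \<times> Diag L) + (\<Sum>k\<in>cell_indices j. measure \<pi> (A \<times> cell L j k))"
    "measure \<pi> (Omega_bar L \<times> A) =
      measure \<pi> (Diag L \<times> A) + (\<Sum>k\<in>cell_indices j. measure \<pi> (cell L j k \<times> A))"
    by simp_all
qed

text \<open>A triangle inequality up to a factor. The couplings are glued cell by cell along a fine grid of
  the middle measure, and the mesh tends to zero. Mass that the first coupling sends to the diagonal,
  or that the second one draws from it, keeps its partner.\<close>

lemma partial_ot_triangle:
  assumes L: "L > 0" and q: "q > 0"
    and fin: "finite_measure \<nu>" "finite_measure \<xi>" "finite_measure \<zeta>"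
    and s\<xi>: "sets \<xi> = sets (borel_bar L)"
    and a: "partial_ot L q \<nu> \<xi> \<le> ennreal a" "0 \<le> a"
    and b: "partial_ot L q \<xi> \<zeta> \<le> ennreal b" "0 \<le> b"
  shows "partial_ot L q \<nu> \<zeta> \<le> ennreal (3 powr q * (a + b))"
proof (rule ennreal_le_epsilon)
  fix e :: real assume e: "e > 0"
  define d where "d = e / (3 * 3 powr q)"
  have d: "d > 0" using e by (simp add: d_def)
  interpret \<xi>: finite_measure \<xi> by fact
  let ?N = "borel_bar L \<Otimes>\<^sub>M borel_bar L"
  let ?c = "\<lambda>x::(real \<times> real) \<times> (real \<times> real). ennreal (norm (fst x - snd x) powr q)"
  obtain \<pi>1 where \<pi>1: "\<pi>1 \<in> adm L \<nu> \<xi>" and c1: "transport_cost q \<pi>1 \<le> ennreal (a + d)"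
    using partial_ot_less_coupling[OF a d] .
  obtain \<pi>2 where \<pi>2: "\<pi>2 \<in> adm L \<xi> \<zeta>" and c2: "transport_cost q \<pi>2 \<le> ennreal (b + d)"
    using partial_ot_less_coupling[OF b d] .
  have f: "finite_measure \<pi>1" "finite_measure \<pi>2" and s1: "sets \<pi>1 = sets ?N" and s2: "sets \<pi>2 = sets ?N"
    using \<pi>1 \<pi>2 by (auto simp: adm_def)
  obtain j where j: "(4 * L / 2 ^ j) powr q * measure \<xi> (Omega L) \<le> d"
    using exists_level[OF q d, of "measure \<xi> (Omega L)" "4 * L"] L by auto
  define \<delta> where "\<delta> = 4 * L / 2 ^ j"
  have \<delta>: "0 \<le> \<delta>" using L by (simp add: \<delta>_def)
  let ?C = "\<lambda>k. cell L j k" and ?K = "cell_indices j"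
  define m where "m k = measure \<xi> (?C k)" for k
  have m1: "measure \<pi>1 (Omega_bar L \<times> ?C k) = m k" and m2: "measure \<pi>2 (?C k \<times> Omega_bar L) = m k" for k
    using adm_measure[OF \<pi>1 cell_borel cell_subset] adm_measure[OF \<pi>2 cell_borel cell_subset]
    by (simp_all add: m_def)
  have e1: "emeasure \<pi>1 (Omega_bar L \<times> ?C k) = ennreal (m k)"
    and e2: "emeasure \<pi>2 (?C k \<times> Omega_bar L) = ennreal (m k)" for k
    using f m1 m2 by (simp_all add: finite_measure.emeasure_eq_measure)
  \<comment> \<open>Mass that \<open>\<pi>1\<close> sends to the diagonal, mass that \<open>\<pi>2\<close> draws from it, and one glued piece per cell.\<close>
  define \<pi> where "\<pi> i = (case i of None \<Rightarrow> density \<pi>1 (indicator (Omega_bar L \<times> Diag L))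
      | Some None \<Rightarrow> density \<pi>2 (indicator (Diag L \<times> Omega_bar L))
      | Some (Some k) \<Rightarrow> glue L (?C k) \<pi>1 \<pi>2)" for i
  \<comment> \<open>The glued piece of a cell has mass \<open>(m k)\<^sup>2\<close>; a cell without mass gets weight \<open>1 / 0 = 0\<close>.\<close>
  define w where "w i = (case i of Some (Some k) \<Rightarrow> 1 / m k | _ \<Rightarrow> 1)" for i
  let ?I = "insert None (Some ` insert None (Some ` ?K))"
  have sum_I: "(\<Sum>i\<in>?I. g i) = g None + (g (Some None) + (\<Sum>k\<in>?K. g (Some (Some k))))"
    for g :: "(int \<times> int) option option \<Rightarrow> 'z::comm_monoid_add"
    by (simp add: sum.reindex image_image inj_on_def image_iff o_def)
  have D1: "Omega_bar L \<times> Diag L \<in> sets ?N" "Diag L \<times> Omega_bar L \<in> sets ?N" by auto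
  have D2: "Omega_bar L \<times> ?C k \<in> sets ?N" "?C k \<times> Omega_bar L \<in> sets ?N" for k by auto
  show "partial_ot L q \<nu> \<zeta> \<le> ennreal (3 powr q * (a + b)) + ennreal e"
  proof (rule partial_ot_le_sum[where I = ?I and c = w and \<pi> = \<pi>])
    show "finite ?I" by simp
    show "0 \<le> w i" for i by (auto simp: w_def m_def split: option.splits)
    show "finite_measure (\<pi> i)" for i
      using density_indicator_pair(1)[OF f(1) s1 D1(1)] density_indicator_pair(1)[OF f(2) s2 D1(2)]
        finite_glue[OF cell_borel_bar f s1 s2]
      by (auto simp: \<pi>_def split: option.splits)
    show "sets (\<pi> i) = sets ?N" for i
      by (auto simp: \<pi>_def glue_def s1 s2 split: option.splits)
    show "finite_measure \<nu>" "finite_measure \<zeta>" by fact+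
  next
    fix A assume A: "A \<in> sets borel" "A \<subseteq> Omega L"
    then have Ab: "A \<in> sets (borel_bar L)" using Omega_subset by (auto simp: sets_borel_bar)
    have AN: "A \<times> Omega_bar L \<in> sets ?N" "Omega_bar L \<times> A \<in> sets ?N" using Ab by auto
    have Asub: "A \<subseteq> Omega_bar L" "A \<inter> Diag L = {}" using A Omega_subset by (auto simp: Diag_eq)
    have z1: "measure \<pi>1 (A \<times> ?C k) = 0" if "m k = 0" for k
    proof -
      have "measure \<pi>1 (A \<times> ?C k) \<le> measure \<pi>1 (Omega_bar L \<times> ?C k)"
        using f(1) s1 D2 Asub by (intro finite_measure.finite_measure_mono) auto
      then show ?thesis using that m1[of k] by (simp add: measure_le_0_iff)
    qed
    have z2: "measure \<pi>2 (?C k \<times> A) = 0" if "m k = 0" for k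
    proof -
      have "measure \<pi>2 (?C k \<times> A) \<le> measure \<pi>2 (?C k \<times> Omega_bar L)"
        using f(2) s2 D2 Asub by (intro finite_measure.finite_measure_mono) auto
      then show ?thesis using that m2[of k] by (simp add: measure_le_0_iff)
    qed
    have D: "measure (density \<pi>1 (indicator (Omega_bar L \<times> Diag L))) (A \<times> Omega_bar L) = measure \<pi>1 (A \<times> Diag L)"
      "measure (density \<pi>1 (indicator (Omega_bar L \<times> Diag L))) (Omega_bar L \<times> A) = 0"
      "measure (density \<pi>2 (indicator (Diag L \<times> Omega_bar L))) (Omega_bar L \<times> A) = measure \<pi>2 (Diag L \<times> A)"
      "measure (density \<pi>2 (indicator (Diag L \<times> Omega_bar L))) (A \<times> Omega_bar L) = 0"
      using Asub Diag_subset[of L]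
      by (simp_all add: density_indicator_pair(2)[OF f(1) s1 D1(1)] density_indicator_pair(2)[OF f(2) s2 D1(2)]
         AN Times_Int_Times Int_absorb1 Int_absorb2 Int_commute)
    have G: "1 / m k * measure (glue L (?C k) \<pi>1 \<pi>2) (A \<times> Omega_bar L) = measure \<pi>1 (A \<times> ?C k)"
      "1 / m k * measure (glue L (?C k) \<pi>1 \<pi>2) (Omega_bar L \<times> A) = measure \<pi>2 (?C k \<times> A)" for k
      using z1[of k] z2[of k] by (simp_all add: m1 m2
         measure_glue[OF cell_borel_bar f s1 s2 Ab Omega_bar_borel_bar]
         measure_glue[OF cell_borel_bar f s1 s2 Omega_bar_borel_bar Ab])
    have "measure \<nu> A = measure \<pi>1 (A \<times> Diag L) + (\<Sum>k\<in>?K. measure \<pi>1 (A \<times> ?C k))"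
      using adm_measure[OF \<pi>1 A] measure_times_cells[OF L f(1) s1 Ab] by simp
    then show "measure \<nu> A = (\<Sum>i\<in>?I. w i * measure (\<pi> i) (A \<times> Omega_bar L))"
      unfolding sum_I by (simp add: \<pi>_def w_def D G del: times_divide_eq_left mult_1_left)
    have "measure \<zeta> A = measure \<pi>2 (Diag L \<times> A) + (\<Sum>k\<in>?K. measure \<pi>2 (?C k \<times> A))"
      using adm_measure[OF \<pi>2 A] measure_times_cells[OF L f(2) s2 Ab] by simp
    then show "measure \<zeta> A = (\<Sum>i\<in>?I. w i * measure (\<pi> i) (Omega_bar L \<times> A))"
      unfolding sum_I by (simp add: \<pi>_def w_def D G del: times_divide_eq_left mult_1_left)
  next
    let ?C1 = "\<lambda>B. \<integral>\<^sup>+x. indicator B x * ?c x \<partial>\<pi>1" and ?C2 = "\<lambda>B. \<integral>\<^sup>+x. indicator B x * ?c x \<partial>\<pi>2"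
    have cd: "u \<in> ?C k \<Longrightarrow> v \<in> ?C k \<Longrightarrow> norm (u - v) \<le> \<delta>" for u v k
      unfolding \<delta>_def by (rule cell_diam[OF L])
    have g: "ennreal (1 / m k) * transport_cost q (glue L (?C k) \<pi>1 \<pi>2) \<le> ennreal (3 powr q) *
       (?C1 (Omega_bar L \<times> ?C k) + ennreal (\<delta> powr q) * ennreal (m k) + ?C2 (?C k \<times> Omega_bar L))" for k
    proof (cases "m k = 0")
      case False
      then have mk: "m k > 0" by (simp add: m_def zero_less_measure_iff)
      have 1: "ennreal (1 / m k) * ennreal (m k) = 1" using mk by (simp flip: ennreal_mult)
      have "transport_cost q (glue L (?C k) \<pi>1 \<pi>2) \<le> ennreal (3 powr q) *
       (?C1 (Omega_bar L \<times> ?C k) * ennreal (m k) + ennreal (\<delta> powr q) * (ennreal (m k) * ennreal (m k))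
         + ennreal (m k) * ?C2 (?C k \<times> Omega_bar L))"
        by (rule transport_cost_glue[OF cell_borel_bar[of L j k] f s1 s2 _ \<delta> q, unfolded e1 e2])
          (rule cd)
      then have "ennreal (1 / m k) * transport_cost q (glue L (?C k) \<pi>1 \<pi>2) \<le> ennreal (1 / m k) * (ennreal (3 powr q) *
       (?C1 (Omega_bar L \<times> ?C k) * ennreal (m k) + ennreal (\<delta> powr q) * (ennreal (m k) * ennreal (m k))
         + ennreal (m k) * ?C2 (?C k \<times> Omega_bar L)))"
        by (intro mult_left_mono) auto
      also have "\<dots> = (ennreal (1 / m k) * ennreal (m k)) * (ennreal (3 powr q) *
       (?C1 (Omega_bar L \<times> ?C k) + ennreal (\<delta> powr q) * ennreal (m k) + ?C2 (?C k \<times> Omega_bar L)))"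
        by (simp add: distrib_left mult_ac)
      finally show ?thesis by (simp add: 1)
    qed simp
    note [measurable_cong] = s1 s2
    have cm: "?c \<in> borel_measurable \<pi>1" "?c \<in> borel_measurable \<pi>2" by measurable
    have S1: "?C1 (Omega_bar L \<times> Diag L) + (\<Sum>k\<in>?K. ?C1 (Omega_bar L \<times> ?C k)) \<le> ennreal (a + d)"
    proof -
      have "(\<Sum>i\<in>insert None (Some ` ?K). \<integral>\<^sup>+x. indicator (case i of None \<Rightarrow> Omega_bar L \<times> Diag L
         | Some k \<Rightarrow> Omega_bar L \<times> ?C k) x * ?c x \<partial>\<pi>1) \<le> (\<integral>\<^sup>+x. ?c x \<partial>\<pi>1)"
        using cm D1 D2 s1 cell_subset by (intro sum_set_nn_integral_le)
          (auto simp: disjoint_family_on_def Diag_eq cell_def split: option.splits)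
      then show ?thesis using c1 by (simp add: sum.reindex transport_cost_def)
    qed
    have S2: "?C2 (Diag L \<times> Omega_bar L) + (\<Sum>k\<in>?K. ?C2 (?C k \<times> Omega_bar L)) \<le> ennreal (b + d)"
    proof -
      have "(\<Sum>i\<in>insert None (Some ` ?K). \<integral>\<^sup>+x. indicator (case i of None \<Rightarrow> Diag L \<times> Omega_bar L
         | Some k \<Rightarrow> ?C k \<times> Omega_bar L) x * ?c x \<partial>\<pi>2) \<le> (\<integral>\<^sup>+x. ?c x \<partial>\<pi>2)"
        using cm D1 D2 s2 cell_subset by (intro sum_set_nn_integral_le)
          (auto simp: disjoint_family_on_def Diag_eq cell_def split: option.splits)
      then show ?thesis using c2 by (simp add: sum.reindex transport_cost_def)
    qed
    have S3: "(\<Sum>k\<in>?K. ennreal (\<delta> powr q) * ennreal (m k)) \<le> ennreal d"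
    proof -
      have "(\<Sum>k\<in>?K. m k) = measure \<xi> (Omega L)"
        using measure_eq_sum_cells[OF L fin(2) s\<xi> Omega_borel order.refl, of j] cell_subset
        by (simp add: m_def Int_absorb1)
      then have "(\<Sum>k\<in>?K. \<delta> powr q * m k) \<le> d" using j by (simp add: \<delta>_def flip: sum_distrib_left)
      then show ?thesis by (simp add: m_def ennreal_leI flip: ennreal_mult)
    qed
    have one: "1 \<le> ennreal (3 powr q)" using q by (simp add: ge_one_powr_ge_zero)
    have mul: "x \<le> ennreal (3 powr q) * x" for x using mult_right_mono[OF one, of x] by simp
    have "(\<Sum>i\<in>?I. ennreal (w i) * transport_cost q (\<pi> i)) = ?C1 (Omega_bar L \<times> Diag L) + (?C2 (Diag L \<times> Omega_bar L)
        + (\<Sum>k\<in>?K. ennreal (1 / m k) * transport_cost q (glue L (?C k) \<pi>1 \<pi>2)))"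
      unfolding sum_I by (simp add: w_def \<pi>_def transport_cost_density_indicator[OF s1 D1(1)]
          transport_cost_density_indicator[OF s2 D1(2)])
    also have "\<dots> \<le> ennreal (3 powr q) * ?C1 (Omega_bar L \<times> Diag L) + (ennreal (3 powr q) * ?C2 (Diag L \<times> Omega_bar L)
       + (\<Sum>k\<in>?K. ennreal (3 powr q) * (?C1 (Omega_bar L \<times> ?C k) + ennreal (\<delta> powr q) * ennreal (m k)
         + ?C2 (?C k \<times> Omega_bar L))))"
      by (intro add_mono mul sum_mono g)
    also have "\<dots> = ennreal (3 powr q) * ((?C1 (Omega_bar L \<times> Diag L) + (\<Sum>k\<in>?K. ?C1 (Omega_bar L \<times> ?C k)))
       + (\<Sum>k\<in>?K. ennreal (\<delta> powr q) * ennreal (m k))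
       + (?C2 (Diag L \<times> Omega_bar L) + (\<Sum>k\<in>?K. ?C2 (?C k \<times> Omega_bar L))))"
      by (simp add: sum.distrib sum_distrib_left distrib_left add_ac)
    also have "\<dots> \<le> ennreal (3 powr q) * (ennreal (a + d) + ennreal d + ennreal (b + d))"
      by (intro mult_left_mono add_mono S1 S2 S3) auto
    also have "\<dots> = ennreal (3 powr q * (a + b) + 3 * 3 powr q * d)"
      using a b d by (simp add: algebra_simps flip: ennreal_plus ennreal_mult)
    also have "\<dots> = ennreal (3 powr q * (a + b)) + ennreal e"
      using a b e by (simp add: d_def ennreal_plus)
    finally show "(\<Sum>i\<in>?I. ennreal (w i) * transport_cost q (\<pi> i)) \<le> ennreal (3 powr q * (a + b)) + ennreal e" .
  qed
qed

section \<open>A multiscale bound for the transport cost\<close>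

text \<open>Keeps the fraction \<open>s k\<close> of the mass in the cell with index \<open>k\<close>.\<close>

definition thin :: "real \<Rightarrow> nat \<Rightarrow> (int \<times> int \<Rightarrow> real) \<Rightarrow> (real \<times> real) measure \<Rightarrow> (real \<times> real) measure" where
  "thin L j s \<mu> = density \<mu> (\<lambda>u. \<Sum>k\<in>cell_indices j. ennreal (s k) * indicator (cell L j k) u)"

lemma thin:
  assumes f: "finite_measure \<mu>" and s: "sets \<mu> = sets (borel_bar L)" and pos: "\<And>k. 0 \<le> s k"
  shows sets_thin: "sets (thin L j s \<mu>) = sets (borel_bar L)"
    and finite_thin: "finite_measure (thin L j s \<mu>)"
    and measure_thin: "A \<in> sets (borel_bar L) \<Longrightarrow>
      measure (thin L j s \<mu>) A = (\<Sum>k\<in>cell_indices j. s k * measure \<mu> (A \<inter> cell L j k))"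
proof -
  interpret finite_measure \<mu> by fact
  note [measurable_cong] = s
  have e: "emeasure (thin L j s \<mu>) A = ennreal (\<Sum>k\<in>cell_indices j. s k * measure \<mu> (A \<inter> cell L j k))"
    if A[measurable]: "A \<in> sets (borel_bar L)" for A
  proof -
    have A': "A \<in> sets \<mu>" using s by simp
    have C': "cell L j k \<in> sets \<mu>" for k using s by simp
    have "emeasure (thin L j s \<mu>) A =
        (\<integral>\<^sup>+u. (\<Sum>k\<in>cell_indices j. ennreal (s k) * indicator (cell L j k) u) * indicator A u \<partial>\<mu>)"
      unfolding thin_def using A' C'
      by (intro emeasure_density borel_measurable_sum borel_measurable_times_ennreal
          borel_measurable_indicator borel_measurable_const)
    also have "\<dots> = (\<integral>\<^sup>+u. (\<Sum>k\<in>cell_indices j. ennreal (s k) * indicator (A \<inter> cell L j k) u) \<partial>\<mu>)"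
      by (intro nn_integral_cong) (auto simp: sum_distrib_right indicator_def intro!: sum.cong)
    also have "\<dots> = (\<Sum>k\<in>cell_indices j. \<integral>\<^sup>+u. ennreal (s k) * indicator (A \<inter> cell L j k) u \<partial>\<mu>)"
      using A' C' by (intro nn_integral_sum borel_measurable_times_ennreal
          borel_measurable_indicator borel_measurable_const sets.Int)
    also have "\<dots> = (\<Sum>k\<in>cell_indices j. ennreal (s k * measure \<mu> (A \<inter> cell L j k)))"
      using A' C' pos by (intro sum.cong refl)
        (simp add: nn_integral_cmult_indicator emeasure_eq_measure ennreal_mult)
    also have "\<dots> = ennreal (\<Sum>k\<in>cell_indices j. s k * measure \<mu> (A \<inter> cell L j k))"
      using pos by (intro sum_ennreal) auto
    finally show ?thesis .
  qed
  show "sets (thin L j s \<mu>) = sets (borel_bar L)" by (simp add: thin_def s)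
  then have "space (thin L j s \<mu>) = Omega_bar L" by (auto dest: sets_eq_imp_space_eq)
  then show "finite_measure (thin L j s \<mu>)"
    using e[OF Omega_bar_borel_bar] by (intro finite_measureI) simp
  show "measure (thin L j s \<mu>) A = (\<Sum>k\<in>cell_indices j. s k * measure \<mu> (A \<inter> cell L j k))"
    if "A \<in> sets (borel_bar L)"
    using e[OF that] pos by (simp add: measure_def sum_nonneg)
qed

text \<open>The orthogonal projection to the line that contains the diagonal. It maps the closed triangle to
  the diagonal and therefore realises the distance from it.\<close>

definition diag_proj :: "real \<times> real \<Rightarrow> real \<times> real" where
  "diag_proj u = ((fst u + snd u) / 2, (fst u + snd u) / 2)"

lemma diag_proj_mem: "u \<in> Omega_bar L \<Longrightarrow> diag_proj u \<in> Diag L"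
  by (cases u) (auto simp: Diag_def Omega_bar_def diag_proj_def intro!: exI[of _ "(fst u + snd u) / 2"])

lemma diag_proj_measurable: "diag_proj \<in> borel_bar L \<rightarrow>\<^sub>M borel_bar L"
proof -
  have "diag_proj \<in> borel \<rightarrow>\<^sub>M borel"
    unfolding diag_proj_def by (intro borel_measurable_continuous_onI continuous_intros) auto
  then show ?thesis
    using diag_proj_mem Diag_subset by (intro measurable_restrict_space3) blast+
qed

lemma norm_diag_proj_le: "v \<in> Diag L \<Longrightarrow> norm (u - diag_proj u) \<le> norm (u - v)"
proof -
  assume "v \<in> Diag L"
  then obtain b where v: "v = (b, b)" by (auto simp: Diag_def)
  have "(fst u - b)\<^sup>2 + (snd u - b)\<^sup>2 - ((fst u - snd u)\<^sup>2 / 2) = 2 * ((fst u + snd u) / 2 - b)\<^sup>2"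
    by (simp add: power2_eq_square field_simps)
  moreover have "(fst u - (fst u + snd u) / 2)\<^sup>2 + (snd u - (fst u + snd u) / 2)\<^sup>2 = (fst u - snd u)\<^sup>2 / 2"
    by (simp add: power2_eq_square field_simps)
  moreover have "0 \<le> 2 * ((fst u + snd u) / 2 - b)\<^sup>2" by simp
  ultimately have "(fst u - (fst u + snd u) / 2)\<^sup>2 + (snd u - (fst u + snd u) / 2)\<^sup>2
      \<le> (fst u - b)\<^sup>2 + (snd u - b)\<^sup>2" by linarith
  then show ?thesis
    by (cases u) (simp add: v diag_proj_def norm_Pair)
qed

lemma norm_diag_proj:
  assumes "u \<in> Omega_bar L"
  shows "norm (u - diag_proj u) = infdist u (Diag L)"
proof (rule antisym)
  have ne: "Diag L \<noteq> {}" using diag_proj_mem[OF assms] by auto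
  show "norm (u - diag_proj u) \<le> infdist u (Diag L)"
    unfolding infdist_notempty[OF ne] using ne norm_diag_proj_le
    by (intro cINF_greatest) (auto simp: dist_norm)
  show "infdist u (Diag L) \<le> norm (u - diag_proj u)"
    using infdist_le[OF diag_proj_mem[OF assms]] by (simp add: dist_norm)
qed

lemma Omega_bar_diam:
  assumes "u \<in> Omega_bar L" "v \<in> Omega_bar L"
  shows "norm (u - v) \<le> 2 * L"
proof -
  have "norm (u - v) \<le> \<bar>fst u - fst v\<bar> + \<bar>snd u - snd v\<bar>"
    using norm_Pair_le[of "fst u - fst v" "snd u - snd v"]
    by (simp add: fst_diff[symmetric] snd_diff[symmetric] del: fst_diff snd_diff)
  then show ?thesis using assms by (auto simp: Omega_bar_def)
qed

text \<open>All mass may be pushed to the diagonal, because the marginals are not constrained there.\<close>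

lemma partial_ot_le_to_diagonal:
  assumes L: "L > 0" and q: "q > 0"
    and f: "finite_measure \<mu>" "finite_measure \<nu>"
    and s: "sets \<mu> = sets (borel_bar L)" "sets \<nu> = sets (borel_bar L)"
  shows "partial_ot L q \<mu> \<nu> \<le> ennreal ((4 * L) powr q * (measure \<mu> (Omega L) + measure \<nu> (Omega L)))"
proof -
  let ?N = "borel_bar L \<Otimes>\<^sub>M borel_bar L"
  define p1 p2 where "p1 = (\<lambda>u. (u, diag_proj u))" and "p2 = (\<lambda>u. (diag_proj u, u))"
  note [measurable] = diag_proj_measurable
  have p[measurable]: "p1 \<in> borel_bar L \<rightarrow>\<^sub>M ?N" "p2 \<in> borel_bar L \<rightarrow>\<^sub>M ?N"
    unfolding p1_def p2_def by measurable
  define \<rho> where "\<rho> b = distr (density (if b then \<mu> else \<nu>) (indicator (Omega L))) ?N (if b then p1 else p2)" for b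
  have si: "sets (if b then \<mu> else \<nu>) = sets (borel_bar L)" for b using s by simp
  have fi: "finite_measure (if b then \<mu> else \<nu>)" for b using f by simp
  have O: "Omega L \<in> sets (if b then \<mu> else \<nu>)" for b unfolding si by simp
  have pm: "(if b then p1 else p2) \<in> (if b then \<mu> else \<nu>) \<rightarrow>\<^sub>M ?N" for b
    unfolding measurable_cong_sets[OF si refl] using p by simp
  have em: "emeasure (\<rho> b) B = emeasure (if b then \<mu> else \<nu>) (Omega L \<inter> (if b then p1 else p2) -` B)"
    if "B \<in> sets ?N" for B b
  proof -
    let ?m = "if b then \<mu> else \<nu>" and ?p = "if b then p1 else p2"
    have "emeasure (\<rho> b) B = emeasure (density ?m (indicator (Omega L))) (?p -` B \<inter> space ?m)"
      unfolding \<rho>_def using that pm by (subst emeasure_distr) auto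
    also have "\<dots> = emeasure ?m (Omega L \<inter> (?p -` B \<inter> space ?m))"
      using O that pm by (subst emeasure_density)
        (auto simp: indicator_inter_arith[symmetric] intro!: measurable_sets nn_integral_indicator sets.Int)
    also have "Omega L \<inter> (?p -` B \<inter> space ?m) = Omega L \<inter> ?p -` B"
      using sets.sets_into_space[OF O[of b]] by blast
    finally show ?thesis .
  qed
  have me: "measure (\<rho> b) B = measure (if b then \<mu> else \<nu>) (Omega L \<inter> (if b then p1 else p2) -` B)"
    if "B \<in> sets ?N" for B b using em[OF that] by (simp add: measure_def)
  show ?thesis
  proof (rule partial_ot_le_sum[where I = UNIV and c = "\<lambda>_. 1" and \<pi> = \<rho>])
    show "finite_measure (\<rho> b)" for b
      using fi[of b] em[OF sets.top, of b] by (intro finite_measureI) (simp add: \<rho>_def finite_measure.emeasure_finite)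
    show "sets (\<rho> b) = sets ?N" for b by (simp add: \<rho>_def)
    show "finite_measure \<mu>" "finite_measure \<nu>" by fact+
    fix A assume A: "A \<in> sets borel" "A \<subseteq> Omega L"
    then have Ab: "A \<in> sets (borel_bar L)" using Omega_subset by (auto simp: sets_borel_bar)
    have AN: "A \<times> Omega_bar L \<in> sets ?N" "Omega_bar L \<times> A \<in> sets ?N" using Ab by auto
    have "diag_proj u \<notin> A" "diag_proj u \<in> Omega_bar L" if "u \<in> Omega L" for u
      using diag_proj_mem[of u L] that A(2) Omega_subset by (auto simp: Diag_eq)
    then have "Omega L \<inter> p1 -` (A \<times> Omega_bar L) = A" "Omega L \<inter> p2 -` (A \<times> Omega_bar L) = {}"
       "Omega L \<inter> p2 -` (Omega_bar L \<times> A) = A" "Omega L \<inter> p1 -` (Omega_bar L \<times> A) = {}"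
      using A(2) by (auto simp: p1_def p2_def) metis+
    then show "measure \<mu> A = (\<Sum>i\<in>UNIV. 1 * measure (\<rho> i) (A \<times> Omega_bar L))"
      "measure \<nu> A = (\<Sum>i\<in>UNIV. 1 * measure (\<rho> i) (Omega_bar L \<times> A))"
      using me[OF AN(1)] me[OF AN(2)] by (simp_all add: UNIV_bool)
  next
    have c: "transport_cost q (\<rho> b) \<le> ennreal ((4 * L) powr q * measure (if b then \<mu> else \<nu>) (Omega L))" for b
    proof -
      let ?m = "if b then \<mu> else \<nu>" and ?p = "if b then p1 else p2"
      have "transport_cost q (\<rho> b) = (\<integral>\<^sup>+u. indicator (Omega L) u *
           ennreal (norm (fst (?p u) - snd (?p u)) powr q) \<partial>?m)"
        unfolding transport_cost_def \<rho>_def using pm O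
        by (subst nn_integral_distr, simp, measurable, subst nn_integral_density)
          (auto intro!: measurable_compose[OF _ measurable_transport_cost])
      also have "\<dots> \<le> (\<integral>\<^sup>+u. ennreal ((4 * L) powr q) * indicator (Omega L) u \<partial>?m)"
      proof (intro nn_integral_mono)
        fix u
        have "norm (u - diag_proj u) powr q \<le> (4 * L) powr q" if "u \<in> Omega L"
        proof -
          have "u \<in> Omega_bar L" using that Omega_subset by blast
          then have "norm (u - diag_proj u) \<le> 2 * L"
            using Diag_subset diag_proj_mem by (intro Omega_bar_diam) blast+
          then show ?thesis using q L by (intro powr_mono2) auto
        qed
        then show "indicator (Omega L) u * ennreal (norm (fst (?p u) - snd (?p u)) powr q)
           \<le> ennreal ((4 * L) powr q) * indicator (Omega L) u"
          by (auto simp: p1_def p2_def norm_minus_commute indicator_def intro!: ennreal_leI)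
      qed
      also have "\<dots> = ennreal ((4 * L) powr q * measure ?m (Omega L))"
        using O[of b] fi[of b] by (subst nn_integral_cmult_indicator)
          (auto simp: finite_measure.emeasure_eq_measure ennreal_mult)
      finally show ?thesis .
    qed
    have "(\<Sum>b\<in>UNIV. ennreal 1 * transport_cost q (\<rho> b)) = transport_cost q (\<rho> False) + transport_cost q (\<rho> True)"
      by (simp add: UNIV_bool)
    also have "\<dots> \<le> ennreal ((4 * L) powr q * measure \<nu> (Omega L)) + ennreal ((4 * L) powr q * measure \<mu> (Omega L))"
      using c[of False] c[of True] by (intro add_mono) auto
    also have "\<dots> = ennreal ((4 * L) powr q * (measure \<mu> (Omega L) + measure \<nu> (Omega L)))"
      by (simp add: algebra_simps flip: ennreal_plus)
    finally show "(\<Sum>b\<in>UNIV. ennreal 1 * transport_cost q (\<rho> b))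
      \<le> ennreal ((4 * L) powr q * (measure \<mu> (Omega L) + measure \<nu> (Omega L)))" .
  qed auto
qed

text \<open>One step of a greedy matching: inside each cell as much mass as possible is coupled. Afterwards at
  most one of the two measures charges a given cell, and the cell-wise differences are unchanged.\<close>

lemma match_cells:
  assumes L: "L > 0" and q: "q > 0"
    and f: "finite_measure \<mu>" "finite_measure \<nu>"
    and s: "sets \<mu> = sets (borel_bar L)" "sets \<nu> = sets (borel_bar L)"
  obtains \<mu>' \<nu>' where "finite_measure \<mu>'" "finite_measure \<nu>'"
    "sets \<mu>' = sets (borel_bar L)" "sets \<nu>' = sets (borel_bar L)"
    "\<And>A. A \<in> sets borel \<Longrightarrow> A \<subseteq> Omega L \<Longrightarrow>
       (\<And>k. k \<in> cell_indices j \<Longrightarrow> cell L j k \<subseteq> A \<or> A \<inter> cell L j k = {}) \<Longrightarrow>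
       measure \<mu>' A - measure \<nu>' A = measure \<mu> A - measure \<nu> A"
    "measure \<mu>' (Omega L) + measure \<nu>' (Omega L)
       = (\<Sum>k\<in>cell_indices j. \<bar>measure \<mu> (cell L j k) - measure \<nu> (cell L j k)\<bar>)"
    "\<And>t. 0 \<le> t \<Longrightarrow> partial_ot L q \<mu>' \<nu>' \<le> ennreal t \<Longrightarrow>
       partial_ot L q \<mu> \<nu> \<le> ennreal ((4 * L / 2 ^ j) powr q * measure \<mu> (Omega L) + t)"
proof -
  interpret \<mu>: finite_measure \<mu> by fact
  interpret \<nu>: finite_measure \<nu> by fact
  let ?N = "borel_bar L \<Otimes>\<^sub>M borel_bar L" and ?K = "cell_indices j" and ?C = "\<lambda>k. cell L j k"
  \<comment> \<open>\<open>c k\<close> is the mass matched in cell \<open>k\<close>; the fractions \<open>x k\<close> and \<open>y k\<close> of the two measures remain there.\<close>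
  define a b c x y where "a k = measure \<mu> (?C k)" and "b k = measure \<nu> (?C k)" and "c k = min (a k) (b k)"
    and "x k = 1 - c k / a k" and "y k = 1 - c k / b k" for k
  have ab: "0 \<le> a k" "0 \<le> b k" "0 \<le> c k" "c k \<le> a k" "c k \<le> b k" for k
    by (auto simp: a_def b_def c_def)
  have xy: "0 \<le> x k" "0 \<le> y k" for k
    using ab[of k] by (auto simp: x_def y_def divide_le_eq_1)
  have xa: "x k * a k = a k - c k" "y k * b k = b k - c k" for k
    using ab[of k] by (auto simp: x_def y_def left_diff_distrib)
  define \<mu>' \<nu>' where "\<mu>' = thin L j x \<mu>" and "\<nu>' = thin L j y \<nu>"
  have m': "measure \<mu>' A = (\<Sum>k\<in>?K. x k * measure \<mu> (A \<inter> ?C k))"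
    "measure \<nu>' A = (\<Sum>k\<in>?K. y k * measure \<nu> (A \<inter> ?C k))" if "A \<in> sets (borel_bar L)" for A
    using that unfolding \<mu>'_def \<nu>'_def
    by (simp_all add: measure_thin[OF f(1) s(1) xy(1)] measure_thin[OF f(2) s(2) xy(2)])
  have sub0: "measure \<mu> (A \<inter> ?C k) \<le> a k" "measure \<nu> (A \<inter> ?C k) \<le> b k" for A k
    unfolding a_def b_def using s by (auto intro!: \<mu>.finite_measure_mono \<nu>.finite_measure_mono)
  show thesis
  proof (rule that)
    show "finite_measure \<mu>'" "finite_measure \<nu>'" "sets \<mu>' = sets (borel_bar L)" "sets \<nu>' = sets (borel_bar L)"
      unfolding \<mu>'_def \<nu>'_def
      using sets_thin[OF f(1) s(1) xy(1)] sets_thin[OF f(2) s(2) xy(2)]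
        finite_thin[OF f(1) s(1) xy(1)] finite_thin[OF f(2) s(2) xy(2)] by auto
    then have f': "finite_measure \<mu>'" "finite_measure \<nu>'" by auto
    show "measure \<mu>' A - measure \<nu>' A = measure \<mu> A - measure \<nu> A"
      if A: "A \<in> sets borel" "A \<subseteq> Omega L"
        and u: "\<And>k. k \<in> ?K \<Longrightarrow> ?C k \<subseteq> A \<or> A \<inter> ?C k = {}" for A
    proof -
      have Ab: "A \<in> sets (borel_bar L)" using A Omega_subset by (auto simp: sets_borel_bar)
      have "x k * measure \<mu> (A \<inter> ?C k) - y k * measure \<nu> (A \<inter> ?C k)
          = measure \<mu> (A \<inter> ?C k) - measure \<nu> (A \<inter> ?C k)" if "k \<in> ?K" for k
      proof (cases "A \<inter> ?C k = {}")
        case False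
        then have "A \<inter> ?C k = ?C k" using u[OF that] by auto
        then show ?thesis using xa[of k] by (simp add: a_def b_def)
      qed simp
      then show ?thesis
        unfolding m'[OF Ab] measure_eq_sum_cells[OF L f(1) s(1) A, of j]
          measure_eq_sum_cells[OF L f(2) s(2) A, of j] by (simp flip: sum_subtractf)
    qed
    have "measure \<mu>' (Omega L) + measure \<nu>' (Omega L) = (\<Sum>k\<in>?K. x k * a k + y k * b k)"
      unfolding m'[OF Omega_borel_bar] using cell_subset[of L j]
      by (simp add: sum.distrib a_def b_def Int_absorb1)
    also have "\<dots> = (\<Sum>k\<in>?K. \<bar>a k - b k\<bar>)"
      unfolding xa by (intro sum.cong refl) (auto simp: c_def min_def)
    finally show "measure \<mu>' (Omega L) + measure \<nu>' (Omega L)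
       = (\<Sum>k\<in>?K. \<bar>measure \<mu> (?C k) - measure \<nu> (?C k)\<bar>)" by (simp add: a_def b_def)
    fix t :: real assume t: "0 \<le> t" "partial_ot L q \<mu>' \<nu>' \<le> ennreal t"
    show "partial_ot L q \<mu> \<nu> \<le> ennreal ((4 * L / 2 ^ j) powr q * measure \<mu> (Omega L) + t)"
    proof (rule ennreal_le_epsilon)
      fix e :: real assume e: "e > 0"
      obtain \<rho> where \<rho>: "\<rho> \<in> adm L \<mu>' \<nu>'" "transport_cost q \<rho> \<le> ennreal (t + e)"
        using partial_ot_less_coupling[OF t(2,1) e] .
      define \<pi> where "\<pi> i = (case i of None \<Rightarrow> \<rho>
        | Some k \<Rightarrow> density (\<mu> \<Otimes>\<^sub>M \<nu>) (indicator (?C k \<times> ?C k)))" for i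
      define w where "w i = (case i of None \<Rightarrow> 1 | Some k \<Rightarrow> c k / (a k * b k))" for i
      let ?I = "insert None (Some ` ?K)"
      have sum_I: "(\<Sum>i\<in>?I. g i) = g None + (\<Sum>k\<in>?K. g (Some k))"
        for g :: "(int \<times> int) option \<Rightarrow> 'z::comm_monoid_add"
        by (simp add: sum.reindex)
      have sp: "sets (\<mu> \<Otimes>\<^sub>M \<nu>) = sets ?N" using s by (rule sets_pair_measure_cong)
      interpret pair_sigma_finite \<mu> \<nu> ..
      have fp: "finite_measure (\<mu> \<Otimes>\<^sub>M \<nu>)"
        by (rule finite_measureI)
          (simp add: space_pair_measure \<nu>.emeasure_pair_measure_Times \<mu>.emeasure_eq_measure
            \<nu>.emeasure_eq_measure flip: ennreal_mult)
      have CC: "?C k \<times> ?C k \<in> sets ?N" for k by auto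
      have mp: "measure (\<mu> \<Otimes>\<^sub>M \<nu>) (A \<times> B) = measure \<mu> A * measure \<nu> B"
        if "A \<in> sets (borel_bar L)" "B \<in> sets (borel_bar L)" for A B
        using that s by (simp add: measure_def \<nu>.emeasure_pair_measure_Times enn2real_mult)
      show "partial_ot L q \<mu> \<nu> \<le> ennreal ((4 * L / 2 ^ j) powr q * measure \<mu> (Omega L) + t) + ennreal e"
      proof (rule partial_ot_le_sum[where I = ?I and c = w and \<pi> = \<pi>])
        show "finite ?I" by simp
        show "0 \<le> w i" for i using ab by (auto simp: w_def split: option.splits)
        show "finite_measure (\<pi> i)" for i
          using density_indicator_pair(1)[OF fp sp CC] \<rho>(1) by (auto simp: \<pi>_def adm_def split: option.splits)
        show "sets (\<pi> i) = sets ?N" for i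
          using \<rho>(1) sp by (auto simp: \<pi>_def adm_def split: option.splits)
        show "finite_measure \<mu>" "finite_measure \<nu>" by fact+
      next
        fix A assume A: "A \<in> sets borel" "A \<subseteq> Omega L"
        then have Ab: "A \<in> sets (borel_bar L)" using Omega_subset by (auto simp: sets_borel_bar)
        then have AC: "A \<inter> ?C k \<in> sets (borel_bar L)" for k by auto
        have AN: "A \<times> Omega_bar L \<in> sets ?N" "Omega_bar L \<times> A \<in> sets ?N" using Ab by auto
        have CO: "?C k \<inter> Omega_bar L = ?C k" "Omega_bar L \<inter> ?C k = ?C k" for k
          using cell_subset[of L j k] Omega_subset[of L] by blast+
        have M: "measure (density (\<mu> \<Otimes>\<^sub>M \<nu>) (indicator (?C k \<times> ?C k))) (A \<times> Omega_bar L)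
            = measure \<mu> (A \<inter> ?C k) * b k"
          "measure (density (\<mu> \<Otimes>\<^sub>M \<nu>) (indicator (?C k \<times> ?C k))) (Omega_bar L \<times> A)
            = a k * measure \<nu> (A \<inter> ?C k)" for k
          unfolding density_indicator_pair(2)[OF fp sp CC AN(1)] density_indicator_pair(2)[OF fp sp CC AN(2)]
          by (simp_all add: Times_Int_Times CO mp AC Int_commute a_def b_def)
        have W: "x k * measure \<mu> (A \<inter> ?C k) + c k / (a k * b k) * (measure \<mu> (A \<inter> ?C k) * b k) = measure \<mu> (A \<inter> ?C k)"
          "y k * measure \<nu> (A \<inter> ?C k) + c k / (a k * b k) * (a k * measure \<nu> (A \<inter> ?C k)) = measure \<nu> (A \<inter> ?C k)" for k
        proof -
          have "a k = 0 \<Longrightarrow> measure \<mu> (A \<inter> ?C k) = 0" "b k = 0 \<Longrightarrow> measure \<nu> (A \<inter> ?C k) = 0"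
            "a k = 0 \<or> b k = 0 \<Longrightarrow> c k = 0"
            using ab[of k] sub0[of A k] by (auto simp: measure_le_0_iff)
          then show "x k * measure \<mu> (A \<inter> ?C k) + c k / (a k * b k) * (measure \<mu> (A \<inter> ?C k) * b k) = measure \<mu> (A \<inter> ?C k)"
            "y k * measure \<nu> (A \<inter> ?C k) + c k / (a k * b k) * (a k * measure \<nu> (A \<inter> ?C k)) = measure \<nu> (A \<inter> ?C k)"
            by (cases "a k = 0"; cases "b k = 0"; simp add: x_def y_def field_simps)+
        qed
        have "measure \<rho> (A \<times> Omega_bar L) = measure \<mu>' A" "measure \<rho> (Omega_bar L \<times> A) = measure \<nu>' A"
          using adm_measure[OF \<rho>(1) A] by auto
        then show "measure \<mu> A = (\<Sum>i\<in>?I. w i * measure (\<pi> i) (A \<times> Omega_bar L))"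
          "measure \<nu> A = (\<Sum>i\<in>?I. w i * measure (\<pi> i) (Omega_bar L \<times> A))"
          unfolding sum_I w_def \<pi>_def option.case M m'[OF Ab]
            measure_eq_sum_cells[OF L f(1) s(1) A, of j] measure_eq_sum_cells[OF L f(2) s(2) A, of j]
          by (simp_all only: mult_1_left sum.distrib[symmetric] W)
      next
        let ?\<delta> = "4 * L / 2 ^ j"
        have tc: "ennreal (c k / (a k * b k)) * transport_cost q (density (\<mu> \<Otimes>\<^sub>M \<nu>) (indicator (?C k \<times> ?C k)))
          \<le> ennreal (?\<delta> powr q * a k)" for k
        proof -
          have "transport_cost q (density (\<mu> \<Otimes>\<^sub>M \<nu>) (indicator (?C k \<times> ?C k)))
            = (\<integral>\<^sup>+x. indicator (?C k \<times> ?C k) x * ennreal (norm (fst x - snd x) powr q) \<partial>(\<mu> \<Otimes>\<^sub>M \<nu>))"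
            by (rule transport_cost_density_indicator[OF sp CC])
          also have "\<dots> \<le> (\<integral>\<^sup>+x. ennreal (?\<delta> powr q) * indicator (?C k \<times> ?C k) x \<partial>(\<mu> \<Otimes>\<^sub>M \<nu>))"
            using q cell_diam[OF L, of _ j k]
            by (intro nn_integral_mono) (auto simp: indicator_def intro!: ennreal_leI powr_mono2)
          also have "\<dots> = ennreal (?\<delta> powr q) * emeasure (\<mu> \<Otimes>\<^sub>M \<nu>) (?C k \<times> ?C k)"
            using CC[of k] sp by (intro nn_integral_cmult_indicator) auto
          also have "\<dots> = ennreal (?\<delta> powr q * (a k * b k))"
            using s by (simp add: \<nu>.emeasure_pair_measure_Times \<mu>.emeasure_eq_measure
              \<nu>.emeasure_eq_measure a_def b_def ennreal_mult)
          finally have "ennreal (c k / (a k * b k)) * transport_cost q (density (\<mu> \<Otimes>\<^sub>M \<nu>) (indicator (?C k \<times> ?C k)))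
             \<le> ennreal (c k / (a k * b k)) * ennreal (?\<delta> powr q * (a k * b k))"
            by (intro mult_left_mono) auto
          also have "\<dots> = ennreal (c k / (a k * b k) * (?\<delta> powr q * (a k * b k)))"
            using ab[of k] by (simp flip: ennreal_mult)
          also have "c k / (a k * b k) * (?\<delta> powr q * (a k * b k)) \<le> ?\<delta> powr q * a k"
            using ab[of k] by (auto intro!: mult_left_mono simp: mult.commute[of "c k"])
          finally show ?thesis by (simp add: ennreal_leI)
        qed
        have "(\<Sum>i\<in>?I. ennreal (w i) * transport_cost q (\<pi> i)) \<le> ennreal (t + e) + (\<Sum>k\<in>?K. ennreal (?\<delta> powr q * a k))"
          unfolding sum_I w_def \<pi>_def option.case using \<rho>(2) tc by (intro add_mono sum_mono) simp_all
        also have "(\<Sum>k\<in>?K. ennreal (?\<delta> powr q * a k)) = ennreal (\<Sum>k\<in>?K. ?\<delta> powr q * a k)"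
          using ab by (intro sum_ennreal) auto
        also have "(\<Sum>k\<in>?K. ?\<delta> powr q * a k) = ?\<delta> powr q * measure \<mu> (Omega L)"
          using measure_eq_sum_cells[OF L f(1) s(1) Omega_borel order.refl, of j] cell_subset[of L j]
          by (simp add: a_def Int_absorb1 flip: sum_distrib_left)
        finally show "(\<Sum>i\<in>?I. ennreal (w i) * transport_cost q (\<pi> i))
           \<le> ennreal (?\<delta> powr q * measure \<mu> (Omega L) + t) + ennreal e"
          using t(1) e by (simp add: add_ac flip: ennreal_plus)
      qed
    qed
  qed
qed

text \<open>Matching from the finest level up. What remains after level \<open>j\<close> has mass at most the
  discrepancy on level \<open>j\<close> and is matched inside cells of the next coarser level; what remains at
  the top goes to the diagonal.\<close>

lemma partial_ot_dyadic:
  assumes L: "L > 0" and q: "q > 0"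
    and "finite_measure \<mu>" "finite_measure \<nu>"
    and "sets \<mu> = sets (borel_bar L)" "sets \<nu> = sets (borel_bar L)"
  shows "partial_ot L q \<mu> \<nu> \<le> ennreal ((4 * L / 2 ^ J) powr q * measure \<mu> (Omega L)
    + (\<Sum>j\<le>J. (8 * L / 2 ^ j) powr q *
         (\<Sum>k\<in>cell_indices j. \<bar>measure \<mu> (cell L j k) - measure \<nu> (cell L j k)\<bar>)))"
  using assms(3-)
proof (induction J arbitrary: \<mu> \<nu>)
  case 0
  obtain \<mu>' \<nu>' where *: "finite_measure \<mu>'" "finite_measure \<nu>'"
    "sets \<mu>' = sets (borel_bar L)" "sets \<nu>' = sets (borel_bar L)"
    "measure \<mu>' (Omega L) + measure \<nu>' (Omega L)
       = (\<Sum>k\<in>cell_indices 0. \<bar>measure \<mu> (cell L 0 k) - measure \<nu> (cell L 0 k)\<bar>)"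
    and le: "\<And>t. 0 \<le> t \<Longrightarrow> partial_ot L q \<mu>' \<nu>' \<le> ennreal t \<Longrightarrow>
       partial_ot L q \<mu> \<nu> \<le> ennreal ((4 * L / 2 ^ 0) powr q * measure \<mu> (Omega L) + t)"
    by (rule match_cells[OF L q 0, where j = 0]) blast
  have "partial_ot L q \<mu> \<nu> \<le> ennreal ((4 * L / 2 ^ 0) powr q * measure \<mu> (Omega L) +
     (4 * L) powr q * (measure \<mu>' (Omega L) + measure \<nu>' (Omega L)))"
    by (intro le partial_ot_le_to_diagonal[OF L q *(1-4)]) simp
  also have "\<dots> \<le> ennreal ((4 * L / 2 ^ 0) powr q * measure \<mu> (Omega L) +
     (8 * L) powr q * (measure \<mu>' (Omega L) + measure \<nu>' (Omega L)))"
    using L q by (intro ennreal_leI add_left_mono mult_right_mono powr_mono2) auto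
  finally show ?case unfolding *(5) by simp
next
  case (Suc J)
  obtain \<mu>' \<nu>' where *: "finite_measure \<mu>'" "finite_measure \<nu>'"
    "sets \<mu>' = sets (borel_bar L)" "sets \<nu>' = sets (borel_bar L)"
    and diff: "\<And>A. A \<in> sets borel \<Longrightarrow> A \<subseteq> Omega L \<Longrightarrow>
       (\<And>k. k \<in> cell_indices (Suc J) \<Longrightarrow> cell L (Suc J) k \<subseteq> A \<or> A \<inter> cell L (Suc J) k = {}) \<Longrightarrow>
       measure \<mu>' A - measure \<nu>' A = measure \<mu> A - measure \<nu> A"
    and sum: "measure \<mu>' (Omega L) + measure \<nu>' (Omega L)
       = (\<Sum>k\<in>cell_indices (Suc J). \<bar>measure \<mu> (cell L (Suc J) k) - measure \<nu> (cell L (Suc J) k)\<bar>)"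
    and le: "\<And>t. 0 \<le> t \<Longrightarrow> partial_ot L q \<mu>' \<nu>' \<le> ennreal t \<Longrightarrow>
       partial_ot L q \<mu> \<nu> \<le> ennreal ((4 * L / 2 ^ Suc J) powr q * measure \<mu> (Omega L) + t)"
    by (rule match_cells[OF L q Suc.prems, where j = "Suc J"]) blast
  have d: "measure \<mu>' (cell L j k) - measure \<nu>' (cell L j k) = measure \<mu> (cell L j k) - measure \<nu> (cell L j k)"
    if "j \<le> J" for j k
  proof (rule diff[OF cell_borel cell_subset])
    fix i
    show "cell L (Suc J) i \<subseteq> cell L j k \<or> cell L j k \<inter> cell L (Suc J) i = {}"
    proof (rule disjCI)
      assume "cell L j k \<inter> cell L (Suc J) i \<noteq> {}"
      then obtain u where u: "u \<in> cell L j k" "u \<in> cell L (Suc J) i" by blast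
      have "cell_index L j v = cell_index L j u" if "v \<in> cell L (Suc J) i" for v
        using that u \<open>j \<le> J\<close> by (intro cell_index_coarser[of j "Suc J"]) (simp_all add: cell_def)
      then show "cell L (Suc J) i \<subseteq> cell L j k"
        using u by (simp add: cell_def subset_iff)
    qed
  qed
  let ?D = "\<lambda>j. \<Sum>k\<in>cell_indices j. \<bar>measure \<mu> (cell L j k) - measure \<nu> (cell L j k)\<bar>"
  have "partial_ot L q \<mu>' \<nu>' \<le> ennreal ((4 * L / 2 ^ J) powr q * measure \<mu>' (Omega L)
    + (\<Sum>j\<le>J. (8 * L / 2 ^ j) powr q * ?D j))"
    using Suc.IH[OF *(1-4)] by (simp add: d)
  also have "\<dots> \<le> ennreal ((8 * L / 2 ^ Suc J) powr q * ?D (Suc J) + (\<Sum>j\<le>J. (8 * L / 2 ^ j) powr q * ?D j))"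
    unfolding sum[symmetric] by (intro ennreal_leI add_right_mono mult_mono) auto
  finally have "partial_ot L q \<mu> \<nu> \<le> ennreal ((4 * L / 2 ^ Suc J) powr q * measure \<mu> (Omega L) +
     ((8 * L / 2 ^ Suc J) powr q * ?D (Suc J) + (\<Sum>j\<le>J. (8 * L / 2 ^ j) powr q * ?D j)))"
    by (intro le) (auto intro!: add_nonneg_nonneg sum_nonneg)
  then show ?case by (simp add: add_ac)
qed

section \<open>Edge-corrected kernels\<close>

text \<open>Near each of its points the set contains a ball of comparable size. This is all that is used of
  the cone condition, and it keeps the kernel normalisation away from zero up to the boundary.\<close>

definition inner_balls :: "'a::euclidean_space set \<Rightarrow> bool" where
  "inner_balls S \<longleftrightarrow> (\<exists>c>0. \<exists>r0>0. \<forall>z\<in>S. \<forall>r. 0 < r \<and> r \<le> r0 \<longrightarrow> (\<exists>y. ball y (c * r) \<subseteq> S \<inter> cball z r))"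

text \<open>A ball around the midpoint of the cone axis, with radius proportional to the aperture, lies in the
  cone.\<close>

lemma inner_balls_cone:
  fixes S :: "'a::euclidean_space set"
  assumes "cone_condition S"
  shows "inner_balls S"
proof -
  obtain \<rho> \<eta> where \<rho>: "\<rho> > 0" and \<eta>: "\<eta> > 0" and
    cone: "\<And>z. z \<in> S \<Longrightarrow> \<exists>\<xi>. norm \<xi> = 1 \<and>
      {z + t *\<^sub>R v | t v. 0 < t \<and> t < \<rho> \<and> norm v = 1 \<and> norm (v - \<xi>) < \<eta>} \<subseteq> S"
    using assms unfolding cone_condition_def by blast
  define c where "c = min \<eta> 1 / 8"
  have c: "0 < c" "c \<le> 1 / 8" "8 * c \<le> \<eta>" using \<eta> by (auto simp: c_def)
  have "\<exists>y. ball y (c * r) \<subseteq> S \<inter> cball z r" if z: "z \<in> S" and r: "0 < r" "r \<le> \<rho>" for z r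
  proof -
    obtain \<xi> where \<xi>: "norm \<xi> = 1"
      and sub: "{z + t *\<^sub>R v | t v. 0 < t \<and> t < \<rho> \<and> norm v = 1 \<and> norm (v - \<xi>) < \<eta>} \<subseteq> S"
      using cone[OF z] by blast
    have "x \<in> S \<inter> cball z r" if x: "x \<in> ball (z + (r / 2) *\<^sub>R \<xi>) (c * r)" for x
    proof -
      define d where "d = x - z"
      have cr: "c * r \<le> r / 8" using c r by (simp add: field_simps)
      have d: "norm (d - (r / 2) *\<^sub>R \<xi>) < c * r"
        using x by (simp add: d_def dist_norm norm_minus_commute algebra_simps)
      have n\<xi>: "norm ((r / 2) *\<^sub>R \<xi>) = r / 2" using r \<xi> by simp
      have nd: "\<bar>norm d - r / 2\<bar> < c * r"
        using norm_triangle_ineq3[of d "(r / 2) *\<^sub>R \<xi>"] d n\<xi> by linarith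
      then have nd1: "3 / 8 * r \<le> norm d" "norm d < r" and nd0: "norm d > 0" using cr r by linarith+
      have "norm (d - norm d *\<^sub>R \<xi>) \<le> norm (d - (r / 2) *\<^sub>R \<xi>) + norm ((r / 2 - norm d) *\<^sub>R \<xi>)"
        using norm_triangle_ineq[of "d - (r / 2) *\<^sub>R \<xi>" "(r / 2 - norm d) *\<^sub>R \<xi>"]
        by (simp add: algebra_simps)
      also have "\<dots> < 2 * (c * r)" using d nd \<xi> by simp
      also have "\<dots> \<le> \<eta> * norm d"
      proof -
        have "2 * (c * r) \<le> (8 * c) * (3 / 8 * r)" using c r by simp
        also have "\<dots> \<le> \<eta> * norm d" using c nd1 r \<eta> by (intro mult_mono) auto
        finally show ?thesis .
      qed
      finally have *: "norm (d - norm d *\<^sub>R \<xi>) < \<eta> * norm d" .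
      define v where "v = (1 / norm d) *\<^sub>R d"
      have v: "norm v = 1" "d = norm d *\<^sub>R v" using nd0 by (auto simp: v_def)
      have "norm d * norm (v - \<xi>) = norm (d - norm d *\<^sub>R \<xi>)"
        using norm_scaleR[of "norm d" "v - \<xi>"] v(2) by (simp add: scaleR_diff_right)
      then have "norm d * norm (v - \<xi>) < norm d * \<eta>" using * by (simp add: mult.commute)
      then have v\<xi>: "norm (v - \<xi>) < \<eta>" using nd0 by simp
      have "z + norm d *\<^sub>R v \<in> S" using sub nd0 nd1 r v v\<xi> by fastforce
      moreover have "z + norm d *\<^sub>R v = x" using v(2) by (simp add: d_def)
      ultimately show ?thesis using nd1 by (simp add: d_def dist_norm norm_minus_commute)
    qed
    then show ?thesis by blast
  qed
  then show ?thesis unfolding inner_balls_def using c \<rho> by blast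
qed

text \<open>By convexity: shrinking a fixed inner ball towards \<open>z\<close> stays inside the triangle.\<close>

lemma inner_balls_Omega_bar:
  assumes L: "L > 0"
  shows "inner_balls (Omega_bar L)"
proof -
  define y0 :: "real \<times> real" where "y0 = (L / 4, 3 * L / 4)"
  have in0: "x \<in> Omega_bar L" if "x \<in> ball y0 (L / 4)" for x
  proof -
    have "norm (x - y0) < L / 4" using that by (simp add: dist_norm norm_minus_commute)
    then have "\<bar>fst x - L / 4\<bar> < L / 4" "\<bar>snd x - 3 * L / 4\<bar> < L / 4"
      using norm_fst_le[of "fst x - L / 4" "snd x - 3 * L / 4"] norm_snd_le[of "snd x - 3 * L / 4" "fst x - L / 4"]
      by (cases x; simp add: y0_def)+
    then have "0 \<le> fst x" "fst x \<le> snd x" "snd x \<le> L" by linarith+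
    then show ?thesis by (auto simp: Omega_bar_def case_prod_unfold)
  qed
  have nn: "norm (y0 - z) \<le> 2 * L" if "z \<in> Omega_bar L" for z
  proof -
    have "norm (y0 - z) \<le> \<bar>L / 4 - fst z\<bar> + \<bar>3 * L / 4 - snd z\<bar>"
      using norm_Pair_le[of "L / 4 - fst z" "3 * L / 4 - snd z"] by (cases z) (simp add: y0_def)
    then show ?thesis using that by (auto simp: Omega_bar_def case_prod_unfold)
  qed
  have "\<exists>y. ball y (1 / 9 * r) \<subseteq> Omega_bar L \<inter> cball z r"
    if z: "z \<in> Omega_bar L" and r: "0 < r" "r \<le> 9 / 4 * L" for z r
  proof -
    define s where "s = r / (9 / 4 * L)"
    have s: "0 < s" "s \<le> 1" "s * (9 / 4 * L) = r" using r L by (auto simp: s_def)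
    have "x \<in> Omega_bar L \<inter> cball z r" if x: "x \<in> ball (z + s *\<^sub>R (y0 - z)) (1 / 9 * r)" for x
    proof -
      define e where "e = x - (z + s *\<^sub>R (y0 - z))"
      have e: "norm e < s * (L / 4)" using x s by (simp add: e_def dist_norm norm_minus_commute)
      define x' where "x' = y0 + (1 / s) *\<^sub>R e"
      have "norm ((1 / s) *\<^sub>R e) < L / 4" using e s by (simp add: field_simps)
      then have x': "x' \<in> Omega_bar L" by (intro in0) (simp add: x'_def dist_norm)
      have xe: "x = (1 - s) *\<^sub>R z + s *\<^sub>R x'"
        using s by (simp add: x'_def e_def algebra_simps)
      have "x \<in> Omega_bar L"
      proof -
        obtain a b where zz: "z = (a, b)" by (cases z)
        obtain a' b' where xx: "x' = (a', b')" by (cases x')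
        have h: "0 \<le> a" "a \<le> b" "b \<le> L" "0 \<le> a'" "a' \<le> b'" "b' \<le> L"
          using z x' by (auto simp: zz xx Omega_bar_def)
        have "0 \<le> (1 - s) * a + s * a'" using h s by simp
        moreover have "(1 - s) * a + s * a' \<le> (1 - s) * b + s * b'" using h s by (intro add_mono mult_left_mono) auto
        moreover have "(1 - s) * b + s * b' \<le> (1 - s) * L + s * L" using h s by (intro add_mono mult_left_mono) auto
        ultimately show ?thesis by (simp add: xe zz xx Omega_bar_def algebra_simps)
      qed
      moreover have "norm (x - z) \<le> r"
      proof -
        have "norm (x - z) \<le> norm (s *\<^sub>R (y0 - z)) + norm e"
          using norm_triangle_ineq[of "s *\<^sub>R (y0 - z)" e] by (simp add: e_def)
        also have "\<dots> \<le> s * (2 * L) + s * (L / 4)" using nn[OF z] e s by (intro add_mono) auto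
        also have "\<dots> = r" using s(3) by (simp add: algebra_simps)
        finally show ?thesis .
      qed
      ultimately show ?thesis by (simp add: dist_norm norm_minus_commute)
    qed
    then show ?thesis by blast
  qed
  then show ?thesis unfolding inner_balls_def using L
    by (intro exI[of _ "1/9"] conjI exI[of _ "9/4 * L"]) auto
qed

lemma admissible_kernelE:
  fixes K :: "'a::euclidean_space \<Rightarrow> real"
  assumes "admissible_kernel K"
  obtains B C \<rho> k where "B > 0" "C > 0" "\<rho> > 0" "k > 0" "\<And>x. 0 \<le> K x" "\<And>x. K x \<le> B"
    "\<And>x. K x \<noteq> 0 \<Longrightarrow> norm x \<le> 1" "\<And>x y. \<bar>K x - K y\<bar> \<le> C * norm (x - y)"
    "\<And>x. norm x \<le> \<rho> \<Longrightarrow> k \<le> K x" "K \<in> borel_measurable borel"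
proof -
  note a = assms[unfolded admissible_kernel_def]
  have "bounded (range K)" using a by simp
  then obtain B where B: "\<forall>x\<in>range K. norm x \<le> B" unfolding bounded_iff by blast
  obtain C where C: "C-lipschitz_on UNIV K" using a by auto
  obtain \<rho> k where \<rho>: "\<rho> > 0" "k > 0" "\<And>x. norm x \<le> \<rho> \<Longrightarrow> k \<le> K x" using a by auto
  show thesis
  proof (rule that[of "max B 1" "max C 1" \<rho> k])
    show "K x \<le> max B 1" for x using B[rule_format, of "K x"] by auto
    show "norm x \<le> 1" if "K x \<noteq> 0" for x using a that by auto
    show "\<bar>K x - K y\<bar> \<le> max C 1 * norm (x - y)" for x y
    proof -
      have "\<bar>K x - K y\<bar> \<le> C * norm (x - y)"
        using lipschitz_onD[OF C, of x y] by (simp add: dist_norm)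
      also have "\<dots> \<le> max C 1 * norm (x - y)" by (intro mult_right_mono) auto
      finally show ?thesis .
    qed
    show "K \<in> borel_measurable borel"
      using lipschitz_on_continuous_on[OF C] by (rule borel_measurable_continuous_onI)
  qed (use a \<rho> in auto)
qed

lemma norm_scaled_le: "h > 0 \<Longrightarrow> norm ((x - z) /\<^sub>R h) \<le> c \<longleftrightarrow> norm (x - z) \<le> c * h"
  by (simp del: scaleR_diff_right) (simp add: field_simps)

lemma nn_integral_cball_le:
  fixes f :: "'a::euclidean_space \<Rightarrow> real"
  assumes "0 < h" "0 \<le> B" "\<And>x. f x \<le> B" "\<And>x. f x \<noteq> 0 \<Longrightarrow> norm (x - z) \<le> h"
  shows "(\<integral>\<^sup>+x. ennreal (f x) \<partial>lborel) \<le> ennreal (B * unit_ball_vol DIM('a) * h ^ DIM('a))"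
proof -
  have "(\<integral>\<^sup>+x. ennreal (f x) \<partial>lborel) \<le> (\<integral>\<^sup>+x. ennreal B * indicator (cball z h) x \<partial>lborel)"
  proof (intro nn_integral_mono)
    fix x show "ennreal (f x) \<le> ennreal B * indicator (cball z h) x"
      using assms(3,4)[of x] assms(2)
      by (cases "f x = 0") (auto simp: indicator_def dist_norm norm_minus_commute intro!: ennreal_leI)
  qed
  also have "\<dots> = ennreal B * emeasure lborel (cball z h)"
    by (intro nn_integral_cmult_indicator) auto
  also have "\<dots> = ennreal (B * unit_ball_vol DIM('a) * h ^ DIM('a))"
    using assms(1,2) by (simp add: emeasure_cball ennreal_mult mult.assoc)
  finally show ?thesis .
qed

text \<open>The kernel exceeds a constant on a small ball, and a fixed proportion of the rescaled ball is filled
  by a ball inside \<open>S\<close>.\<close>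

lemma kernel_const_ge:
  fixes K :: "'a::euclidean_space \<Rightarrow> real"
  assumes K: "admissible_kernel K" and S: "inner_balls S" "S \<in> sets borel"
  shows "\<exists>c>0. \<exists>h0>0. \<forall>h z. 0 < h \<and> h \<le> h0 \<and> z \<in> S \<longrightarrow> c \<le> kernel_const K S h z"
proof -
  obtain B C \<rho> k where *: "B > 0" "\<rho> > 0" "k > 0" "\<And>x. 0 \<le> K x" "\<And>x. K x \<le> B"
    "\<And>x. K x \<noteq> 0 \<Longrightarrow> norm x \<le> 1" "\<And>x. norm x \<le> \<rho> \<Longrightarrow> k \<le> K x" and [measurable]: "K \<in> borel_measurable borel"
    using admissible_kernelE[OF K] by metis
  obtain c r0 where c: "c > 0" "r0 > 0"
    and ball: "\<And>z r. z \<in> S \<Longrightarrow> 0 < r \<Longrightarrow> r \<le> r0 \<Longrightarrow> \<exists>y. ball y (c * r) \<subseteq> S \<inter> cball z r"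
    using S(1) unfolding inner_balls_def by blast
  note [measurable] = S(2)
  define c' where "c' = k * (unit_ball_vol DIM('a) * (c * \<rho>) ^ DIM('a))"
  have c': "c' > 0" using * c by (auto simp: c'_def unit_ball_vol_pos)
  have "c' \<le> kernel_const K S h z" if h: "0 < h" "h \<le> r0 / \<rho>" and z: "z \<in> S" for h z
  proof -
    have r: "0 < \<rho> * h" "\<rho> * h \<le> r0" using h * by (auto simp: field_simps)
    obtain y where y: "ball y (c * (\<rho> * h)) \<subseteq> S \<inter> cball z (\<rho> * h)" using ball[OF z r] by blast
    let ?f = "\<lambda>z'. indicator S z' * (K ((z' - z) /\<^sub>R h) / h ^ DIM('a))"
    have [measurable]: "(\<lambda>z'. K ((z' - z) /\<^sub>R h)) \<in> borel_measurable borel" by measurable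
    have fm: "?f \<in> borel_measurable lborel" by measurable
    have f0: "0 \<le> ?f z'" for z' using *(4) h by simp
    have "(\<integral>\<^sup>+z'. ennreal (?f z') \<partial>lborel)
        \<le> ennreal (B / h ^ DIM('a) * unit_ball_vol DIM('a) * h ^ DIM('a))"
    proof (rule nn_integral_cball_le[where z = z])
      show "?f x \<le> B / h ^ DIM('a)" for x
        using *(1,4,5) h by (auto simp: indicator_def intro!: divide_right_mono)
      show "norm (x - z) \<le> h" if "?f x \<noteq> 0" for x
        using *(6)[of "(x - z) /\<^sub>R h"] that norm_scaled_le[OF h(1), of x z 1] by auto
    qed (use h * in auto)
    then have fi: "integrable lborel ?f"
      using f0 by (intro integrableI_nonneg fm) (auto intro: le_less_trans simp: less_top[symmetric] top_unique)
    have "c' = (k / h ^ DIM('a)) * (unit_ball_vol DIM('a) * (c * (\<rho> * h)) ^ DIM('a))"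
      using h by (simp add: c'_def power_mult_distrib)
    also have "\<dots> = (LINT z'|lborel. (k / h ^ DIM('a)) * indicator (ball y (c * (\<rho> * h))) z')"
      using c r by (simp add: content_ball lmeasurable_ball)
    also have "\<dots> \<le> (LINT z'|lborel. ?f z')"
    proof (rule integral_mono_AE)
      show "integrable lborel (\<lambda>z'. (k / h ^ DIM('a)) * indicator (ball y (c * (\<rho> * h))) z')"
        by (intro integrable_mult_right integrable_real_indicator) (auto simp: emeasure_ball c r less_imp_le)
      show "AE z' in lborel. k / h ^ DIM('a) * indicator (ball y (c * (\<rho> * h))) z' \<le> ?f z'"
      proof (rule AE_I2)
        fix z'
        show "k / h ^ DIM('a) * indicator (ball y (c * (\<rho> * h))) z' \<le> ?f z'"
        proof (cases "z' \<in> ball y (c * (\<rho> * h))")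
          case True
          then have "z' \<in> S" "dist z z' \<le> \<rho> * h" using y by auto
          then have "k \<le> K ((z' - z) /\<^sub>R h)"
            by (intro *(7)) (simp only: norm_scaled_le[OF h(1)], simp add: dist_norm norm_minus_commute)
          then show ?thesis using True \<open>z' \<in> S\<close> h by (auto intro!: divide_right_mono)
        qed (use f0 in auto)
      qed
    qed (rule fi)
    finally show ?thesis by (simp add: kernel_const_def set_lebesgue_integral_def)
  qed
  then show ?thesis using c' c * by (intro exI[of _ c'] conjI exI[of _ "r0 / \<rho>"]) auto
qed

section \<open>Smoothing and its bias\<close>

text \<open>The smoothing step splits a coupling into mass that moves to neighbours, mass that comes from the
  diagonal and mass that goes to it.\<close>

lemma partial_ot_le_three:
  assumes \<pi>: "finite_measure \<pi>1" "finite_measure \<pi>2" "finite_measure \<pi>3"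
      "sets \<pi>1 = sets (borel_bar L \<Otimes>\<^sub>M borel_bar L)" "sets \<pi>2 = sets (borel_bar L \<Otimes>\<^sub>M borel_bar L)"
      "sets \<pi>3 = sets (borel_bar L \<Otimes>\<^sub>M borel_bar L)"
    and \<nu>: "finite_measure \<nu>" "finite_measure \<xi>"
    and 1: "\<And>A. A \<in> sets borel \<Longrightarrow> A \<subseteq> Omega L \<Longrightarrow> emeasure \<nu> A = emeasure \<pi>1 (A \<times> Omega_bar L)
       + emeasure \<pi>2 (A \<times> Omega_bar L) + emeasure \<pi>3 (A \<times> Omega_bar L)"
    and 2: "\<And>A. A \<in> sets borel \<Longrightarrow> A \<subseteq> Omega L \<Longrightarrow> emeasure \<xi> A = emeasure \<pi>1 (Omega_bar L \<times> A)
       + emeasure \<pi>2 (Omega_bar L \<times> A) + emeasure \<pi>3 (Omega_bar L \<times> A)"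
  shows "partial_ot L q \<nu> \<xi> \<le> transport_cost q \<pi>1 + transport_cost q \<pi>2 + transport_cost q \<pi>3"
proof -
  interpret a: finite_measure \<pi>1 by fact
  interpret b: finite_measure \<pi>2 by fact
  interpret c: finite_measure \<pi>3 by fact
  interpret n: finite_measure \<nu> by fact
  interpret x: finite_measure \<xi> by fact
  define \<pi> where "\<pi> i = (if i = 0 then \<pi>1 else if i = Suc 0 then \<pi>2 else \<pi>3)" for i :: nat
  show ?thesis
  proof (rule partial_ot_le_sum[where I = "{..<3}" and c = "\<lambda>_. 1" and \<pi> = \<pi>])
    fix A assume A: "A \<in> sets borel" "A \<subseteq> Omega L"
    show "measure \<nu> A = (\<Sum>i<3. 1 * measure (\<pi> i) (A \<times> Omega_bar L))"
      using 1[OF A] by (simp add: n.emeasure_eq_measure a.emeasure_eq_measure b.emeasure_eq_measure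
        c.emeasure_eq_measure \<pi>_def numeral_3_eq_3 flip: ennreal_plus)
    show "measure \<xi> A = (\<Sum>i<3. 1 * measure (\<pi> i) (Omega_bar L \<times> A))"
      using 2[OF A] by (simp add: x.emeasure_eq_measure a.emeasure_eq_measure b.emeasure_eq_measure
        c.emeasure_eq_measure \<pi>_def numeral_3_eq_3 flip: ennreal_plus)
  qed (use \<pi> \<nu> in \<open>auto simp: \<pi>_def numeral_3_eq_3\<close>)
qed

abbreviation lborel_bar :: "real \<Rightarrow> (real \<times> real) measure" where
  "lborel_bar L \<equiv> restrict_space lborel (Omega_bar L)"

lemma sets_lborel_bar [measurable_cong]: "sets (lborel_bar L) = sets (borel_bar L)"
  by (rule sets_restrict_space_cong) simp

lemma bounded_Omega_bar: "bounded (Omega_bar L)"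
proof -
  have "Omega_bar L \<subseteq> cbox (0, 0) (L, L)" by (auto simp: Omega_bar_def)
  then show ?thesis by (rule bounded_subset[OF bounded_cbox])
qed

lemma finite_lborel_bar: "finite_measure (lborel_bar L)"
  by (rule finite_measureI) (use emeasure_bounded_finite[OF bounded_Omega_bar, of L] in
    \<open>simp add: space_restrict_space emeasure_restrict_space less_top\<close>)

text \<open>For the kernel \<open>kernel_corr K (Omega_bar L) h\<close> this is the smoothed measure that the estimator averages. The theory
  of its transport cost needs only an abstract kernel with bounded mass and range.\<close>

definition smoothing :: "real \<Rightarrow> (real \<times> real \<Rightarrow> real \<times> real \<Rightarrow> real) \<Rightarrow> (real \<times> real) measure \<Rightarrow> (real \<times> real) measure" where
  "smoothing L \<kappa> \<mu> = density (lborel_bar L) (\<lambda>u. \<integral>\<^sup>+v. ennreal (\<kappa> u v) \<partial>\<mu>)"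

text \<open>The mass that smoothing moves from \<open>v\<close> into \<open>A\<close>. For \<open>A = Omega_bar L\<close> this is \<open>r_U\<close> as an extended
  nonnegative real. These functions are the test functions of the empirical process.\<close>

definition kernel_mass :: "real \<Rightarrow> (real \<times> real \<Rightarrow> real \<times> real \<Rightarrow> real) \<Rightarrow> (real \<times> real) set \<Rightarrow> real \<times> real \<Rightarrow> ennreal" where
  "kernel_mass L \<kappa> A v = (\<integral>\<^sup>+u. ennreal (\<kappa> u v) * indicator A u \<partial>lborel_bar L)"

lemma sets_smoothing [simp]: "sets (smoothing L \<kappa> \<mu>) = sets (borel_bar L)"
  by (simp add: smoothing_def sets_lborel_bar)

lemma kernel_mass_measurable:
  assumes \<kappa>m: "(\<lambda>x. \<kappa> (fst x) (snd x)) \<in> borel_measurable (borel_bar L \<Otimes>\<^sub>M borel_bar L)"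
    and [measurable]: "A \<in> sets (borel_bar L)"
  shows "kernel_mass L \<kappa> A \<in> borel_measurable (borel_bar L)"
proof -
  interpret finite_measure "lborel_bar L" by (rule finite_lborel_bar)
  note [measurable] = \<kappa>m
  have "(\<lambda>x. ennreal (\<kappa> (snd x) (fst x)) * indicator A (snd x)) \<in> borel_measurable (borel_bar L \<Otimes>\<^sub>M lborel_bar L)"
    by (intro borel_measurable_times_ennreal measurable_compose[OF _ measurable_ennreal]
        measurable_compose[where f = "\<lambda>x. (snd x, fst x)", OF _ \<kappa>m, simplified]) measurable
  from borel_measurable_nn_integral_fst[OF this] show ?thesis
    by (simp add: kernel_mass_def[abs_def])
qed

text \<open>Smoothing followed by evaluation on \<open>A\<close> is the integral of a bounded test function, so no smoothness of the
  measure enters.\<close>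

lemma emeasure_smoothing:
  assumes \<kappa>m: "(\<lambda>x. \<kappa> (fst x) (snd x)) \<in> borel_measurable (borel_bar L \<Otimes>\<^sub>M borel_bar L)"
    and fin: "finite_measure \<mu>" and s: "sets \<mu> = sets (borel_bar L)" and A: "A \<in> sets (borel_bar L)"
  shows "emeasure (smoothing L \<kappa> \<mu>) A = (\<integral>\<^sup>+v. kernel_mass L \<kappa> A v \<partial>\<mu>)"
proof -
  interpret \<mu>: finite_measure \<mu> by (rule fin)
  interpret lb: finite_measure "lborel_bar L" by (rule finite_lborel_bar)
  interpret pair_sigma_finite "lborel_bar L" \<mu> ..
  note [measurable_cong] = s
  note [measurable] = \<kappa>m A
  have \<kappa>': "(\<lambda>x. ennreal (\<kappa> (fst x) (snd x))) \<in> borel_measurable (lborel_bar L \<Otimes>\<^sub>M \<mu>)"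
    by measurable
  have \<kappa>'': "(\<lambda>x. ennreal (\<kappa> (fst x) (snd x)) * indicator A (fst x)) \<in> borel_measurable (lborel_bar L \<Otimes>\<^sub>M \<mu>)"
    using \<kappa>' by measurable
  have i: "(\<lambda>u. \<integral>\<^sup>+v. ennreal (\<kappa> u v) \<partial>\<mu>) \<in> borel_measurable (lborel_bar L)"
    using \<mu>.borel_measurable_nn_integral_fst[OF \<kappa>'] by simp
  have "A \<in> sets (lborel_bar L)" using A by (simp add: sets_lborel_bar)
  then have "emeasure (smoothing L \<kappa> \<mu>) A = (\<integral>\<^sup>+u. (\<integral>\<^sup>+v. ennreal (\<kappa> u v) \<partial>\<mu>) * indicator A u \<partial>lborel_bar L)"
    unfolding smoothing_def by (intro emeasure_density i)
  also have "\<dots> = (\<integral>\<^sup>+u. \<integral>\<^sup>+v. ennreal (\<kappa> u v) * indicator A u \<partial>\<mu> \<partial>lborel_bar L)"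
  proof (intro nn_integral_cong)
    fix u assume "u \<in> space (lborel_bar L)"
    then have "(\<lambda>v. ennreal (\<kappa> u v)) \<in> borel_measurable \<mu>"
      using measurable_Pair2[OF \<kappa>', of u] by simp
    then show "(\<integral>\<^sup>+v. ennreal (\<kappa> u v) \<partial>\<mu>) * indicator A u = (\<integral>\<^sup>+v. ennreal (\<kappa> u v) * indicator A u \<partial>\<mu>)"
      by (simp add: nn_integral_multc)
  qed
  also have "\<dots> = (\<integral>\<^sup>+v. kernel_mass L \<kappa> A v \<partial>\<mu>)"
    using Fubini[OF \<kappa>''] by (simp add: kernel_mass_def)
  finally show ?thesis .
qed

lemma emeasure_smoothing_le:
  assumes \<kappa>m: "(\<lambda>x. \<kappa> (fst x) (snd x)) \<in> borel_measurable (borel_bar L \<Otimes>\<^sub>M borel_bar L)"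
    and R: "0 \<le> R" and mass: "\<And>v. v \<in> Omega_bar L \<Longrightarrow> kernel_mass L \<kappa> (Omega_bar L) v \<le> ennreal R"
    and fin: "finite_measure \<mu>" and s: "sets \<mu> = sets (borel_bar L)"
  shows "emeasure (smoothing L \<kappa> \<mu>) (Omega_bar L) \<le> ennreal (R * measure \<mu> (Omega_bar L))"
proof -
  have sp: "space \<mu> = Omega_bar L" using sets_eq_imp_space_eq[OF s] by simp
  have "emeasure (smoothing L \<kappa> \<mu>) (Omega_bar L) \<le> (\<integral>\<^sup>+v. ennreal R \<partial>\<mu>)"
    unfolding emeasure_smoothing[OF \<kappa>m fin s Omega_bar_borel_bar] using mass sp by (intro nn_integral_mono) simp
  also have "\<dots> = ennreal (R * measure \<mu> (Omega_bar L))"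
    using R by (simp add: sp finite_measure.emeasure_eq_measure[OF fin] ennreal_mult)
  finally show ?thesis .
qed

lemma finite_smoothing:
  assumes \<kappa>m: "(\<lambda>x. \<kappa> (fst x) (snd x)) \<in> borel_measurable (borel_bar L \<Otimes>\<^sub>M borel_bar L)"
    and R: "0 \<le> R" and mass: "\<And>v. v \<in> Omega_bar L \<Longrightarrow> kernel_mass L \<kappa> (Omega_bar L) v \<le> ennreal R"
    and fin: "finite_measure \<mu>" and s: "sets \<mu> = sets (borel_bar L)"
  shows "finite_measure (smoothing L \<kappa> \<mu>)"
proof (rule finite_measureI)
  have "space (smoothing L \<kappa> \<mu>) = Omega_bar L"
    using sets_eq_imp_space_eq[OF sets_smoothing] by simp
  then show "emeasure (smoothing L \<kappa> \<mu>) (space (smoothing L \<kappa> \<mu>)) \<noteq> \<infinity>"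
    using emeasure_smoothing_le[OF assms] by (auto simp: top_unique)
qed

text \<open>Each point \<open>v\<close> sends its mass to its neighbours according to \<open>\<kappa>\<close>, as far as it can; a deficit
  of the kernel mass at \<open>v\<close> is absorbed by the diagonal, and an excess is drawn from it. Hence only the
  deviation of the kernel mass from one is paid at the distance from the diagonal.\<close>

lemma partial_ot_smoothing_le:
  assumes h: "0 < h" and R: "0 \<le> R" and q: "0 < q"
    and \<kappa>m: "(\<lambda>x. \<kappa> (fst x) (snd x)) \<in> borel_measurable (borel_bar L \<Otimes>\<^sub>M borel_bar L)"
    and \<kappa>0: "\<And>u v. 0 \<le> \<kappa> u v" and supp: "\<And>u v. \<kappa> u v \<noteq> 0 \<Longrightarrow> norm (u - v) \<le> h"
    and mass: "\<And>v. v \<in> Omega_bar L \<Longrightarrow> kernel_mass L \<kappa> (Omega_bar L) v \<le> ennreal R"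
    and fin: "finite_measure \<mu>" and s: "sets \<mu> = sets (borel_bar L)"
  defines "r \<equiv> kernel_mass L \<kappa> (Omega_bar L)"
  shows "partial_ot L q (smoothing L \<kappa> \<mu>) \<mu> \<le>
    ennreal ((1 + 3 powr q * R) * h powr q) * emeasure \<mu> (Omega_bar L) +
    ennreal (3 powr q + 1) * (\<integral>\<^sup>+v. ((r v - 1) + (1 - r v)) * ennreal (infdist v (Diag L) powr q) \<partial>\<mu>)"
proof -
  interpret \<mu>: finite_measure \<mu> by (rule fin)
  interpret lb: finite_measure "lborel_bar L" by (rule finite_lborel_bar)
  interpret pair_sigma_finite "lborel_bar L" \<mu> ..
  note [measurable_cong] = s
  note [measurable] = \<kappa>m diag_proj_measurable
  let ?N = "borel_bar L \<Otimes>\<^sub>M borel_bar L" and ?P = "lborel_bar L \<Otimes>\<^sub>M \<mu>"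
  have sp: "space \<mu> = Omega_bar L" using sets_eq_imp_space_eq[OF s] by simp
  have sP: "sets ?P = sets ?N" by (intro sets_pair_measure_cong sets_lborel_bar s)
  have rm[measurable]: "r \<in> borel_measurable (borel_bar L)"
    unfolding r_def by (rule kernel_mass_measurable[OF \<kappa>m]) simp
  have rR: "r v \<le> ennreal R" if "v \<in> Omega_bar L" for v using mass[OF that] by (simp add: r_def)
  define d where "d v = ennreal (infdist v (Diag L) powr q)" for v
  have dm[measurable]: "d \<in> borel_measurable (borel_bar L)"
  proof -
    have "(\<lambda>v. infdist v (Diag L)) \<in> borel_measurable borel"
      by (intro borel_measurable_continuous_onI continuous_intros)
    then have "d \<in> borel_measurable borel" unfolding d_def by measurable
    then show ?thesis by (rule measurable_restrict_space1)
  qed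
  \<comment> \<open>The fraction of the kernel at \<open>v\<close> that can be paid with the mass at \<open>v\<close>; it is one where \<open>r v = 0\<close>.\<close>
  define t where "t v = min 1 (1 / r v)" for v
  have tm[measurable]: "t \<in> borel_measurable (borel_bar L)" unfolding t_def by measurable
  have t1: "t v \<le> 1" "t v + (1 - t v) = 1" for v by (auto simp: t_def)
  have tr: "t v * r v = min (r v) 1" "(1 - t v) * r v = r v - 1" "min (r v) 1 + (1 - r v) = 1"
    if v: "v \<in> Omega_bar L" for v
  proof -
    obtain x where x: "r v = ennreal x" "0 \<le> x" using rR[OF v] by (cases "r v") (auto simp: top_unique)
    consider "x = 0" | "0 < x" "x \<le> 1" | "x > 1" using x by linarith
    then have "t v * r v = min (r v) 1 \<and> (1 - t v) * r v = r v - 1 \<and> min (r v) 1 + (1 - r v) = 1"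
    proof cases
      case 1
      then show ?thesis by (simp add: t_def x)
    next
      case 2
      then have "1 / r v = ennreal (1 / x)" using divide_ennreal[of 1 x] by (simp add: x)
      moreover have "1 \<le> ennreal (1 / x)" using 2 by (simp add: le_divide_eq_1_pos)
      ultimately have t: "t v = 1" by (simp add: t_def)
      have "ennreal x + (1 - ennreal x) = 1" "ennreal x - 1 = 0" "ennreal x \<le> 1"
        using 2 by (simp_all add: ennreal_minus ennreal_neg flip: ennreal_1 ennreal_plus)
      then show ?thesis by (simp add: t x min_def)
    next
      case 3
      then have "1 / r v = ennreal (1 / x)" using divide_ennreal[of 1 x] by (simp add: x)
      moreover have "ennreal (1 / x) \<le> 1" using 3 by simp
      ultimately have t: "t v = ennreal (1 / x)" by (simp add: t_def min_def)
      have "ennreal (1 / x) * ennreal x = 1" using 3 by (simp flip: ennreal_mult)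
      moreover have "(1 - ennreal (1 / x)) * ennreal x = ennreal x - 1"
      proof -
        have "1 - ennreal (1 / x) = ennreal (1 - 1 / x)"
          using 3 by (simp add: ennreal_minus flip: ennreal_1)
        then have "(1 - ennreal (1 / x)) * ennreal x = ennreal ((1 - 1 / x) * x)"
          using 3 by (simp add: ennreal_mult)
        also have "(1 - 1 / x) * x = x - 1" using 3 by (simp add: field_simps)
        finally show ?thesis using 3 by (simp add: ennreal_minus flip: ennreal_1)
      qed
      moreover have "1 - ennreal x = 0" "1 \<le> ennreal x"
        using 3 by (simp_all add: ennreal_minus ennreal_neg flip: ennreal_1)
      ultimately show ?thesis by (simp add: t x min_def)
    qed
    then show "t v * r v = min (r v) 1" "(1 - t v) * r v = r v - 1" "min (r v) 1 + (1 - r v) = 1" by auto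
  qed
  have trx: "r v * (t v * x) = min (r v) 1 * x" if "v \<in> Omega_bar L" for v x
    using tr(1)[OF that] by (metis mult.assoc mult.commute)
  have integ: "(\<integral>\<^sup>+x. ennreal (\<kappa> (fst x) (snd x)) * f (snd x) \<partial>?P) = (\<integral>\<^sup>+v. r v * f v \<partial>\<mu>)"
    if [measurable]: "f \<in> borel_measurable (borel_bar L)" for f
  proof -
    have mf: "(\<lambda>x. ennreal (\<kappa> (fst x) (snd x)) * f (snd x)) \<in> borel_measurable ?P" by measurable
    have "(\<integral>\<^sup>+x. ennreal (\<kappa> (fst x) (snd x)) * f (snd x) \<partial>?P) =
        (\<integral>\<^sup>+v. \<integral>\<^sup>+u. ennreal (\<kappa> u v) * f v \<partial>lborel_bar L \<partial>\<mu>)"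
      using nn_integral_snd[OF mf] by simp
    also have "\<dots> = (\<integral>\<^sup>+v. r v * f v \<partial>\<mu>)"
    proof (intro nn_integral_cong)
      fix v assume "v \<in> space \<mu>"
      then have [measurable]: "(\<lambda>u. ennreal (\<kappa> u v)) \<in> borel_measurable (lborel_bar L)"
        using measurable_Pair1[of "\<lambda>x. ennreal (\<kappa> (fst x) (snd x))" "lborel_bar L" \<mu> borel v]
        by simp
      have "(\<integral>\<^sup>+u. ennreal (\<kappa> u v) * f v \<partial>lborel_bar L) = (\<integral>\<^sup>+u. ennreal (\<kappa> u v) \<partial>lborel_bar L) * f v"
        by (simp add: nn_integral_multc)
      also have "(\<integral>\<^sup>+u. ennreal (\<kappa> u v) \<partial>lborel_bar L) = r v"
        unfolding r_def kernel_mass_def by (intro nn_integral_cong) (auto simp: space_restrict_space)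
      finally show "(\<integral>\<^sup>+u. ennreal (\<kappa> u v) * f v \<partial>lborel_bar L) = r v * f v" .
    qed
    finally show ?thesis .
  qed
  define push where "push f g = distr (density ?P (\<lambda>x. ennreal (\<kappa> (fst x) (snd x)) * f (snd x))) ?N g" for f g
  have push: "(\<integral>\<^sup>+x. F x \<partial>push f g) = (\<integral>\<^sup>+x. ennreal (\<kappa> (fst x) (snd x)) * f (snd x) * F (g x) \<partial>?P)"
    if [measurable]: "f \<in> borel_measurable (borel_bar L)" "g \<in> ?N \<rightarrow>\<^sub>M ?N" "F \<in> borel_measurable ?N" for f g F
  proof -
    have 1: "(\<lambda>x. ennreal (\<kappa> (fst x) (snd x)) * f (snd x)) \<in> borel_measurable ?P" by measurable
    have 2: "g \<in> density ?P (\<lambda>x. ennreal (\<kappa> (fst x) (snd x)) * f (snd x)) \<rightarrow>\<^sub>M ?N" by measurable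
    have 3: "(\<lambda>x. F (g x)) \<in> borel_measurable ?P" by measurable
    show ?thesis unfolding push_def by (simp add: nn_integral_distr[OF 2] nn_integral_density[OF 1 3])
  qed
  define g1 g2 g3 where "g1 = (\<lambda>x::(real \<times> real) \<times> (real \<times> real). x)"
    and "g2 = (\<lambda>x::(real \<times> real) \<times> (real \<times> real). (fst x, diag_proj (fst x)))"
    and "g3 = (\<lambda>v::real \<times> real. (diag_proj v, v))"
  have g[measurable]: "g1 \<in> ?N \<rightarrow>\<^sub>M ?N" "g2 \<in> ?N \<rightarrow>\<^sub>M ?N" "g3 \<in> borel_bar L \<rightarrow>\<^sub>M ?N"
    unfolding g1_def g2_def g3_def by measurable
  \<comment> \<open>\<open>\<pi>1\<close> moves mass to neighbours, \<open>\<pi>2\<close> draws the excess of the kernel from the projection of the target point, and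
    \<open>\<pi>3\<close> sends the deficit to the projection of the source point.\<close>
  define \<pi>1 \<pi>2 \<pi>3 where "\<pi>1 = push t g1" and "\<pi>2 = push (\<lambda>v. 1 - t v) g2"
    and "\<pi>3 = distr (density \<mu> (\<lambda>v. 1 - r v)) ?N g3"
  have n1: "(\<integral>\<^sup>+x. F x \<partial>\<pi>1) = (\<integral>\<^sup>+x. ennreal (\<kappa> (fst x) (snd x)) * t (snd x) * F (g1 x) \<partial>?P)"
    and n2: "(\<integral>\<^sup>+x. F x \<partial>\<pi>2) = (\<integral>\<^sup>+x. ennreal (\<kappa> (fst x) (snd x)) * (1 - t (snd x)) * F (g2 x) \<partial>?P)"
    and n3: "(\<integral>\<^sup>+x. F x \<partial>\<pi>3) = (\<integral>\<^sup>+v. (1 - r v) * F (g3 v) \<partial>\<mu>)"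
    if F[measurable]: "F \<in> borel_measurable ?N" for F
  proof -
    show "(\<integral>\<^sup>+x. F x \<partial>\<pi>1) = (\<integral>\<^sup>+x. ennreal (\<kappa> (fst x) (snd x)) * t (snd x) * F (g1 x) \<partial>?P)"
      unfolding \<pi>1_def by (rule push) measurable
    show "(\<integral>\<^sup>+x. F x \<partial>\<pi>2) = (\<integral>\<^sup>+x. ennreal (\<kappa> (fst x) (snd x)) * (1 - t (snd x)) * F (g2 x) \<partial>?P)"
      unfolding \<pi>2_def by (rule push) measurable
    have 1: "(\<lambda>v. 1 - r v) \<in> borel_measurable \<mu>" by measurable
    have 2: "g3 \<in> density \<mu> (\<lambda>v. 1 - r v) \<rightarrow>\<^sub>M ?N" by measurable
    have 3: "(\<lambda>v. F (g3 v)) \<in> borel_measurable \<mu>" by measurable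
    show "(\<integral>\<^sup>+x. F x \<partial>\<pi>3) = (\<integral>\<^sup>+v. (1 - r v) * F (g3 v) \<partial>\<mu>)"
      unfolding \<pi>3_def by (simp add: nn_integral_distr[OF 2] nn_integral_density[OF 1 3])
  qed
  have st: "sets \<pi>1 = sets ?N" "sets \<pi>2 = sets ?N" "sets \<pi>3 = sets ?N"
    by (simp_all add: \<pi>1_def \<pi>2_def \<pi>3_def push_def)
  have em: "emeasure \<pi> B = (\<integral>\<^sup>+x. indicator B x \<partial>\<pi>)" if "sets \<pi> = sets ?N" "B \<in> sets ?N" for \<pi> B
    using that by (intro nn_integral_indicator[symmetric]) simp
  have \<mu>le: "(\<integral>\<^sup>+v. f v \<partial>\<mu>) \<le> ennreal c * emeasure \<mu> (Omega_bar L)"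
    if "\<And>v. v \<in> Omega_bar L \<Longrightarrow> f v \<le> ennreal c" for f c
  proof -
    have "(\<integral>\<^sup>+v. f v \<partial>\<mu>) \<le> (\<integral>\<^sup>+v. ennreal c \<partial>\<mu>)" using that sp by (intro nn_integral_mono) simp
    then show ?thesis by (simp add: sp)
  qed
  have finI: "finite_measure \<pi>" if "sets \<pi> = sets ?N" "(\<integral>\<^sup>+x. 1 \<partial>\<pi>) \<le> ennreal c * emeasure \<mu> (Omega_bar L)" for \<pi> c
    using that(2) \<mu>.emeasure_finite[of "Omega_bar L"]
    by (intro finite_measureI) (auto simp: top_unique ennreal_mult_eq_top_iff)
  have "(\<integral>\<^sup>+x. 1 \<partial>\<pi>1) \<le> ennreal 1 * emeasure \<mu> (Omega_bar L)"
    using n1[of "\<lambda>_. 1"] integ[OF tm] tr(1) by (simp add: \<mu>le[of _ 1, simplified] mult.commute)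
  then have f1: "finite_measure \<pi>1" by (rule finI[OF st(1)])
  have m2: "(\<lambda>v. 1 - t v) \<in> borel_measurable (borel_bar L)" by measurable
  have "(\<integral>\<^sup>+x. 1 \<partial>\<pi>2) \<le> ennreal R * emeasure \<mu> (Omega_bar L)"
  proof -
    have "(\<integral>\<^sup>+x. 1 \<partial>\<pi>2) = (\<integral>\<^sup>+v. r v * (1 - t v) \<partial>\<mu>)"
      using n2[of "\<lambda>_. 1"] integ[OF m2] by simp
    also have "\<dots> \<le> ennreal R * emeasure \<mu> (Omega_bar L)"
    proof (rule \<mu>le)
      fix v assume v: "v \<in> Omega_bar L"
      have "r v * (1 - t v) \<le> r v * 1" by (intro mult_left_mono) auto
      then show "r v * (1 - t v) \<le> ennreal R" using rR[OF v] by simp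
    qed
    finally show ?thesis .
  qed
  then have f2: "finite_measure \<pi>2" by (rule finI[OF st(2)])
  have "(\<integral>\<^sup>+x. 1 \<partial>\<pi>3) \<le> ennreal 1 * emeasure \<mu> (Omega_bar L)"
    using n3[of "\<lambda>_. 1"] by (simp add: \<mu>le[of _ 1, simplified])
  then have f3: "finite_measure \<pi>3" by (rule finI[OF st(3)])
  have "partial_ot L q (smoothing L \<kappa> \<mu>) \<mu> \<le> transport_cost q \<pi>1 + transport_cost q \<pi>2 + transport_cost q \<pi>3"
  proof (rule partial_ot_le_three[OF f1 f2 f3 st finite_smoothing[OF \<kappa>m R mass fin s] fin])
    fix A assume A: "A \<in> sets borel" "A \<subseteq> Omega L"
    then have Ab[measurable]: "A \<in> sets (borel_bar L)" using Omega_subset by (auto simp: sets_borel_bar)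
    have AN[measurable]: "A \<times> Omega_bar L \<in> sets ?N" "Omega_bar L \<times> A \<in> sets ?N" by auto
    have np: "diag_proj u \<notin> A" "diag_proj u \<in> Omega_bar L" if "u \<in> Omega_bar L" for u
      using diag_proj_mem[OF that] A(2) Diag_subset by (auto simp: Diag_eq)
    have spP: "space ?P = Omega_bar L \<times> Omega_bar L"
      by (simp add: space_pair_measure sp space_restrict_space)
    have A1: "indicator (A \<times> Omega_bar L) (g1 x) = (indicator A (fst x) :: ennreal)"
      "indicator (A \<times> Omega_bar L) (g2 x) = (indicator A (fst x) :: ennreal)"
      "indicator (Omega_bar L \<times> A) (g1 x) = (indicator A (snd x) :: ennreal)"
      "indicator (Omega_bar L \<times> A) (g2 x) = (0 :: ennreal)" if "x \<in> space ?P" for x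
      using that np[of "fst x"] by (auto simp: g1_def g2_def spP indicator_def)
    have A3: "indicator (A \<times> Omega_bar L) (g3 v) = (0 :: ennreal)"
      "indicator (Omega_bar L \<times> A) (g3 v) = (indicator A v :: ennreal)" if "v \<in> space \<mu>" for v
      using that np[of v] by (auto simp: g3_def sp indicator_def)
    have mf: "(\<lambda>x. ennreal (\<kappa> (fst x) (snd x)) * indicator A (fst x)) \<in> borel_measurable ?P" by measurable
    have "emeasure (smoothing L \<kappa> \<mu>) A = (\<integral>\<^sup>+v. \<integral>\<^sup>+u. ennreal (\<kappa> u v) * indicator A u \<partial>lborel_bar L \<partial>\<mu>)"
      using emeasure_smoothing[OF \<kappa>m fin s Ab] by (simp add: kernel_mass_def)
    also have "\<dots> = (\<integral>\<^sup>+x. ennreal (\<kappa> (fst x) (snd x)) * indicator A (fst x) \<partial>?P)"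
      using nn_integral_snd[OF mf] by simp
    also have "\<dots> = (\<integral>\<^sup>+x. ennreal (\<kappa> (fst x) (snd x)) * t (snd x) * indicator A (fst x)
        + ennreal (\<kappa> (fst x) (snd x)) * (1 - t (snd x)) * indicator A (fst x) \<partial>?P)"
      by (intro nn_integral_cong) (simp add: t1 flip: distrib_left distrib_right)
    also have "\<dots> = (\<integral>\<^sup>+x. ennreal (\<kappa> (fst x) (snd x)) * t (snd x) * indicator A (fst x) \<partial>?P)
        + (\<integral>\<^sup>+x. ennreal (\<kappa> (fst x) (snd x)) * (1 - t (snd x)) * indicator A (fst x) \<partial>?P)"
      by (intro nn_integral_add) measurable
    also have "\<dots> = emeasure \<pi>1 (A \<times> Omega_bar L) + emeasure \<pi>2 (A \<times> Omega_bar L)"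
      using A1 by (simp add: em[OF st(1) AN(1)] em[OF st(2) AN(1)] n1 n2 cong: nn_integral_cong)
    also have "emeasure \<pi>3 (A \<times> Omega_bar L) = 0"
      using A3 by (simp add: em[OF st(3) AN(1)] n3 cong: nn_integral_cong)
    ultimately show "emeasure (smoothing L \<kappa> \<mu>) A = emeasure \<pi>1 (A \<times> Omega_bar L)
        + emeasure \<pi>2 (A \<times> Omega_bar L) + emeasure \<pi>3 (A \<times> Omega_bar L)" by simp
    have ti: "(\<lambda>v. t v * indicator A v) \<in> borel_measurable (borel_bar L)" by measurable
    have "emeasure \<pi>1 (Omega_bar L \<times> A) = (\<integral>\<^sup>+x. ennreal (\<kappa> (fst x) (snd x)) * (t (snd x) * indicator A (snd x)) \<partial>?P)"
      using A1 by (simp add: em[OF st(1) AN(2)] n1 mult.assoc cong: nn_integral_cong)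
    also have "\<dots> = (\<integral>\<^sup>+v. min (r v) 1 * indicator A v \<partial>\<mu>)"
      unfolding integ[OF ti] using trx sp by (intro nn_integral_cong) simp
    finally have e1: "emeasure \<pi>1 (Omega_bar L \<times> A) = (\<integral>\<^sup>+v. min (r v) 1 * indicator A v \<partial>\<mu>)" .
    have e2: "emeasure \<pi>2 (Omega_bar L \<times> A) = 0"
      using A1 by (simp add: em[OF st(2) AN(2)] n2 cong: nn_integral_cong)
    have e3: "emeasure \<pi>3 (Omega_bar L \<times> A) = (\<integral>\<^sup>+v. (1 - r v) * indicator A v \<partial>\<mu>)"
      using A3 by (simp add: em[OF st(3) AN(2)] n3 cong: nn_integral_cong)
    have "emeasure \<pi>1 (Omega_bar L \<times> A) + emeasure \<pi>2 (Omega_bar L \<times> A) + emeasure \<pi>3 (Omega_bar L \<times> A)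
      = (\<integral>\<^sup>+v. min (r v) 1 * indicator A v + (1 - r v) * indicator A v \<partial>\<mu>)"
      unfolding e1 e2 e3 by (subst nn_integral_add) simp_all
    also have "\<dots> = (\<integral>\<^sup>+v. indicator A v \<partial>\<mu>)"
      using tr(3) sp by (intro nn_integral_cong) (simp flip: distrib_right)
    also have "\<dots> = emeasure \<mu> A" using Ab s by (intro nn_integral_indicator) simp
    finally show "emeasure \<mu> A = emeasure \<pi>1 (Omega_bar L \<times> A) + emeasure \<pi>2 (Omega_bar L \<times> A)
      + emeasure \<pi>3 (Omega_bar L \<times> A)" by simp
  qed
  also have "transport_cost q \<pi>1 \<le> ennreal (h powr q) * emeasure \<mu> (Omega_bar L)"
  proof -
    have m: "(\<lambda>v. t v * ennreal (h powr q)) \<in> borel_measurable (borel_bar L)" by measurable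
    have "transport_cost q \<pi>1 \<le> (\<integral>\<^sup>+x. ennreal (\<kappa> (fst x) (snd x)) * (t (snd x) * ennreal (h powr q)) \<partial>?P)"
      unfolding transport_cost_def n1[OF measurable_transport_cost]
    proof (intro nn_integral_mono)
      fix x
      show "ennreal (\<kappa> (fst x) (snd x)) * t (snd x) * ennreal (norm (fst (g1 x) - snd (g1 x)) powr q)
        \<le> ennreal (\<kappa> (fst x) (snd x)) * (t (snd x) * ennreal (h powr q))"
      proof (cases "\<kappa> (fst x) (snd x) = 0")
        case False
        then have "norm (fst x - snd x) powr q \<le> h powr q" using supp q by (intro powr_mono2) auto
        then show ?thesis unfolding mult.assoc g1_def by (intro mult_left_mono ennreal_leI) auto
      qed simp
    qed
    also have "\<dots> = (\<integral>\<^sup>+v. min (r v) 1 * ennreal (h powr q) \<partial>\<mu>)"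
      unfolding integ[OF m] using trx sp by (intro nn_integral_cong) simp
    also have "\<dots> \<le> ennreal (h powr q) * emeasure \<mu> (Omega_bar L)"
    proof (rule \<mu>le)
      fix v
      have "min (r v) 1 * ennreal (h powr q) \<le> 1 * ennreal (h powr q)" by (intro mult_right_mono) auto
      then show "min (r v) 1 * ennreal (h powr q) \<le> ennreal (h powr q)" by simp
    qed
    finally show ?thesis .
  qed
  also have "transport_cost q \<pi>2 \<le> ennreal (3 powr q) * ((\<integral>\<^sup>+v. ((r v - 1) + (1 - r v)) * d v \<partial>\<mu>)
      + ennreal (R * h powr q) * emeasure \<mu> (Omega_bar L))"
  proof -
    have m: "(\<lambda>v. (1 - t v) * (ennreal (3 powr q) * (d v + ennreal (h powr q)))) \<in> borel_measurable (borel_bar L)"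
      by measurable
    have "transport_cost q \<pi>2 \<le> (\<integral>\<^sup>+x. ennreal (\<kappa> (fst x) (snd x)) * ((1 - t (snd x)) *
        (ennreal (3 powr q) * (d (snd x) + ennreal (h powr q)))) \<partial>?P)"
      unfolding transport_cost_def n2[OF measurable_transport_cost]
    proof (intro nn_integral_mono)
      fix x assume x: "x \<in> space ?P"
      show "ennreal (\<kappa> (fst x) (snd x)) * (1 - t (snd x)) * ennreal (norm (fst (g2 x) - snd (g2 x)) powr q)
        \<le> ennreal (\<kappa> (fst x) (snd x)) * ((1 - t (snd x)) * (ennreal (3 powr q) * (d (snd x) + ennreal (h powr q))))"
      proof (cases "\<kappa> (fst x) (snd x) = 0")
        case False
        have "fst x \<in> Omega_bar L" using x by (auto simp: space_pair_measure space_restrict_space)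
        then have "norm (fst x - diag_proj (fst x)) = infdist (fst x) (Diag L)" by (rule norm_diag_proj)
        also have "\<dots> \<le> infdist (snd x) (Diag L) + dist (fst x) (snd x)" by (rule infdist_triangle)
        also have "\<dots> \<le> infdist (snd x) (Diag L) + h + 0" using supp[OF False] by (simp add: dist_norm)
        finally have "norm (fst x - diag_proj (fst x)) powr q \<le> (infdist (snd x) (Diag L) + h + 0) powr q"
          using q by (intro powr_mono2) auto
        also have "\<dots> \<le> 3 powr q * (infdist (snd x) (Diag L) powr q + h powr q + 0 powr q)"
          using q h by (intro powr_add_le) (auto simp: infdist_nonneg)
        finally have "ennreal (norm (fst x - diag_proj (fst x)) powr q)
            \<le> ennreal (3 powr q * (infdist (snd x) (Diag L) powr q + h powr q))"
          by (intro ennreal_leI) simp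
        also have "\<dots> = ennreal (3 powr q) * (d (snd x) + ennreal (h powr q))"
          by (simp add: d_def ennreal_mult)
        finally show ?thesis unfolding mult.assoc g2_def fst_conv snd_conv by (intro mult_left_mono) auto
      qed simp
    qed
    also have "\<dots> = (\<integral>\<^sup>+v. ennreal (3 powr q) * ((r v - 1) * d v + (r v - 1) * ennreal (h powr q)) \<partial>\<mu>)"
      unfolding integ[OF m]
    proof (intro nn_integral_cong)
      fix v assume "v \<in> space \<mu>"
      then have "r v - 1 = (1 - t v) * r v" using tr(2)[of v] sp by simp
      then show "r v * ((1 - t v) * (ennreal (3 powr q) * (d v + ennreal (h powr q)))) =
        ennreal (3 powr q) * ((r v - 1) * d v + (r v - 1) * ennreal (h powr q))"
        by (simp add: distrib_left mult_ac)
    qed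
    also have "\<dots> = ennreal (3 powr q) * ((\<integral>\<^sup>+v. (r v - 1) * d v \<partial>\<mu>) + (\<integral>\<^sup>+v. (r v - 1) * ennreal (h powr q) \<partial>\<mu>))"
      by (simp add: nn_integral_cmult nn_integral_add)
    also have "\<dots> \<le> ennreal (3 powr q) * ((\<integral>\<^sup>+v. ((r v - 1) + (1 - r v)) * d v \<partial>\<mu>)
        + ennreal (R * h powr q) * emeasure \<mu> (Omega_bar L))"
    proof (intro mult_left_mono add_mono nn_integral_mono mult_right_mono \<mu>le)
      fix v assume v: "v \<in> Omega_bar L"
      have "r v - 1 \<le> ennreal R" using rR[OF v] diff_le_self_ennreal order_trans by blast
      then have "(r v - 1) * ennreal (h powr q) \<le> ennreal R * ennreal (h powr q)" by (intro mult_right_mono) auto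
      then show "(r v - 1) * ennreal (h powr q) \<le> ennreal (R * h powr q)" using R by (simp add: ennreal_mult)
    qed auto
    finally show ?thesis .
  qed
  also have "transport_cost q \<pi>3 \<le> (\<integral>\<^sup>+v. ((r v - 1) + (1 - r v)) * d v \<partial>\<mu>)"
    unfolding transport_cost_def n3[OF measurable_transport_cost]
  proof (intro nn_integral_mono)
    fix v assume "v \<in> space \<mu>"
    then have "norm (diag_proj v - v) = infdist v (Diag L)" using norm_diag_proj[of v L] sp by (simp add: norm_minus_commute)
    then show "(1 - r v) * ennreal (norm (fst (g3 v) - snd (g3 v)) powr q) \<le> ((r v - 1) + (1 - r v)) * d v"
      by (simp add: g3_def d_def mult_right_mono)
  qed
  finally have "partial_ot L q (smoothing L \<kappa> \<mu>) \<mu> \<le> ennreal (h powr q) * emeasure \<mu> (Omega_bar L)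
     + ennreal (3 powr q) * ((\<integral>\<^sup>+v. ((r v - 1) + (1 - r v)) * d v \<partial>\<mu>) + ennreal (R * h powr q) * emeasure \<mu> (Omega_bar L))
     + (\<integral>\<^sup>+v. ((r v - 1) + (1 - r v)) * d v \<partial>\<mu>)"
    by (simp add: add_mono)
  also have "\<dots> = ennreal ((1 + 3 powr q * R) * h powr q) * emeasure \<mu> (Omega_bar L)
     + ennreal (3 powr q + 1) * (\<integral>\<^sup>+v. ((r v - 1) + (1 - r v)) * d v \<partial>\<mu>)"
    using R by (simp add: distrib_left distrib_right ennreal_mult add_ac mult_ac)
  finally show ?thesis by (simp add: d_def)
qed

lemma kernel_const_nonneg:
  fixes K :: "'a::euclidean_space \<Rightarrow> real"
  assumes "\<And>x. 0 \<le> K x" "0 < h"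
  shows "0 \<le> kernel_const K S h z"
  unfolding kernel_const_def set_lebesgue_integral_def using assms by (intro Bochner_Integration.integral_nonneg) auto

lemma kernel_shift_measurable:
  fixes K :: "'a::euclidean_space \<Rightarrow> real"
  assumes "K \<in> borel_measurable borel"
  shows "(\<lambda>x. K ((snd x - fst x) /\<^sub>R h)) \<in> borel_measurable (borel \<Otimes>\<^sub>M borel)"
proof -
  have "(\<lambda>x::'a \<times> 'a. (snd x - fst x) /\<^sub>R h) \<in> borel_measurable borel"
    by (intro borel_measurable_continuous_onI continuous_intros)
  from measurable_compose[OF this assms] show ?thesis by (simp add: borel_prod)
qed

lemma kernel_const_measurable:
  fixes K :: "'a::euclidean_space \<Rightarrow> real"
  assumes K: "K \<in> borel_measurable borel" and S: "S \<in> sets borel"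
  shows "kernel_const K S h \<in> borel_measurable borel"
proof -
  note [measurable] = kernel_shift_measurable[OF K, of h] S
  have "(\<lambda>x. indicator S (snd x) *\<^sub>R (K ((snd x - fst x) /\<^sub>R h) / h ^ DIM('a)))
      \<in> borel_measurable (borel \<Otimes>\<^sub>M lborel)" (is ?m) by measurable
  from lborel.borel_measurable_lebesgue_integral[of "\<lambda>z z'. indicator S z' *\<^sub>R (K ((z' - z) /\<^sub>R h) / h ^ DIM('a))" borel]
  show ?thesis using \<open>?m\<close>
    by (simp add: kernel_const_def[abs_def] set_lebesgue_integral_def case_prod_unfold)
qed

lemma nn_integral_lborel_bar:
  "f \<in> borel_measurable (borel_bar L) \<Longrightarrow>
    (\<integral>\<^sup>+u. f u \<partial>lborel_bar L) = (\<integral>\<^sup>+u. f u * indicator (Omega_bar L) u \<partial>lborel)"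
  by (rule nn_integral_restrict_space) simp

text \<open>What the smoothing step needs of the corrected kernel: the edge correction keeps its total mass
  bounded, uniformly in small bandwidths.\<close>

lemma kernel_corr_bounds:
  fixes K :: "real \<times> real \<Rightarrow> real"
  assumes K: "admissible_kernel K" and L: "L > 0"
  obtains R h0 where "R > 0" "h0 > 0"
    "\<And>h. 0 < h \<Longrightarrow> (\<lambda>x. kernel_corr K (Omega_bar L) h (fst x) (snd x)) \<in> borel_measurable (borel_bar L \<Otimes>\<^sub>M borel_bar L)"
    "\<And>h u v. 0 < h \<Longrightarrow> 0 \<le> kernel_corr K (Omega_bar L) h u v"
    "\<And>h u v. 0 < h \<Longrightarrow> kernel_corr K (Omega_bar L) h u v \<noteq> 0 \<Longrightarrow> norm (u - v) \<le> h"
    "\<And>h v. 0 < h \<Longrightarrow> h \<le> h0 \<Longrightarrow>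
      kernel_mass L (kernel_corr K (Omega_bar L) h) (Omega_bar L) v \<le> ennreal R"
    "\<And>h u v. 0 < h \<Longrightarrow> h \<le> h0 \<Longrightarrow> u \<in> Omega_bar L \<Longrightarrow> kernel_corr K (Omega_bar L) h u v \<le> R / h\<^sup>2"
proof -
  obtain B where *: "B > 0" "\<And>x. 0 \<le> K x" "\<And>x. K x \<le> B"
    "\<And>x. K x \<noteq> 0 \<Longrightarrow> norm x \<le> 1" and Km: "K \<in> borel_measurable borel"
    using admissible_kernelE[OF K] by metis
  obtain c h0 where c: "c > 0" "h0 > 0"
    and kc: "\<And>h z. 0 < h \<Longrightarrow> h \<le> h0 \<Longrightarrow> z \<in> Omega_bar L \<Longrightarrow> c \<le> kernel_const K (Omega_bar L) h z"
    using kernel_const_ge[OF K inner_balls_Omega_bar[OF L] Omega_bar_borel] by blast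
  let ?\<kappa> = "kernel_corr K (Omega_bar L)"
  define V where "V = unit_ball_vol (real DIM(real \<times> real))"
  have V: "V > 0" unfolding V_def by (rule unit_ball_vol_pos) simp
  define R where "R = max (B / c * V) (B / c)"
  have meas: "(\<lambda>x. ?\<kappa> h (fst x) (snd x)) \<in> borel_measurable (borel \<Otimes>\<^sub>M borel)" for h
  proof -
    note [measurable] = kernel_shift_measurable[OF Km, of h] kernel_const_measurable[OF Km Omega_bar_borel[of L], of h]
    show ?thesis unfolding kernel_corr_def by measurable
  qed
  have nn: "0 \<le> ?\<kappa> h u v" if "0 < h" for h u v
    using that kernel_const_nonneg[of K h "Omega_bar L" u] *(2) by (simp add: kernel_corr_def)
  have sp: "norm (u - v) \<le> h" if "0 < h" "?\<kappa> h u v \<noteq> 0" for h u v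
  proof -
    have "K ((v - u) /\<^sub>R h) \<noteq> 0" using that by (auto simp: kernel_corr_def)
    then have "norm ((v - u) /\<^sub>R h) \<le> 1" by (rule *(4))
    then have "norm (v - u) \<le> 1 * h" by (simp only: norm_scaled_le[OF that(1)])
    then show ?thesis by (simp add: norm_minus_commute)
  qed
  have up: "?\<kappa> h u v \<le> B / c / h\<^sup>2" if "0 < h" "h \<le> h0" "u \<in> Omega_bar L" for h u v
  proof -
    have "?\<kappa> h u v \<le> (B / h ^ DIM(real \<times> real)) / c"
      unfolding kernel_corr_def using kc[OF that] * c that
      by (intro frac_le divide_right_mono) auto
    also have "\<dots> = B / c / h\<^sup>2" by (simp add: power2_eq_square)
    finally show ?thesis .
  qed
  show thesis
  proof (rule that[of R h0])
    show "R > 0" using * c V by (auto simp: R_def less_max_iff_disj)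
    show "h0 > 0" by fact
    fix h :: real assume h: "0 < h"
    show "(\<lambda>x. ?\<kappa> h (fst x) (snd x)) \<in> borel_measurable (borel_bar L \<Otimes>\<^sub>M borel_bar L)"
      using measurable_compose[OF measurable_id_borel_bar_pair meas[of h, unfolded borel_prod]] by simp
    show "0 \<le> ?\<kappa> h u v" for u v by (rule nn[OF h])
    show "norm (u - v) \<le> h" if "?\<kappa> h u v \<noteq> 0" for u v by (rule sp[OF h that])
    assume h0: "h \<le> h0"
    show "?\<kappa> h u v \<le> R / h\<^sup>2" if "u \<in> Omega_bar L" for u v
    proof -
      have "B / c / h\<^sup>2 \<le> R / h\<^sup>2" by (intro divide_right_mono) (auto simp: R_def)
      with up[OF h h0 that] show ?thesis by (rule order_trans)
    qed
    show "kernel_mass L (?\<kappa> h) (Omega_bar L) v \<le> ennreal R" for v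
    proof -
      let ?f = "\<lambda>u. if u \<in> Omega_bar L then ?\<kappa> h u v else 0"
      have "(\<lambda>u. ?\<kappa> h u v) \<in> borel_measurable borel"
        using measurable_compose[OF measurable_Pair2' meas[of h], of v] by simp
      then have "(\<lambda>u. ennreal (?\<kappa> h u v) * indicator (Omega_bar L) u) \<in> borel_measurable borel" by measurable
      then have "(\<lambda>u. ennreal (?\<kappa> h u v) * indicator (Omega_bar L) u) \<in> borel_measurable (borel_bar L)"
        by (rule measurable_restrict_space1)
      then have "kernel_mass L (?\<kappa> h) (Omega_bar L) v = (\<integral>\<^sup>+u. ennreal (?f u) \<partial>lborel)"
        unfolding kernel_mass_def
        by (simp add: nn_integral_lborel_bar) (auto intro!: nn_integral_cong simp: indicator_def)
      also have "\<dots> \<le> ennreal (B / c / h\<^sup>2 * V * h ^ DIM(real \<times> real))"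
        unfolding V_def
      proof (rule nn_integral_cball_le[where z = v])
        show "?f u \<le> B / c / h\<^sup>2" for u using up[OF h h0] * c by auto
        show "norm (u - v) \<le> h" if "?f u \<noteq> 0" for u using that sp[OF h] by (auto split: if_splits)
      qed (use h * c in auto)
      also have "B / c / h\<^sup>2 * V * h ^ DIM(real \<times> real) = B / c * V" using h by (simp add: power2_eq_square)
      also have "ennreal (B / c * V) \<le> ennreal R" by (intro ennreal_leI) (simp add: R_def)
      finally show ?thesis .
    qed
  qed
qed

text \<open>Links the Bochner integral \<open>r_U\<close> with the nonnegative integral used for couplings.\<close>

lemma r_U_eq:
  assumes "\<And>u v. 0 \<le> \<kappa> u v" "kernel_mass L \<kappa> (Omega_bar L) v \<le> ennreal R"
    and \<kappa>: "\<kappa> = kernel_corr K (Omega_bar L) h"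
    and m: "(\<lambda>x. \<kappa> (fst x) (snd x)) \<in> borel_measurable (borel_bar L \<Otimes>\<^sub>M borel_bar L)" and v: "v \<in> Omega_bar L"
  shows "ennreal (r_U L K h v) = kernel_mass L \<kappa> (Omega_bar L) v"
proof -
  have "(\<lambda>u. \<kappa> u v) \<in> borel_measurable (borel_bar L)"
    using measurable_Pair1[OF m, of v] v by simp
  then have m': "(\<lambda>u. \<kappa> u v) \<in> borel_measurable (lborel_bar L)"
    using measurable_cong_sets[OF sets_lborel_bar refl] by blast
  have "r_U L K h v = (\<integral>u. \<kappa> u v \<partial>lborel_bar L)"
    unfolding r_U_def set_lebesgue_integral_def \<kappa> by (rule integral_restrict_space[symmetric]) simp
  also have "\<dots> = enn2real (\<integral>\<^sup>+u. ennreal (\<kappa> u v) \<partial>lborel_bar L)"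
    using assms(1) m' by (intro integral_eq_nn_integral) auto
  also have "(\<integral>\<^sup>+u. ennreal (\<kappa> u v) \<partial>lborel_bar L) = kernel_mass L \<kappa> (Omega_bar L) v"
    unfolding kernel_mass_def by (intro nn_integral_cong) (auto simp: space_restrict_space)
  finally have "r_U L K h v = enn2real (kernel_mass L \<kappa> (Omega_bar L) v)" .
  moreover have "kernel_mass L \<kappa> (Omega_bar L) v \<noteq> top" using assms(2) by (auto simp: top_unique)
  ultimately show ?thesis by (simp add: ennreal_enn2real_if)
qed

lemma ennreal_abs_diff_one: "0 \<le> x \<Longrightarrow> (ennreal x - 1) + (1 - ennreal x) = ennreal \<bar>x - 1\<bar>"
  by (cases "x \<le> 1") (simp_all add: ennreal_minus ennreal_neg flip: ennreal_1)

text \<open>The distance between a conditional mean measure and its smoothed version: a term of order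
  \<open>h powr q\<close> from the moves to neighbours and the edge bias.\<close>

lemma smoothing_bias:
  assumes q: "q > 0" and R: "R > 0"
    and \<kappa>: "(\<lambda>x. kernel_corr K (Omega_bar L) h (fst x) (snd x)) \<in> borel_measurable (borel_bar L \<Otimes>\<^sub>M borel_bar L)"
      "\<And>u v. 0 \<le> kernel_corr K (Omega_bar L) h u v"
      "\<And>u v. kernel_corr K (Omega_bar L) h u v \<noteq> 0 \<Longrightarrow> norm (u - v) \<le> h"
      "\<And>v. kernel_mass L (kernel_corr K (Omega_bar L) h) (Omega_bar L) v \<le> ennreal R"
    and h: "0 < h"
    and \<Lambda>: "finite_measure (\<Lambda> z)" "sets (\<Lambda> z) = sets (borel_bar L)" "emeasure (\<Lambda> z) (Omega_bar L) \<le> ennreal m" "0 \<le> m"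
    and z: "z \<in> S" and bias: "bias_U L q K S \<Lambda> h \<le> ennreal b" "0 \<le> b"
  shows "partial_ot L q (smoothing L (kernel_corr K (Omega_bar L) h) (\<Lambda> z)) (\<Lambda> z)
    \<le> ennreal ((1 + 3 powr q * R) * m * h powr q + (3 powr q + 1) * b)"
proof -
  let ?\<kappa> = "kernel_corr K (Omega_bar L) h"
  let ?r = "kernel_mass L ?\<kappa> (Omega_bar L)"
  have sp: "space (\<Lambda> z) = Omega_bar L" using sets_eq_imp_space_eq[OF \<Lambda>(2)] by simp
  have "(\<integral>\<^sup>+v. ((?r v - 1) + (1 - ?r v)) * ennreal (infdist v (Diag L) powr q) \<partial>\<Lambda> z)
     = (\<integral>\<^sup>+v. ennreal (\<bar>r_U L K h v - 1\<bar> * infdist v (Diag L) powr q) \<partial>\<Lambda> z)"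
  proof (intro nn_integral_cong)
    fix v assume "v \<in> space (\<Lambda> z)"
    then have r: "?r v = ennreal (r_U L K h v)" using r_U_eq[OF \<kappa>(2) \<kappa>(4) refl \<kappa>(1)] sp by simp
    have "0 \<le> r_U L K h v"
      unfolding r_U_def set_lebesgue_integral_def using \<kappa>(2) by (intro Bochner_Integration.integral_nonneg) auto
    then show "((?r v - 1) + (1 - ?r v)) * ennreal (infdist v (Diag L) powr q)
      = ennreal (\<bar>r_U L K h v - 1\<bar> * infdist v (Diag L) powr q)"
      unfolding r by (simp add: ennreal_abs_diff_one ennreal_mult)
  qed
  also have "\<dots> \<le> bias_U L q K S \<Lambda> h"
    unfolding bias_U_def using z by (rule SUP_upper)
  also have "\<dots> \<le> ennreal b" by fact
  finally have I: "(\<integral>\<^sup>+v. ((?r v - 1) + (1 - ?r v)) * ennreal (infdist v (Diag L) powr q) \<partial>\<Lambda> z) \<le> ennreal b" .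
  have "partial_ot L q (smoothing L ?\<kappa> (\<Lambda> z)) (\<Lambda> z) \<le>
    ennreal ((1 + 3 powr q * R) * h powr q) * emeasure (\<Lambda> z) (Omega_bar L) +
    ennreal (3 powr q + 1) * (\<integral>\<^sup>+v. ((?r v - 1) + (1 - ?r v)) * ennreal (infdist v (Diag L) powr q) \<partial>\<Lambda> z)"
    by (rule partial_ot_smoothing_le[OF h less_imp_le[OF R] q \<kappa>(1,2) _ \<kappa>(4) \<Lambda>(1,2)])
      (rule \<kappa>(3))
  also have "\<dots> \<le> ennreal ((1 + 3 powr q * R) * h powr q) * ennreal m + ennreal (3 powr q + 1) * ennreal b"
    using \<Lambda>(3) I by (intro add_mono mult_left_mono) auto
  also have "\<dots> = ennreal ((1 + 3 powr q * R) * m * h powr q + (3 powr q + 1) * b)"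
    using R \<Lambda>(4) bias(2) by (simp add: ennreal_mult ennreal_plus mult_ac flip: ennreal_mult ennreal_plus)
  finally show ?thesis .
qed

section \<open>An exponential inequality\<close>

text \<open>For negative arguments this is the reciprocal of the quadratic lower Taylor bound of \<open>exp\<close>.\<close>

lemma exp_le_quadratic:
  fixes x :: real
  assumes "\<bar>x\<bar> \<le> 1"
  shows "exp x \<le> 1 + x + x\<^sup>2"
proof (cases "0 \<le> x")
  case True
  then show ?thesis using assms exp_bound by auto
next
  case False
  define y where "y = - x"
  have y: "0 \<le> y" using False by (simp add: y_def)
  have q: "0 < 1 + y + y\<^sup>2 / 2" using y by (simp add: add_pos_nonneg)
  have "1 \<le> 1 + y\<^sup>2 / 2 + y ^ 3 / 2 + y ^ 4 / 2" using y by simp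
  also have "\<dots> = (1 - y + y\<^sup>2) * (1 + y + y\<^sup>2 / 2)"
    by (simp add: field_simps power2_eq_square power3_eq_cube power4_eq_xxxx)
  finally have *: "1 / (1 + y + y\<^sup>2 / 2) \<le> 1 - y + y\<^sup>2" using q by (simp add: divide_le_eq)
  have "exp x = 1 / exp y" by (simp add: y_def exp_minus divide_inverse)
  also have "\<dots> \<le> 1 / (1 + y + y\<^sup>2 / 2)"
    using exp_lower_Taylor_quadratic[OF y] q by (intro divide_left_mono) auto
  finally show ?thesis using * by (simp add: y_def)
qed

text \<open>Since \<open>exp x \<le> 1 + x + x\<^sup>2\<close> on \<open>[-1, 1]\<close>, a centred variable bounded by \<open>1 / l\<close> has moment generating
  function at most \<open>exp (l\<^sup>2 * v)\<close> at \<open>l\<close>. The parameter \<open>l\<close> stays free because it is chosen level by level.\<close>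

lemma (in prob_space) chernoff_bernstein:
  fixes F :: "'b \<Rightarrow> real"
  assumes ind: "indep_vars (\<lambda>_. N) X (UNIV :: nat set)"
    and F: "F \<in> borel_measurable N"
    and b: "\<And>i. AE \<omega> in M. \<bar>F (X i \<omega>)\<bar> \<le> b"
    and mean: "\<And>i. expectation (\<lambda>\<omega>. F (X i \<omega>)) = 0"
    and var: "\<And>i. expectation (\<lambda>\<omega>. (F (X i \<omega>))\<^sup>2) \<le> v"
    and l: "0 \<le> l" "l * b \<le> 1"
  shows "emeasure M {\<omega> \<in> space M. s \<le> (\<Sum>i<n. F (X i \<omega>))} \<le> ennreal (exp (- l * s + real n * l\<^sup>2 * v))"
proof -
  have rv: "X i \<in> M \<rightarrow>\<^sub>M N" for i using ind by (auto simp: indep_vars_def)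
  have FX[measurable]: "(\<lambda>\<omega>. F (X i \<omega>)) \<in> borel_measurable M" for i
    using measurable_compose[OF rv F] .
  have int: "integrable M (\<lambda>\<omega>. F (X i \<omega>))" for i
    using b[of i] by (intro integrable_const_bound[where B = b]) auto
  have int2: "integrable M (\<lambda>\<omega>. (F (X i \<omega>))\<^sup>2)" for i
  proof (rule integrable_const_bound[where B = "b\<^sup>2"])
    show "AE \<omega> in M. norm ((F (X i \<omega>))\<^sup>2) \<le> b\<^sup>2"
      using b[of i] by eventually_elim (simp add: abs_le_square_iff[symmetric])
  qed simp
  have mgf: "(\<integral>\<^sup>+\<omega>. ennreal (exp (l * F (X i \<omega>))) \<partial>M) \<le> ennreal (exp (l\<^sup>2 * v))" for i
  proof -
    have "(\<integral>\<^sup>+\<omega>. ennreal (exp (l * F (X i \<omega>))) \<partial>M) \<le> (\<integral>\<^sup>+\<omega>. ennreal (1 + l * F (X i \<omega>) + l\<^sup>2 * (F (X i \<omega>))\<^sup>2) \<partial>M)"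
    proof (rule nn_integral_mono_AE)
      show "AE \<omega> in M. ennreal (exp (l * F (X i \<omega>))) \<le> ennreal (1 + l * F (X i \<omega>) + l\<^sup>2 * (F (X i \<omega>))\<^sup>2)"
        using b[of i]
      proof eventually_elim
        case (elim \<omega>)
        have "\<bar>l * F (X i \<omega>)\<bar> \<le> l * b" using l elim by (simp add: abs_mult mult_left_mono)
        then have "\<bar>l * F (X i \<omega>)\<bar> \<le> 1" using l by simp
        from exp_le_quadratic[OF this] show ?case by (intro ennreal_leI) (simp add: power_mult_distrib)
      qed
    qed
    also have "\<dots> = ennreal (\<integral>\<omega>. 1 + l * F (X i \<omega>) + l\<^sup>2 * (F (X i \<omega>))\<^sup>2 \<partial>M)"
    proof (rule nn_integral_eq_integral)
      show "integrable M (\<lambda>\<omega>. 1 + l * F (X i \<omega>) + l\<^sup>2 * (F (X i \<omega>))\<^sup>2)" using int int2 by simp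
      have "0 \<le> 1 + x + x\<^sup>2" for x :: real
      proof -
        have "0 \<le> (x + 1 / 2)\<^sup>2" by simp
        then show ?thesis by (simp add: power2_eq_square algebra_simps)
      qed
      from this[of "l * F (X i _)"]
      show "AE \<omega> in M. 0 \<le> 1 + l * F (X i \<omega>) + l\<^sup>2 * (F (X i \<omega>))\<^sup>2"
        by (simp add: power_mult_distrib)
    qed
    also have "(\<integral>\<omega>. 1 + l * F (X i \<omega>) + l\<^sup>2 * (F (X i \<omega>))\<^sup>2 \<partial>M)
        = 1 + l\<^sup>2 * expectation (\<lambda>\<omega>. (F (X i \<omega>))\<^sup>2)"
      using int int2 mean by (simp add: prob_space)
    also have "\<dots> \<le> 1 + l\<^sup>2 * v" using var[of i] by (simp add: mult_left_mono)
    also have "\<dots> \<le> exp (l\<^sup>2 * v)" by (rule exp_ge_add_one_self)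
    finally show ?thesis by (simp add: ennreal_leI)
  qed
  have ind': "indep_vars (\<lambda>_. borel) (\<lambda>i \<omega>. ennreal (exp (l * F (X i \<omega>)))) {..<n}"
  proof -
    have "indep_vars (\<lambda>_. borel) (\<lambda>i. (\<lambda>x. ennreal (exp (l * F x))) \<circ> X i) UNIV"
      by (rule indep_vars_compose[OF ind]) (use F in measurable)
    then show ?thesis by (auto simp: o_def intro: indep_vars_subset)
  qed
  let ?S = "\<lambda>\<omega>. \<Sum>i<n. F (X i \<omega>)"
  have "emeasure M {\<omega> \<in> space M. s \<le> ?S \<omega>} \<le> emeasure M {\<omega> \<in> space M. 1 \<le> ennreal (exp (- l * s)) * ennreal (exp (l * ?S \<omega>))}"
  proof (intro emeasure_mono)
    show "{\<omega> \<in> space M. s \<le> ?S \<omega>} \<subseteq> {\<omega> \<in> space M. 1 \<le> ennreal (exp (- l * s)) * ennreal (exp (l * ?S \<omega>))}"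
    proof safe
      fix \<omega> assume "s \<le> ?S \<omega>"
      then have "l * s \<le> l * ?S \<omega>" using l by (intro mult_left_mono) auto
      then have "1 \<le> exp (- l * s) * exp (l * ?S \<omega>)" by (simp flip: exp_add)
      then show "1 \<le> ennreal (exp (- l * s)) * ennreal (exp (l * ?S \<omega>))" by (simp flip: ennreal_mult)
    qed
  qed measurable
  also have "\<dots> \<le> ennreal (exp (- l * s)) * (\<integral>\<^sup>+\<omega>. ennreal (exp (l * ?S \<omega>)) \<partial>M)"
  proof -
    have "(\<lambda>\<omega>. ennreal (exp (l * ?S \<omega>)) * indicator (space M) \<omega>) \<in> borel_measurable M" by measurable
    from nn_integral_Markov_inequality[OF this sets.top, of "ennreal (exp (- l * s))"]
    show ?thesis by (simp cong: nn_integral_cong)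
  qed
  also have "(\<integral>\<^sup>+\<omega>. ennreal (exp (l * ?S \<omega>)) \<partial>M) = (\<integral>\<^sup>+\<omega>. (\<Prod>i<n. ennreal (exp (l * F (X i \<omega>)))) \<partial>M)"
    by (simp add: sum_distrib_left exp_sum prod_ennreal)
  also have "\<dots> = (\<Prod>i<n. \<integral>\<^sup>+\<omega>. ennreal (exp (l * F (X i \<omega>))) \<partial>M)"
    by (rule indep_vars_nn_integral[OF _ ind']) auto
  also have "\<dots> \<le> (\<Prod>i<n. ennreal (exp (l\<^sup>2 * v)))" by (intro prod_mono_ennreal mgf)
  also have "\<dots> = ennreal (exp (real n * l\<^sup>2 * v))"
    by (simp add: ennreal_power exp_of_nat_mult mult.assoc)
  finally have "emeasure M {\<omega> \<in> space M. s \<le> ?S \<omega>}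
      \<le> ennreal (exp (- l * s)) * ennreal (exp (real n * l\<^sup>2 * v))"
    by (simp add: mult_left_mono)
  also have "\<dots> = ennreal (exp (- l * s + real n * l\<^sup>2 * v))"
    unfolding exp_add by (simp add: ennreal_mult)
  finally show ?thesis .
qed

section \<open>Samples of covariates and diagrams\<close>

text \<open>Measurability of integrals against a family of measures that need not be bounded: the diagram
  measures may have infinite mass on a null event.\<close>

lemma borel_measurable_nn_integral_kernel:
  assumes s: "\<And>x. x \<in> space M \<Longrightarrow> sets (\<kappa> x) = sets N"
    and m: "\<And>A. A \<in> sets N \<Longrightarrow> (\<lambda>x. emeasure (\<kappa> x) A) \<in> borel_measurable M"
    and f: "f \<in> borel_measurable N"
  shows "(\<lambda>x. \<integral>\<^sup>+y. f y \<partial>\<kappa> x) \<in> borel_measurable M"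
proof -
  have fm: "f \<in> borel_measurable (\<kappa> x)" if "f \<in> borel_measurable N" "x \<in> space M" for f x
    using that(1) measurable_cong_sets[OF s[OF that(2)] refl] by auto
  show ?thesis
    using f
  proof (induct rule: borel_measurable_induct)
    case (cong f g)
    have "(\<integral>\<^sup>+y. f y \<partial>\<kappa> x) = (\<integral>\<^sup>+y. g y \<partial>\<kappa> x)" if "x \<in> space M" for x
      using cong(3) sets_eq_imp_space_eq[OF s[OF that]] by (intro nn_integral_cong) simp
    then show ?case using cong(4) by (simp cong: measurable_cong)
  next
    case (set A)
    have "(\<integral>\<^sup>+y. indicator A y \<partial>\<kappa> x) = emeasure (\<kappa> x) A" if "x \<in> space M" for x
      using set s[OF that] by simp
    then show ?case using m[OF set] by (simp cong: measurable_cong)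
  next
    case (mult u c)
    have "(\<integral>\<^sup>+y. c * u y \<partial>\<kappa> x) = c * (\<integral>\<^sup>+y. u y \<partial>\<kappa> x)" if "x \<in> space M" for x
      by (intro nn_integral_cmult fm mult that)
    then show ?case using mult(4) by (simp cong: measurable_cong)
  next
    case (add u v)
    have "(\<integral>\<^sup>+y. v y + u y \<partial>\<kappa> x) = (\<integral>\<^sup>+y. v y \<partial>\<kappa> x) + (\<integral>\<^sup>+y. u y \<partial>\<kappa> x)" if "x \<in> space M" for x
      by (intro nn_integral_add fm add that)
    then show ?case using add(3,7) by (simp cong: measurable_cong)
  next
    case (seq U)
    have "(\<integral>\<^sup>+y. (SUP n. U n) y \<partial>\<kappa> x) = (SUP n. \<integral>\<^sup>+y. U n y \<partial>\<kappa> x)" if "x \<in> space M" for x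
      unfolding SUP_apply using seq(4) by (intro nn_integral_monotone_convergence_SUP fm seq that)
    then show ?case using seq(3) by (simp cong: measurable_cong)
  qed
qed

text \<open>The defining property of \<open>\<Lambda>\<close> concerns single sets; this extends it to integrals of functions.\<close>

lemma nn_integral_kernel_cong:
  assumes s: "\<And>x. x \<in> space M \<Longrightarrow> sets (\<kappa>1 x) = sets N" "\<And>x. x \<in> space M \<Longrightarrow> sets (\<kappa>2 x) = sets N"
    and m: "\<And>A. A \<in> sets N \<Longrightarrow> (\<lambda>x. emeasure (\<kappa>1 x) A) \<in> borel_measurable M"
      "\<And>A. A \<in> sets N \<Longrightarrow> (\<lambda>x. emeasure (\<kappa>2 x) A) \<in> borel_measurable M"
    and G[measurable]: "G \<in> borel_measurable M"
    and eq: "\<And>A. A \<in> sets N \<Longrightarrow>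
      (\<integral>\<^sup>+x. G x * emeasure (\<kappa>1 x) A \<partial>M) = (\<integral>\<^sup>+x. G x * emeasure (\<kappa>2 x) A \<partial>M)"
    and f: "f \<in> borel_measurable N"
  shows "(\<integral>\<^sup>+x. G x * (\<integral>\<^sup>+y. f y \<partial>\<kappa>1 x) \<partial>M) = (\<integral>\<^sup>+x. G x * (\<integral>\<^sup>+y. f y \<partial>\<kappa>2 x) \<partial>M)"
proof -
  have fm: "f \<in> borel_measurable (\<kappa>1 x)" "f \<in> borel_measurable (\<kappa>2 x)"
    if "f \<in> borel_measurable N" "x \<in> space M" for f x
    using that(1) measurable_cong_sets[OF s(1)[OF that(2)] refl] measurable_cong_sets[OF s(2)[OF that(2)] refl] by auto
  note km = borel_measurable_nn_integral_kernel[OF s(1) m(1)] borel_measurable_nn_integral_kernel[OF s(2) m(2)]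
  show ?thesis
    using f
  proof (induct rule: borel_measurable_induct)
    case (cong f g)
    have "(\<integral>\<^sup>+y. f y \<partial>\<kappa>1 x) = (\<integral>\<^sup>+y. g y \<partial>\<kappa>1 x)" "(\<integral>\<^sup>+y. f y \<partial>\<kappa>2 x) = (\<integral>\<^sup>+y. g y \<partial>\<kappa>2 x)"
      if "x \<in> space M" for x
      using cong(3) sets_eq_imp_space_eq[OF s(1)[OF that]] sets_eq_imp_space_eq[OF s(2)[OF that]]
      by (auto intro!: nn_integral_cong)
    then show ?case using cong(4) by (simp cong: nn_integral_cong)
  next
    case (set A)
    then show ?case using eq[OF set] s by (simp cong: nn_integral_cong)
  next
    case (mult u c)
    have "(\<integral>\<^sup>+x. G x * (\<integral>\<^sup>+y. c * u y \<partial>\<kappa> x) \<partial>M) = c * (\<integral>\<^sup>+x. G x * (\<integral>\<^sup>+y. u y \<partial>\<kappa> x) \<partial>M)"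
      if "\<kappa> = \<kappa>1 \<or> \<kappa> = \<kappa>2" for \<kappa>
    proof -
      have "(\<integral>\<^sup>+x. G x * (\<integral>\<^sup>+y. c * u y \<partial>\<kappa> x) \<partial>M) = (\<integral>\<^sup>+x. c * (G x * (\<integral>\<^sup>+y. u y \<partial>\<kappa> x)) \<partial>M)"
        using that by (intro nn_integral_cong) (auto simp: nn_integral_cmult[OF fm(1)[OF mult(2)]]
          nn_integral_cmult[OF fm(2)[OF mult(2)]] mult_ac)
      also have "\<dots> = c * (\<integral>\<^sup>+x. G x * (\<integral>\<^sup>+y. u y \<partial>\<kappa> x) \<partial>M)"
        using that km[OF _ _ mult(2)] by (intro nn_integral_cmult borel_measurable_times_ennreal G) auto
      finally show ?thesis .
    qed
    then show ?case using mult(4) by simp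
  next
    case (add u v)
    have "(\<integral>\<^sup>+x. G x * (\<integral>\<^sup>+y. v y + u y \<partial>\<kappa> x) \<partial>M) =
        (\<integral>\<^sup>+x. G x * (\<integral>\<^sup>+y. v y \<partial>\<kappa> x) \<partial>M) + (\<integral>\<^sup>+x. G x * (\<integral>\<^sup>+y. u y \<partial>\<kappa> x) \<partial>M)"
      if "\<kappa> = \<kappa>1 \<or> \<kappa> = \<kappa>2" for \<kappa>
    proof -
      have "(\<integral>\<^sup>+x. G x * (\<integral>\<^sup>+y. v y + u y \<partial>\<kappa> x) \<partial>M) =
          (\<integral>\<^sup>+x. G x * (\<integral>\<^sup>+y. v y \<partial>\<kappa> x) + G x * (\<integral>\<^sup>+y. u y \<partial>\<kappa> x) \<partial>M)"
        using that by (intro nn_integral_cong) (auto simp: nn_integral_add[OF fm(1)[OF add(4)] fm(1)[OF add(1)]]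
          nn_integral_add[OF fm(2)[OF add(4)] fm(2)[OF add(1)]] distrib_left)
      also have "\<dots> = (\<integral>\<^sup>+x. G x * (\<integral>\<^sup>+y. v y \<partial>\<kappa> x) \<partial>M) + (\<integral>\<^sup>+x. G x * (\<integral>\<^sup>+y. u y \<partial>\<kappa> x) \<partial>M)"
        using that km[OF _ _ add(4)] km[OF _ _ add(1)]
        by (intro nn_integral_add borel_measurable_times_ennreal G) auto
      finally show ?thesis .
    qed
    then show ?case using add(3,7) by simp
  next
    case (seq U)
    have "(\<integral>\<^sup>+x. G x * (\<integral>\<^sup>+y. (SUP n. U n) y \<partial>\<kappa> x) \<partial>M) = (SUP n. \<integral>\<^sup>+x. G x * (\<integral>\<^sup>+y. U n y \<partial>\<kappa> x) \<partial>M)"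
      if \<kappa>: "\<kappa> = \<kappa>1 \<or> \<kappa> = \<kappa>2" for \<kappa>
    proof -
      have inc: "incseq (\<lambda>n. \<integral>\<^sup>+y. U n y \<partial>\<kappa> x)" for x using seq(4) by (intro incseq_nn_integral)
      have "(\<integral>\<^sup>+x. G x * (\<integral>\<^sup>+y. (SUP n. U n) y \<partial>\<kappa> x) \<partial>M) = (\<integral>\<^sup>+x. (SUP n. G x * (\<integral>\<^sup>+y. U n y \<partial>\<kappa> x)) \<partial>M)"
      proof (intro nn_integral_cong)
        fix x assume x: "x \<in> space M"
        have "(\<integral>\<^sup>+y. (SUP n. U n) y \<partial>\<kappa> x) = (SUP n. \<integral>\<^sup>+y. U n y \<partial>\<kappa> x)"
          unfolding SUP_apply using \<kappa> fm[OF seq(1) x] by (intro nn_integral_monotone_convergence_SUP seq(4)) auto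
        then show "G x * (\<integral>\<^sup>+y. (SUP n. U n) y \<partial>\<kappa> x) = (SUP n. G x * (\<integral>\<^sup>+y. U n y \<partial>\<kappa> x))"
          by (simp add: SUP_mult_left_ennreal)
      qed
      also have "\<dots> = (SUP n. \<integral>\<^sup>+x. G x * (\<integral>\<^sup>+y. U n y \<partial>\<kappa> x) \<partial>M)"
      proof (rule nn_integral_monotone_convergence_SUP)
        show "incseq (\<lambda>n x. G x * (\<integral>\<^sup>+y. U n y \<partial>\<kappa> x))"
          using inc by (auto simp: incseq_def le_fun_def intro!: mult_left_mono)
        show "(\<lambda>x. G x * (\<integral>\<^sup>+y. U n y \<partial>\<kappa> x)) \<in> borel_measurable M" for n
          using \<kappa> km[OF _ _ seq(1)] by (intro borel_measurable_times_ennreal G) auto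
      qed
      finally show ?thesis .
    qed
    then show ?case using seq(3) by simp
  qed
qed

lemma sets_weighted_dgm [simp]: "sets (weighted_dgm L w D) = sets (borel_bar L)"
  by (simp add: weighted_dgm_def dgm_measure_def)

lemma emeasure_dgm_measurable:
  assumes A: "A \<in> sets (borel_bar L)"
  shows "(\<lambda>D. emeasure (dgm_measure L D) A) \<in> borel_measurable (diagram_space L)"
proof (rule measurableI)
  let ?G = "{{D \<in> diagrams L. emeasure (dgm_measure L D) A \<in> B} | A B. A \<in> sets (borel_bar L) \<and> B \<in> sets borel}"
  have G: "?G \<subseteq> Pow (diagrams L)" by blast
  fix B :: "ennreal set" assume B: "B \<in> sets borel"
  have "(\<lambda>D. emeasure (dgm_measure L D) A) -` B \<inter> space (diagram_space L)
      = {D \<in> diagrams L. emeasure (dgm_measure L D) A \<in> B}"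
    unfolding diagram_space_def by (auto simp: space_measure_of[OF G])
  also have "\<dots> \<in> sigma_sets (diagrams L) ?G" using A B by (intro sigma_sets.Basic) blast
  also have "\<dots> = sets (diagram_space L)" unfolding diagram_space_def by (rule sets_measure_of[OF G, symmetric])
  finally show "(\<lambda>D. emeasure (dgm_measure L D) A) -` B \<inter> space (diagram_space L) \<in> sets (diagram_space L)" .
qed simp

lemma emeasure_weighted_dgm_measurable:
  assumes A: "A \<in> sets (borel_bar L)" and w: "w \<in> borel_measurable (borel_bar L)"
  shows "(\<lambda>D. emeasure (weighted_dgm L w D) A) \<in> borel_measurable (diagram_space L)"
proof -
  have s: "sets (dgm_measure L D) = sets (borel_bar L)" for D by (simp add: dgm_measure_def)
  have m: "(\<lambda>x. ennreal (w x)) \<in> borel_measurable (borel_bar L)" using w by measurable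
  then have m': "(\<lambda>x. ennreal (w x)) \<in> borel_measurable (dgm_measure L D)" for D
    unfolding measurable_cong_sets[OF s refl] .
  have "emeasure (weighted_dgm L w D) A = (\<integral>\<^sup>+x. ennreal (w x) * indicator A x \<partial>dgm_measure L D)" for D
    unfolding weighted_dgm_def using A s by (intro emeasure_density m') simp
  moreover have "(\<lambda>D. \<integral>\<^sup>+x. ennreal (w x) * indicator A x \<partial>dgm_measure L D) \<in> borel_measurable (diagram_space L)"
    using m A by (intro borel_measurable_nn_integral_kernel[where N = "borel_bar L"] s emeasure_dgm_measurable) auto
  ultimately show ?thesis by simp
qed

text \<open>The standing assumptions on the sample. The law of the covariates enters only through integrals
  against their density, and \<open>M0 \<ge> 1\<close> is a normalisation of the mass bound.\<close>

locale diagram_sample = prob_space M for M :: "'w measure" +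
  fixes L :: real and w :: "real \<times> real \<Rightarrow> real" and S :: "'a::euclidean_space set"
    and Zs :: "nat \<Rightarrow> 'w \<Rightarrow> 'a" and Ds :: "nat \<Rightarrow> 'w \<Rightarrow> real \<times> real \<Rightarrow> nat"
    and \<Lambda> :: "'a \<Rightarrow> (real \<times> real) measure" and M0 :: real and p :: "'a \<Rightarrow> real" and cp Cp :: real
  assumes w: "w \<in> borel_measurable (borel_bar L)"
    and S: "S \<in> sets borel"
    and indep: "indep_vars (\<lambda>_. restrict_space borel S \<Otimes>\<^sub>M diagram_space L) (\<lambda>i \<omega>. (Zs i \<omega>, Ds i \<omega>)) UNIV"
    and cond: "\<And>i. cond_expected_measure M (restrict_space borel S) (borel_bar L) (Zs i)
                (\<lambda>\<omega>. weighted_dgm L w (Ds i \<omega>)) \<Lambda>"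
    and M0: "M0 \<ge> 1"
    and mass: "\<And>i. AE \<omega> in M. emeasure (weighted_dgm L w (Ds i \<omega>)) (Omega_bar L) \<le> ennreal M0"
    and dens: "\<And>i f. f \<in> borel_measurable borel \<Longrightarrow>
       (\<integral>\<^sup>+\<omega>. f (Zs i \<omega>) \<partial>M) = (\<integral>\<^sup>+z. ennreal (p z) * f z * indicator S z \<partial>lborel)"
    and p: "\<And>z. z \<in> S \<Longrightarrow> cp \<le> p z" "\<And>z. z \<in> S \<Longrightarrow> p z \<le> Cp" "cp > 0"
begin

lemma pair_measurable: "(\<lambda>\<omega>. (Zs i \<omega>, Ds i \<omega>)) \<in> M \<rightarrow>\<^sub>M restrict_space borel S \<Otimes>\<^sub>M diagram_space L"
  using indep by (auto simp: indep_vars_def)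

lemma Zs_measurable: "Zs i \<in> M \<rightarrow>\<^sub>M restrict_space borel S"
  using measurable_compose[OF pair_measurable measurable_fst] by simp

lemma Ds_measurable: "Ds i \<in> M \<rightarrow>\<^sub>M diagram_space L"
  using measurable_compose[OF pair_measurable measurable_snd] by simp

lemma Zs_in: "\<omega> \<in> space M \<Longrightarrow> Zs i \<omega> \<in> S"
  using measurable_space[OF Zs_measurable] by (simp add: space_restrict_space)

lemma Lambda_sets: "z \<in> S \<Longrightarrow> sets (\<Lambda> z) = sets (borel_bar L)"
  and Lambda_finite: "z \<in> S \<Longrightarrow> finite_measure (\<Lambda> z)"
  and Lambda_measurable: "A \<in> sets (borel_bar L) \<Longrightarrow> (\<lambda>z. emeasure (\<Lambda> z) A) \<in> borel_measurable (restrict_space borel S)"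
  using cond[of 0] by (auto simp: cond_expected_measure_def space_restrict_space)

abbreviation "\<mu> i \<omega> \<equiv> weighted_dgm L w (Ds i \<omega>)"

lemma subalg: "finite_measure_subalgebra M (vimage_algebra (space M) (Zs i) (restrict_space borel S))"
proof
  show "subalgebra M (vimage_algebra (space M) (Zs i) (restrict_space borel S))"
    unfolding subalgebra_def using measurable_sets[OF Zs_measurable] measurable_space[OF Zs_measurable]
    by (auto simp: sets_vimage_algebra2)
qed

lemma mu_measurable: "A \<in> sets (borel_bar L) \<Longrightarrow> (\<lambda>\<omega>. emeasure (\<mu> i \<omega>) A) \<in> borel_measurable M"
  using measurable_compose[OF Ds_measurable emeasure_weighted_dgm_measurable[OF _ w]] .

lemma Lambda_Zs_measurable: "A \<in> sets (borel_bar L) \<Longrightarrow> (\<lambda>\<omega>. emeasure (\<Lambda> (Zs i \<omega>)) A) \<in> borel_measurable M"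
  using measurable_compose[OF Zs_measurable Lambda_measurable] .

text \<open>The tower property for a function of the covariate times an integral against the random measure.\<close>

lemma nn_integral_cond:
  assumes g: "g \<in> borel_measurable (restrict_space borel S)" and f: "f \<in> borel_measurable (borel_bar L)"
  shows "(\<integral>\<^sup>+\<omega>. g (Zs i \<omega>) * (\<integral>\<^sup>+v. f v \<partial>\<Lambda> (Zs i \<omega>)) \<partial>M) = (\<integral>\<^sup>+\<omega>. g (Zs i \<omega>) * (\<integral>\<^sup>+v. f v \<partial>\<mu> i \<omega>) \<partial>M)"
proof (rule nn_integral_kernel_cong[where N = "borel_bar L"])
  let ?F = "vimage_algebra (space M) (Zs i) (restrict_space borel S)"
  interpret F: finite_measure_subalgebra M ?F by (rule subalg)
  show gm: "(\<lambda>\<omega>. g (Zs i \<omega>)) \<in> borel_measurable M" by (rule measurable_compose[OF Zs_measurable g])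
  fix A assume A: "A \<in> sets (borel_bar L)"
  show "(\<lambda>\<omega>. emeasure (\<Lambda> (Zs i \<omega>)) A) \<in> borel_measurable M" "(\<lambda>\<omega>. emeasure (\<mu> i \<omega>) A) \<in> borel_measurable M"
    using A by (rule Lambda_Zs_measurable, rule mu_measurable)
  have "Zs i \<in> ?F \<rightarrow>\<^sub>M restrict_space borel S"
    using measurable_space[OF Zs_measurable] by (intro measurable_vimage_algebra1) auto
  then have gF: "(\<lambda>\<omega>. g (Zs i \<omega>)) \<in> borel_measurable ?F" by (rule measurable_compose[OF _ g])
  have "AE \<omega> in M. emeasure (\<Lambda> (Zs i \<omega>)) A = nn_cond_exp M ?F (\<lambda>\<omega>. emeasure (\<mu> i \<omega>) A) \<omega>"
    using cond[of i] A by (auto simp: cond_expected_measure_def)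
  then have "(\<integral>\<^sup>+\<omega>. g (Zs i \<omega>) * emeasure (\<Lambda> (Zs i \<omega>)) A \<partial>M)
      = (\<integral>\<^sup>+\<omega>. g (Zs i \<omega>) * nn_cond_exp M ?F (\<lambda>\<omega>. emeasure (\<mu> i \<omega>) A) \<omega> \<partial>M)"
    by (intro nn_integral_cong_AE) auto
  also have "\<dots> = (\<integral>\<^sup>+\<omega>. g (Zs i \<omega>) * emeasure (\<mu> i \<omega>) A \<partial>M)"
    by (rule F.nn_cond_exp_intg[OF gF mu_measurable[OF A]])
  finally show "(\<integral>\<^sup>+\<omega>. g (Zs i \<omega>) * emeasure (\<Lambda> (Zs i \<omega>)) A \<partial>M) = (\<integral>\<^sup>+\<omega>. g (Zs i \<omega>) * emeasure (\<mu> i \<omega>) A \<partial>M)" .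
qed (use Lambda_sets Zs_in f in auto)

lemma mass_Lambda: "AE \<omega> in M. emeasure (\<Lambda> (Zs i \<omega>)) (Omega_bar L) \<le> ennreal M0"
proof -
  let ?F = "vimage_algebra (space M) (Zs i) (restrict_space borel S)"
  interpret F: finite_measure_subalgebra M ?F by (rule subalg)
  have "AE \<omega> in M. emeasure (\<Lambda> (Zs i \<omega>)) (Omega_bar L) = nn_cond_exp M ?F (\<lambda>\<omega>. emeasure (\<mu> i \<omega>) (Omega_bar L)) \<omega>"
    using cond[of i] by (auto simp: cond_expected_measure_def)
  moreover have "AE \<omega> in M. nn_cond_exp M ?F (\<lambda>\<omega>. emeasure (\<mu> i \<omega>) (Omega_bar L)) \<omega> \<le> nn_cond_exp M ?F (\<lambda>_. ennreal M0) \<omega>"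
    using mass by (intro F.nn_cond_exp_mono mu_measurable) auto
  moreover have "AE \<omega> in M. ennreal M0 = nn_cond_exp M ?F (\<lambda>_. ennreal M0) \<omega>"
    by (rule F.nn_cond_exp_F_meas) simp
  ultimately show ?thesis by eventually_elim simp
qed

end

section \<open>Centred scores and their deviations\<close>

context diagram_sample begin

text \<open>Real-valued integrals. For bounded test functions, an infinite integral with the default value zero occurs only
  on a null event, where the mass bound fails.\<close>

definition dgm_functional :: "(real \<times> real \<Rightarrow> ennreal) \<Rightarrow> (real \<times> real \<Rightarrow> nat) \<Rightarrow> real" where
  "dgm_functional f D = enn2real (\<integral>\<^sup>+v. f v \<partial>weighted_dgm L w D)"

definition mean_functional :: "(real \<times> real \<Rightarrow> ennreal) \<Rightarrow> 'a \<Rightarrow> real" where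
  "mean_functional f z = enn2real (\<integral>\<^sup>+v. f v \<partial>\<Lambda> z)"

text \<open>With signs \<open>\<epsilon>\<close> these are the linear functionals whose maximum is the sum of the absolute discrepancies over the
  cells of one level, which is what the multiscale bound needs.\<close>

definition score :: "'k set \<Rightarrow> ('k \<Rightarrow> real \<times> real \<Rightarrow> ennreal) \<Rightarrow> ('k \<Rightarrow> real) \<Rightarrow> 'a \<times> (real \<times> real \<Rightarrow> nat) \<Rightarrow> real" where
  "score I \<phi> \<epsilon> x = (\<Sum>k\<in>I. \<epsilon> k * (dgm_functional (\<phi> k) (snd x) - mean_functional (\<phi> k) (fst x)))"

lemma dgm_functional_measurable:
  assumes "f \<in> borel_measurable (borel_bar L)"
  shows "dgm_functional f \<in> borel_measurable (diagram_space L)"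
proof -
  have "(\<lambda>D. \<integral>\<^sup>+v. f v \<partial>weighted_dgm L w D) \<in> borel_measurable (diagram_space L)"
    by (rule borel_measurable_nn_integral_kernel[OF _ emeasure_weighted_dgm_measurable[OF _ w] assms]) auto
  then show ?thesis unfolding dgm_functional_def by measurable
qed

lemma mean_functional_measurable:
  assumes "f \<in> borel_measurable (borel_bar L)"
  shows "mean_functional f \<in> borel_measurable (restrict_space borel S)"
proof -
  have "(\<lambda>z. \<integral>\<^sup>+v. f v \<partial>\<Lambda> z) \<in> borel_measurable (restrict_space borel S)"
    by (rule borel_measurable_nn_integral_kernel[OF _ Lambda_measurable assms])
      (auto simp: space_restrict_space Lambda_sets)
  then show ?thesis unfolding mean_functional_def by measurable
qed

lemma score_measurable:
  assumes "\<And>k. k \<in> I \<Longrightarrow> \<phi> k \<in> borel_measurable (borel_bar L)"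
  shows "score I \<phi> \<epsilon> \<in> borel_measurable (restrict_space borel S \<Otimes>\<^sub>M diagram_space L)"
proof -
  have "(\<lambda>x. dgm_functional (\<phi> k) (snd x)) \<in> borel_measurable (restrict_space borel S \<Otimes>\<^sub>M diagram_space L)"
    "(\<lambda>x. mean_functional (\<phi> k) (fst x)) \<in> borel_measurable (restrict_space borel S \<Otimes>\<^sub>M diagram_space L)"
    if "k \<in> I" for k
    using measurable_compose[OF measurable_snd dgm_functional_measurable[OF assms[OF that]]]
      measurable_compose[OF measurable_fst mean_functional_measurable[OF assms[OF that]]] by auto
  then show ?thesis
    unfolding score_def[abs_def]
    by (intro borel_measurable_sum borel_measurable_times borel_measurable_diff borel_measurable_const) auto
qed

lemma sum_nn_integral_bound:
  assumes \<nu>: "sets \<nu> = sets (borel_bar L)" "emeasure \<nu> (Omega_bar L) \<le> ennreal M0"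
    and \<phi>: "\<And>k. k \<in> I \<Longrightarrow> \<phi> k \<in> borel_measurable (borel_bar L)"
      "\<And>v. v \<in> Omega_bar L \<Longrightarrow> (\<Sum>k\<in>I. \<phi> k v) \<le> ennreal R" and R: "0 \<le> R" and I: "finite I"
  shows "(\<Sum>k\<in>I. \<integral>\<^sup>+v. \<phi> k v \<partial>\<nu>) \<le> ennreal (R * M0)"
    and "(\<Sum>k\<in>I. enn2real (\<integral>\<^sup>+v. \<phi> k v \<partial>\<nu>)) \<le> R * M0"
    and "k \<in> I \<Longrightarrow> (\<integral>\<^sup>+v. \<phi> k v \<partial>\<nu>) = ennreal (enn2real (\<integral>\<^sup>+v. \<phi> k v \<partial>\<nu>))"
proof -
  have sp: "space \<nu> = Omega_bar L" using sets_eq_imp_space_eq[OF \<nu>(1)] by simp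
  have "(\<Sum>k\<in>I. \<integral>\<^sup>+v. \<phi> k v \<partial>\<nu>) = (\<integral>\<^sup>+v. (\<Sum>k\<in>I. \<phi> k v) \<partial>\<nu>)"
    using \<phi>(1) measurable_cong_sets[OF \<nu>(1) refl] by (intro nn_integral_sum[symmetric]) auto
  also have "\<dots> \<le> (\<integral>\<^sup>+v. ennreal R \<partial>\<nu>)" using \<phi>(2) sp by (intro nn_integral_mono) simp
  also have "\<dots> \<le> ennreal R * ennreal M0" using \<nu>(2) by (simp add: sp mult_left_mono)
  finally show 1: "(\<Sum>k\<in>I. \<integral>\<^sup>+v. \<phi> k v \<partial>\<nu>) \<le> ennreal (R * M0)"
    using R M0 by (simp add: ennreal_mult)
  have fin: "(\<integral>\<^sup>+v. \<phi> k v \<partial>\<nu>) < top" if "k \<in> I" for k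
  proof -
    have "(\<integral>\<^sup>+v. \<phi> k v \<partial>\<nu>) \<le> (\<Sum>k\<in>I. \<integral>\<^sup>+v. \<phi> k v \<partial>\<nu>)"
      using I that by (intro member_le_sum) auto
    with 1 show ?thesis by (meson ennreal_less_top le_less_trans order_trans)
  qed
  then show "k \<in> I \<Longrightarrow> (\<integral>\<^sup>+v. \<phi> k v \<partial>\<nu>) = ennreal (enn2real (\<integral>\<^sup>+v. \<phi> k v \<partial>\<nu>))" by simp
  have "(\<Sum>k\<in>I. enn2real (\<integral>\<^sup>+v. \<phi> k v \<partial>\<nu>)) = enn2real (\<Sum>k\<in>I. \<integral>\<^sup>+v. \<phi> k v \<partial>\<nu>)"
    using fin by (subst enn2real_sum) (auto simp: o_def)
  also have "\<dots> \<le> R * M0" using 1 R M0 by (intro enn2real_leI) auto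
  finally show "(\<Sum>k\<in>I. enn2real (\<integral>\<^sup>+v. \<phi> k v \<partial>\<nu>)) \<le> R * M0" .
qed

context
  fixes I :: "'k set" and \<phi> :: "'k \<Rightarrow> real \<times> real \<Rightarrow> ennreal" and R :: real
  assumes I: "finite I"
    and \<phi>: "\<And>k. k \<in> I \<Longrightarrow> \<phi> k \<in> borel_measurable (borel_bar L)"
      "\<And>v. v \<in> Omega_bar L \<Longrightarrow> (\<Sum>k\<in>I. \<phi> k v) \<le> ennreal R" and R: "1 \<le> R"
begin

text \<open>The test functions of one level sum to at most \<open>R\<close>, so the bound does not grow with the number of cells.\<close>

lemma score_bound:
  assumes \<epsilon>: "\<And>k. k \<in> I \<Longrightarrow> \<bar>\<epsilon> k\<bar> \<le> 1" and z: "z \<in> S"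
    and "emeasure (weighted_dgm L w D) (Omega_bar L) \<le> ennreal M0" "emeasure (\<Lambda> z) (Omega_bar L) \<le> ennreal M0"
  shows "\<bar>score I \<phi> \<epsilon> (z, D)\<bar> \<le> 2 * R * M0"
proof -
  have "\<bar>score I \<phi> \<epsilon> (z, D)\<bar> \<le> (\<Sum>k\<in>I. \<bar>\<epsilon> k * (dgm_functional (\<phi> k) D - mean_functional (\<phi> k) z)\<bar>)"
    unfolding score_def by (simp add: sum_abs)
  also have "\<dots> \<le> (\<Sum>k\<in>I. dgm_functional (\<phi> k) D + mean_functional (\<phi> k) z)"
  proof (intro sum_mono)
    fix k assume k: "k \<in> I"
    have nn: "0 \<le> dgm_functional (\<phi> k) D" "0 \<le> mean_functional (\<phi> k) z"
      by (auto simp: dgm_functional_def mean_functional_def)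
    have "\<bar>\<epsilon> k\<bar> * \<bar>dgm_functional (\<phi> k) D - mean_functional (\<phi> k) z\<bar>
        \<le> 1 * (dgm_functional (\<phi> k) D + mean_functional (\<phi> k) z)"
      using nn by (intro mult_mono \<epsilon> k) auto
    then show "\<bar>\<epsilon> k * (dgm_functional (\<phi> k) D - mean_functional (\<phi> k) z)\<bar>
      \<le> dgm_functional (\<phi> k) D + mean_functional (\<phi> k) z" by (simp add: abs_mult)
  qed
  also have "\<dots> \<le> R * M0 + R * M0"
    unfolding sum.distrib dgm_functional_def mean_functional_def using R
    by (intro add_mono sum_nn_integral_bound(2)[OF _ _ \<phi>] assms I Lambda_sets) auto
  finally show ?thesis by (simp add: mult_ac)
qed

lemma AE_score_bound:
  assumes \<epsilon>: "\<And>k. k \<in> I \<Longrightarrow> \<bar>\<epsilon> k\<bar> \<le> 1"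
  shows "AE \<omega> in M. \<bar>score I \<phi> \<epsilon> (Zs i \<omega>, Ds i \<omega>)\<bar> \<le> 2 * R * M0"
  using mass[of i] mass_Lambda[of i] AE_space
  by eventually_elim (rule score_bound[OF \<epsilon>], auto simp: Zs_in)

end

context
  fixes Kf :: "'a \<Rightarrow> real" and B h :: real and g :: 'a
  assumes Km: "Kf \<in> borel_measurable borel" and K: "\<And>x. 0 \<le> Kf x" "\<And>x. Kf x \<le> B"
      "\<And>x. Kf x \<noteq> 0 \<Longrightarrow> norm (x - g) \<le> h" and B: "0 < B" and h: "0 < h"
begin

lemma Kf_Zs_measurable: "(\<lambda>\<omega>. Kf (Zs i \<omega>)) \<in> borel_measurable M"
  using measurable_compose[OF Zs_measurable measurable_restrict_space1[OF Km]] .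

text \<open>Integrals over a kernel window have the order of its volume \<open>h ^ DIM('a)\<close>: this is the variance proxy that produces the
  effective sample size \<open>n * h ^ DIM('a)\<close>.\<close>

lemma expectation_Kf:
  "expectation (\<lambda>\<omega>. Kf (Zs i \<omega>)) \<le> Cp * B * unit_ball_vol DIM('a) * h ^ DIM('a)"
  "expectation (\<lambda>\<omega>. Kf (Zs i \<omega>)) = expectation (\<lambda>\<omega>. Kf (Zs j \<omega>))"
  "ennreal cp * (\<integral>\<^sup>+z. ennreal (Kf z) * indicator S z \<partial>lborel) \<le> ennreal (expectation (\<lambda>\<omega>. Kf (Zs i \<omega>)))"
proof -
  have Kf': "(\<lambda>z. ennreal (Kf z)) \<in> borel_measurable borel" using Km by measurable
  have int: "integrable M (\<lambda>\<omega>. Kf (Zs i \<omega>))" for i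
    using K(1,2) by (intro integrable_const_bound[where B = B] Kf_Zs_measurable) auto
  have e: "ennreal (expectation (\<lambda>\<omega>. Kf (Zs i \<omega>))) = (\<integral>\<^sup>+z. ennreal (p z) * ennreal (Kf z) * indicator S z \<partial>lborel)" for i
    using nn_integral_eq_integral[OF int] K(1) dens[OF Kf', of i] by simp
  have nn: "0 \<le> expectation (\<lambda>\<omega>. Kf (Zs i \<omega>))" for i using K(1) by (intro Bochner_Integration.integral_nonneg) auto
  show "expectation (\<lambda>\<omega>. Kf (Zs i \<omega>)) = expectation (\<lambda>\<omega>. Kf (Zs j \<omega>))"
    using e[of i] e[of j] nn[of i] nn[of j] by (metis ennreal_inj)
  note [measurable] = S Kf'
  have "ennreal cp * (\<integral>\<^sup>+z. ennreal (Kf z) * indicator S z \<partial>lborel)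
      = (\<integral>\<^sup>+z. ennreal cp * (ennreal (Kf z) * indicator S z) \<partial>lborel)"
    by (intro nn_integral_cmult[symmetric]) measurable
  also have "\<dots> \<le> (\<integral>\<^sup>+z. ennreal (p z) * ennreal (Kf z) * indicator S z \<partial>lborel)"
    using p(1) by (intro nn_integral_mono) (auto simp: indicator_def intro!: mult_right_mono ennreal_leI)
  finally show "ennreal cp * (\<integral>\<^sup>+z. ennreal (Kf z) * indicator S z \<partial>lborel) \<le> ennreal (expectation (\<lambda>\<omega>. Kf (Zs i \<omega>)))"
    by (simp add: e)
  have "S \<noteq> {}" using Zs_in not_empty by blast
  then have Cp: "0 < Cp" using p by (metis all_not_in_conv less_le_trans order_trans)
  have "ennreal (expectation (\<lambda>\<omega>. Kf (Zs i \<omega>))) \<le> (\<integral>\<^sup>+z. ennreal Cp * ennreal (Kf z) \<partial>lborel)"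
    unfolding e using p(2) by (intro nn_integral_mono) (auto simp: indicator_def intro!: mult_right_mono ennreal_leI)
  also have "\<dots> = ennreal Cp * (\<integral>\<^sup>+z. ennreal (Kf z) \<partial>lborel)" by (intro nn_integral_cmult) measurable
  also have "\<dots> \<le> ennreal Cp * ennreal (B * unit_ball_vol DIM('a) * h ^ DIM('a))"
    using K B h by (intro mult_left_mono nn_integral_cball_le[where z = g]) auto
  also have "\<dots> = ennreal (Cp * B * unit_ball_vol DIM('a) * h ^ DIM('a))"
    using Cp by (simp add: mult.assoc flip: ennreal_mult')
  finally show "expectation (\<lambda>\<omega>. Kf (Zs i \<omega>)) \<le> Cp * B * unit_ball_vol DIM('a) * h ^ DIM('a)"
    using Cp B h by (subst (asm) ennreal_le_iff) auto
qed

lemma expectation_Kf_sq: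
  "expectation (\<lambda>\<omega>. (Kf (Zs i \<omega>))\<^sup>2) \<le> Cp * B\<^sup>2 * unit_ball_vol DIM('a) * h ^ DIM('a)"
proof -
  have int: "integrable M (\<lambda>\<omega>. Kf (Zs i \<omega>))"
    using K(1,2) by (intro integrable_const_bound[where B = B] Kf_Zs_measurable) auto
  have le: "(Kf x)\<^sup>2 \<le> B * Kf x" for x using K by (simp add: power2_eq_square mult_right_mono)
  have "(Kf x)\<^sup>2 \<le> B\<^sup>2" for x using K by (intro power_mono) auto
  then have "integrable M (\<lambda>\<omega>. (Kf (Zs i \<omega>))\<^sup>2)"
    using Kf_Zs_measurable by (intro integrable_const_bound[where B = "B\<^sup>2"]) auto
  then have "expectation (\<lambda>\<omega>. (Kf (Zs i \<omega>))\<^sup>2) \<le> expectation (\<lambda>\<omega>. B * Kf (Zs i \<omega>))"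
    using int le by (intro integral_mono) auto
  also have "\<dots> = B * expectation (\<lambda>\<omega>. Kf (Zs i \<omega>))" by simp
  also have "\<dots> \<le> B * (Cp * B * unit_ball_vol DIM('a) * h ^ DIM('a))"
    using B expectation_Kf(1) by (intro mult_left_mono) auto
  finally show ?thesis by (simp add: power2_eq_square mult_ac)
qed

text \<open>The denominator of the estimator. Its bounds are weakened to those of \<open>score_deviation\<close> so that both
  families of events share one tail bound.\<close>

lemma kernel_sum_deviation:
  assumes R: "1 \<le> R" and l: "0 \<le> l" "l * (2 * R * M0 * B) \<le> 1"
  shows "emeasure M {\<omega> \<in> space M. s \<le> (\<Sum>i<n. expectation (\<lambda>\<omega>. Kf (Zs 0 \<omega>)) - Kf (Zs i \<omega>))}
    \<le> ennreal (exp (- l * s + real n * l\<^sup>2 * ((2 * R * M0)\<^sup>2 * (Cp * B\<^sup>2 * unit_ball_vol DIM('a) * h ^ DIM('a)))))"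
proof -
  let ?e = "expectation (\<lambda>\<omega>. Kf (Zs 0 \<omega>))"
  let ?F = "\<lambda>x :: 'a \<times> (real \<times> real \<Rightarrow> nat). ?e - Kf (fst x)"
  have int: "integrable M (\<lambda>\<omega>. Kf (Zs i \<omega>))" for i
    using K(1,2) by (intro integrable_const_bound[where B = B] Kf_Zs_measurable) auto
  have e: "0 \<le> ?e" "?e \<le> B"
  proof -
    show "0 \<le> ?e" using K(1) by (intro Bochner_Integration.integral_nonneg) auto
    have "?e \<le> expectation (\<lambda>_. B)" using K(2) int by (intro integral_mono) auto
    then show "?e \<le> B" by (simp add: prob_space)
  qed
  have RM: "1 \<le> R * M0" using mult_mono[of 1 R 1 M0] R M0 by simp
  have Fm: "?F \<in> borel_measurable (restrict_space borel S \<Otimes>\<^sub>M diagram_space L)"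
    by (intro borel_measurable_diff borel_measurable_const measurable_compose[OF measurable_fst]
      measurable_restrict_space1[OF Km])
  have b: "AE \<omega> in M. \<bar>?F (Zs i \<omega>, Ds i \<omega>)\<bar> \<le> 2 * R * M0 * B" for i
  proof (rule AE_I2)
    fix \<omega>
    have "\<bar>?e - Kf (Zs i \<omega>)\<bar> \<le> 1 * B" using e K[of "Zs i \<omega>"] by auto
    also have "\<dots> \<le> 2 * R * M0 * B" using RM B by (intro mult_right_mono) auto
    finally show "\<bar>?F (Zs i \<omega>, Ds i \<omega>)\<bar> \<le> 2 * R * M0 * B" by simp
  qed
  have eq: "expectation (\<lambda>\<omega>. Kf (Zs i \<omega>)) = ?e" for i by (rule expectation_Kf(2))
  have m: "expectation (\<lambda>\<omega>. ?F (Zs i \<omega>, Ds i \<omega>)) = 0" for i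
    using int[of i] eq[of i] by (simp add: prob_space)
  have v: "expectation (\<lambda>\<omega>. (?F (Zs i \<omega>, Ds i \<omega>))\<^sup>2)
      \<le> (2 * R * M0)\<^sup>2 * (Cp * B\<^sup>2 * unit_ball_vol DIM('a) * h ^ DIM('a))" for i
  proof -
    have "(Kf x)\<^sup>2 \<le> B\<^sup>2" for x using K by (intro power_mono) auto
    then have i2: "integrable M (\<lambda>\<omega>. (Kf (Zs i \<omega>))\<^sup>2)"
      using Kf_Zs_measurable by (intro integrable_const_bound[where B = "B\<^sup>2"]) auto
    have "expectation (\<lambda>\<omega>. (?F (Zs i \<omega>, Ds i \<omega>))\<^sup>2) =
       expectation (\<lambda>\<omega>. ?e\<^sup>2 - 2 * ?e * Kf (Zs i \<omega>) + (Kf (Zs i \<omega>))\<^sup>2)"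
      by (simp add: power2_diff algebra_simps)
    also have "\<dots> = ?e\<^sup>2 - 2 * ?e * ?e + expectation (\<lambda>\<omega>. (Kf (Zs i \<omega>))\<^sup>2)"
      using int i2 eq[of i] by (simp add: prob_space)
    also have "\<dots> \<le> 1 * expectation (\<lambda>\<omega>. (Kf (Zs i \<omega>))\<^sup>2)" by (simp add: power2_eq_square)
    also have "\<dots> \<le> (2 * R * M0)\<^sup>2 * (Cp * B\<^sup>2 * unit_ball_vol DIM('a) * h ^ DIM('a))"
    proof (intro mult_mono expectation_Kf_sq)
      show "1 \<le> (2 * R * M0)\<^sup>2" using RM by (intro one_le_power) simp
    qed auto
    finally show ?thesis .
  qed
  show ?thesis
    using chernoff_bernstein[OF indep Fm b m v l, of s n] by simp
qed

context
  fixes I :: "'k set" and \<phi> :: "'k \<Rightarrow> real \<times> real \<Rightarrow> ennreal" and R :: real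
  assumes I: "finite I"
    and \<phi>: "\<And>k. k \<in> I \<Longrightarrow> \<phi> k \<in> borel_measurable (borel_bar L)"
      "\<And>v. v \<in> Omega_bar L \<Longrightarrow> (\<Sum>k\<in>I. \<phi> k v) \<le> ennreal R" and R: "1 \<le> R"
begin

text \<open>Because \<open>\<Lambda> (Zs i)\<close> is the conditional mean of the measure of the \<open>i\<close>-th diagram, the weighted
  scores are centred without conditioning on the covariates.\<close>

lemma expectation_score:
  "expectation (\<lambda>\<omega>. Kf (Zs i \<omega>) * score I \<phi> \<epsilon> (Zs i \<omega>, Ds i \<omega>)) = 0"
proof -
  have R0: "0 \<le> R" using R by simp
  have RM: "0 \<le> R * M0" using R M0 by simp
  have a: "integrable M (\<lambda>\<omega>. Kf (Zs i \<omega>) * dgm_functional (\<phi> k) (Ds i \<omega>)) \<and>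
      integrable M (\<lambda>\<omega>. Kf (Zs i \<omega>) * mean_functional (\<phi> k) (Zs i \<omega>)) \<and>
      expectation (\<lambda>\<omega>. Kf (Zs i \<omega>) * dgm_functional (\<phi> k) (Ds i \<omega>)) =
      expectation (\<lambda>\<omega>. Kf (Zs i \<omega>) * mean_functional (\<phi> k) (Zs i \<omega>))" if k: "k \<in> I" for k
  proof -
    let ?f = "\<lambda>\<omega>. Kf (Zs i \<omega>) * dgm_functional (\<phi> k) (Ds i \<omega>)"
    let ?g = "\<lambda>\<omega>. Kf (Zs i \<omega>) * mean_functional (\<phi> k) (Zs i \<omega>)"
    have fm: "?f \<in> borel_measurable M" "?g \<in> borel_measurable M"
      using measurable_compose[OF Ds_measurable dgm_functional_measurable[OF \<phi>(1)[OF k]], of i]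
        measurable_compose[OF Zs_measurable mean_functional_measurable[OF \<phi>(1)[OF k]], of i] Kf_Zs_measurable[of i]
      by auto
    have nn: "0 \<le> dgm_functional f D" "0 \<le> mean_functional f z" for f D z
      by (auto simp: dgm_functional_def mean_functional_def)
    have f1: "AE \<omega> in M. ennreal (?f \<omega>) = ennreal (Kf (Zs i \<omega>)) * (\<integral>\<^sup>+v. \<phi> k v \<partial>\<mu> i \<omega>)"
      using mass[of i]
    proof eventually_elim
      case (elim \<omega>)
      show ?case using sum_nn_integral_bound(3)[OF sets_weighted_dgm elim \<phi> R0 I k] K(1) nn
        by (simp add: dgm_functional_def ennreal_mult)
    qed
    have g1: "AE \<omega> in M. ennreal (?g \<omega>) = ennreal (Kf (Zs i \<omega>)) * (\<integral>\<^sup>+v. \<phi> k v \<partial>\<Lambda> (Zs i \<omega>))"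
      using mass_Lambda[of i] AE_space
    proof eventually_elim
      case (elim \<omega>)
      show ?case using sum_nn_integral_bound(3)[OF Lambda_sets[OF Zs_in[OF elim(2)]] elim(1) \<phi> R0 I k] K(1) nn
        by (simp add: mean_functional_def ennreal_mult)
    qed
    have eq: "(\<integral>\<^sup>+\<omega>. ennreal (?f \<omega>) \<partial>M) = (\<integral>\<^sup>+\<omega>. ennreal (?g \<omega>) \<partial>M)"
      unfolding nn_integral_cong_AE[OF f1] nn_integral_cong_AE[OF g1]
      using Km by (intro nn_integral_cond[symmetric, of "\<lambda>z. ennreal (Kf z)"] \<phi>(1) k
         measurable_restrict_space1) measurable
    have bf: "AE \<omega> in M. ?f \<omega> \<le> B * (R * M0)"
      using mass[of i]
    proof eventually_elim
      case (elim \<omega>)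
      have "dgm_functional (\<phi> k) (Ds i \<omega>) \<le> (\<Sum>k\<in>I. dgm_functional (\<phi> k) (Ds i \<omega>))"
        using I k nn by (intro member_le_sum) auto
      also have "\<dots> \<le> R * M0"
        unfolding dgm_functional_def by (rule sum_nn_integral_bound(2)[OF sets_weighted_dgm elim \<phi> R0 I])
      finally show ?case using K nn B by (intro mult_mono) auto
    qed
    have bg: "AE \<omega> in M. ?g \<omega> \<le> B * (R * M0)"
      using mass_Lambda[of i] AE_space
    proof eventually_elim
      case (elim \<omega>)
      have "mean_functional (\<phi> k) (Zs i \<omega>) \<le> (\<Sum>k\<in>I. mean_functional (\<phi> k) (Zs i \<omega>))"
        using I k nn by (intro member_le_sum) auto
      also have "\<dots> \<le> R * M0"
        unfolding mean_functional_def
        by (rule sum_nn_integral_bound(2)[OF Lambda_sets[OF Zs_in[OF elim(2)]] elim(1) \<phi> R0 I])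
      finally show ?case using K nn B by (intro mult_mono) auto
    qed
    have pos: "0 \<le> ?f \<omega>" "0 \<le> ?g \<omega>" for \<omega> using K(1) nn by auto
    have int: "integrable M ?f" "integrable M ?g"
      using bf bg pos by (auto intro!: integrable_const_bound[where B = "B * (R * M0)"] fm)
    moreover have "expectation ?f = expectation ?g"
      using eq pos fm by (simp add: integral_eq_nn_integral)
    ultimately show ?thesis by simp
  qed
  have "expectation (\<lambda>\<omega>. Kf (Zs i \<omega>) * score I \<phi> \<epsilon> (Zs i \<omega>, Ds i \<omega>)) =
    expectation (\<lambda>\<omega>. \<Sum>k\<in>I. \<epsilon> k * (Kf (Zs i \<omega>) * dgm_functional (\<phi> k) (Ds i \<omega>)
       - Kf (Zs i \<omega>) * mean_functional (\<phi> k) (Zs i \<omega>)))"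
    by (simp add: score_def sum_distrib_left right_diff_distrib mult_ac)
  also have "\<dots> = (\<Sum>k\<in>I. expectation (\<lambda>\<omega>. \<epsilon> k * (Kf (Zs i \<omega>) * dgm_functional (\<phi> k) (Ds i \<omega>)
       - Kf (Zs i \<omega>) * mean_functional (\<phi> k) (Zs i \<omega>))))"
    using a by (intro Bochner_Integration.integral_sum) auto
  also have "\<dots> = 0" using a by (intro sum.neutral) simp
  finally show ?thesis .
qed

lemma score_deviation:
  assumes \<epsilon>: "\<And>k. k \<in> I \<Longrightarrow> \<bar>\<epsilon> k\<bar> \<le> 1" and l: "0 \<le> l" "l * (2 * R * M0 * B) \<le> 1"
  shows "emeasure M {\<omega> \<in> space M. s \<le> (\<Sum>i<n. Kf (Zs i \<omega>) * score I \<phi> \<epsilon> (Zs i \<omega>, Ds i \<omega>))}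
    \<le> ennreal (exp (- l * s + real n * l\<^sup>2 * ((2 * R * M0)\<^sup>2 * (Cp * B\<^sup>2 * unit_ball_vol DIM('a) * h ^ DIM('a)))))"
proof -
  let ?F = "\<lambda>x. Kf (fst x) * score I \<phi> \<epsilon> x"
  have RM: "0 \<le> 2 * R * M0" using R M0 by simp
  have sb: "AE \<omega> in M. \<bar>score I \<phi> \<epsilon> (Zs i \<omega>, Ds i \<omega>)\<bar> \<le> 2 * R * M0" for i
    by (rule AE_score_bound) (use I \<phi> R \<epsilon> in auto)
  have Fm: "?F \<in> borel_measurable (restrict_space borel S \<Otimes>\<^sub>M diagram_space L)"
    by (intro borel_measurable_times score_measurable \<phi> measurable_compose[OF measurable_fst]
      measurable_restrict_space1[OF Km])
  have b: "AE \<omega> in M. \<bar>?F (Zs i \<omega>, Ds i \<omega>)\<bar> \<le> 2 * R * M0 * B" for i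
    using sb[of i]
  proof eventually_elim
    case (elim \<omega>)
    have "\<bar>Kf (Zs i \<omega>)\<bar> * \<bar>score I \<phi> \<epsilon> (Zs i \<omega>, Ds i \<omega>)\<bar> \<le> B * (2 * R * M0)"
      using K elim B by (intro mult_mono) auto
    then show ?case by (simp add: abs_mult mult_ac)
  qed
  have v: "expectation (\<lambda>\<omega>. (?F (Zs i \<omega>, Ds i \<omega>))\<^sup>2)
      \<le> (2 * R * M0)\<^sup>2 * (Cp * B\<^sup>2 * unit_ball_vol DIM('a) * h ^ DIM('a))" for i
  proof -
    have "(Kf x)\<^sup>2 \<le> B\<^sup>2" for x using K by (intro power_mono) auto
    then have i2: "integrable M (\<lambda>\<omega>. (2 * R * M0)\<^sup>2 * (Kf (Zs i \<omega>))\<^sup>2)"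
      using Kf_Zs_measurable by (intro integrable_mult_right integrable_const_bound[where B = "B\<^sup>2"]) auto
    have "expectation (\<lambda>\<omega>. (?F (Zs i \<omega>, Ds i \<omega>))\<^sup>2) \<le> expectation (\<lambda>\<omega>. (2 * R * M0)\<^sup>2 * (Kf (Zs i \<omega>))\<^sup>2)"
    proof (rule integral_mono_AE')
      show "AE \<omega> in M. (?F (Zs i \<omega>, Ds i \<omega>))\<^sup>2 \<le> (2 * R * M0)\<^sup>2 * (Kf (Zs i \<omega>))\<^sup>2"
        using sb[of i]
      proof eventually_elim
        case (elim \<omega>)
        then have "(score I \<phi> \<epsilon> (Zs i \<omega>, Ds i \<omega>))\<^sup>2 \<le> (2 * R * M0)\<^sup>2"
          using RM by (simp add: abs_le_square_iff[symmetric])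
        then show ?case by (simp add: power_mult_distrib mult.commute mult_left_mono)
      qed
    qed (use i2 in auto)
    also have "\<dots> = (2 * R * M0)\<^sup>2 * expectation (\<lambda>\<omega>. (Kf (Zs i \<omega>))\<^sup>2)" by simp
    also have "\<dots> \<le> (2 * R * M0)\<^sup>2 * (Cp * B\<^sup>2 * unit_ball_vol DIM('a) * h ^ DIM('a))"
      by (intro mult_left_mono expectation_Kf_sq) auto
    finally show ?thesis .
  qed
  show ?thesis
    using chernoff_bernstein[OF indep Fm b _ v l, of s n] expectation_score by simp
qed

end
end
end

section \<open>The estimator as a mixture of smoothed diagrams\<close>

definition mixture :: "real \<Rightarrow> nat \<Rightarrow> (nat \<Rightarrow> real) \<Rightarrow> (nat \<Rightarrow> (real \<times> real) measure) \<Rightarrow> (real \<times> real) measure" where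
  "mixture L n a \<mu> = sum_measure (borel_bar L) {..<n} (\<lambda>i. scale_measure (ennreal (a i)) (\<mu> i))"

lemma sets_mixture [simp]: "sets (mixture L n a \<mu>) = sets (borel_bar L)"
  by (simp add: mixture_def)

lemma emeasure_mixture:
  assumes "\<And>i. i < n \<Longrightarrow> sets (\<mu> i) = sets (borel_bar L)" "A \<in> sets (borel_bar L)"
  shows "emeasure (mixture L n a \<mu>) A = (\<Sum>i<n. ennreal (a i) * emeasure (\<mu> i) A)"
  unfolding mixture_def using assms by (subst emeasure_sum_measure) auto

lemma mixture_finite:
  assumes "\<And>i. i < n \<Longrightarrow> sets (\<mu> i) = sets (borel_bar L)" "\<And>i. i < n \<Longrightarrow> finite_measure (\<mu> i)"
  shows "finite_measure (mixture L n a \<mu>)"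
proof (rule finite_measureI)
  have "space (mixture L n a \<mu>) = Omega_bar L" by (simp add: mixture_def)
  moreover have "emeasure (\<mu> i) (Omega_bar L) < top" if "i < n" for i
    using finite_measure.emeasure_finite[OF assms(2)[OF that]] by (simp add: less_top)
  ultimately show "emeasure (mixture L n a \<mu>) (space (mixture L n a \<mu>)) \<noteq> \<infinity>"
    using assms(1) by (simp add: emeasure_mixture ennreal_mult_less_top less_top)
qed

lemma measure_mixture:
  assumes "\<And>i. i < n \<Longrightarrow> sets (\<mu> i) = sets (borel_bar L)" "\<And>i. i < n \<Longrightarrow> finite_measure (\<mu> i)"
    "\<And>i. i < n \<Longrightarrow> 0 \<le> a i" "A \<in> sets (borel_bar L)"
  shows "measure (mixture L n a \<mu>) A = (\<Sum>i<n. a i * measure (\<mu> i) A)"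
proof -
  have "emeasure (mixture L n a \<mu>) A = (\<Sum>i<n. ennreal (a i * measure (\<mu> i) A))"
    using assms by (subst emeasure_mixture)
      (auto intro!: sum.cong simp: finite_measure.emeasure_eq_measure ennreal_mult)
  also have "\<dots> = ennreal (\<Sum>i<n. a i * measure (\<mu> i) A)" using assms(3) by (intro sum_ennreal) auto
  finally have "emeasure (mixture L n a \<mu>) A = ennreal (\<Sum>i<n. a i * measure (\<mu> i) A)" .
  moreover have "0 \<le> (\<Sum>i<n. a i * measure (\<mu> i) A)" using assms(3) by (intro sum_nonneg mult_nonneg_nonneg) auto
  ultimately show ?thesis by (subst measure_def) simp
qed

text \<open>Convexity in the first argument. Only finitely many measures are mixed, so nearly optimal
  couplings can be chosen one by one.\<close>

lemma partial_ot_mixture_le: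
  assumes s: "\<And>i. i < n \<Longrightarrow> sets (\<mu> i) = sets (borel_bar L)" and f: "\<And>i. i < n \<Longrightarrow> finite_measure (\<mu> i)"
    and \<xi>: "finite_measure \<xi>"
    and a: "\<And>i. i < n \<Longrightarrow> 0 \<le> a i" "(\<Sum>i<n. a i) = 1"
    and le: "\<And>i. i < n \<Longrightarrow> 0 < a i \<Longrightarrow> partial_ot L q (\<mu> i) \<xi> \<le> ennreal t" and t: "0 \<le> t"
  shows "partial_ot L q (mixture L n a \<mu>) \<xi> \<le> ennreal t"
proof (rule ennreal_le_epsilon)
  fix e :: real assume e: "0 < e"
  let ?I = "{i. i < n \<and> 0 < a i}"
  have "\<exists>\<pi>. \<pi> \<in> adm L (\<mu> i) \<xi> \<and> transport_cost q \<pi> \<le> ennreal (t + e)" if "i \<in> ?I" for i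
    using partial_ot_less_coupling[OF le t e] that by blast
  then obtain \<pi> where \<pi>: "\<And>i. i \<in> ?I \<Longrightarrow> \<pi> i \<in> adm L (\<mu> i) \<xi>"
    and c: "\<And>i. i \<in> ?I \<Longrightarrow> transport_cost q (\<pi> i) \<le> ennreal (t + e)" by metis
  have sum_I: "(\<Sum>i\<in>?I. a i * g i) = (\<Sum>i<n. a i * g i)" for g :: "nat \<Rightarrow> real"
    using a(1) by (intro sum.mono_neutral_left) (auto simp: less_le)
  show "partial_ot L q (mixture L n a \<mu>) \<xi> \<le> ennreal t + ennreal e"
  proof (rule partial_ot_le_sum[where I = ?I and c = a and \<pi> = \<pi>])
    show "finite_measure (\<pi> i)" "sets (\<pi> i) = sets (borel_bar L \<Otimes>\<^sub>M borel_bar L)" if "i \<in> ?I" for i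
      using \<pi>[OF that] by (auto simp: adm_def)
    show "finite_measure (mixture L n a \<mu>)" by (rule mixture_finite[OF s f])
  next
    fix A assume A: "A \<in> sets borel" "A \<subseteq> Omega L"
    then have Ab: "A \<in> sets (borel_bar L)" using Omega_subset by (auto simp: sets_borel_bar)
    show "measure (mixture L n a \<mu>) A = (\<Sum>i\<in>?I. a i * measure (\<pi> i) (A \<times> Omega_bar L))"
      using adm_measure(1)[OF \<pi> A] sum_I[of "\<lambda>i. measure (\<mu> i) A"] measure_mixture[OF s f a(1) Ab] by simp
    show "measure \<xi> A = (\<Sum>i\<in>?I. a i * measure (\<pi> i) (Omega_bar L \<times> A))"
      using adm_measure(2)[OF \<pi> A] sum_I[of "\<lambda>i. measure \<xi> A"] a(2) by (simp flip: sum_distrib_right)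
  next
    have "(\<Sum>i\<in>?I. ennreal (a i) * transport_cost q (\<pi> i)) \<le> (\<Sum>i\<in>?I. ennreal (a i) * ennreal (t + e))"
      using c by (intro sum_mono mult_left_mono) auto
    also have "\<dots> = (\<Sum>i\<in>?I. ennreal (a i * (t + e)))"
      using t e by (intro sum.cong refl ennreal_mult[symmetric]) auto
    also have "\<dots> = ennreal (\<Sum>i\<in>?I. a i * (t + e))" using t e by (intro sum_ennreal) auto
    also have "(\<Sum>i\<in>?I. a i * (t + e)) = t + e" using sum_I[of "\<lambda>_. t + e"] a(2) by (simp flip: sum_distrib_right)
    finally show "(\<Sum>i\<in>?I. ennreal (a i) * transport_cost q (\<pi> i)) \<le> ennreal t + ennreal e"
      using t e by (simp add: ennreal_plus)
  qed (use \<xi> in auto)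
qed

text \<open>The cells of one level are disjoint.\<close>

lemma sum_kernel_mass_cells_le:
  assumes L: "L > 0" and v: "v \<in> Omega_bar L"
    and \<kappa>m: "(\<lambda>x. \<kappa> (fst x) (snd x)) \<in> borel_measurable (borel_bar L \<Otimes>\<^sub>M borel_bar L)"
    and R: "kernel_mass L \<kappa> (Omega_bar L) v \<le> ennreal R"
  shows "(\<Sum>k\<in>cell_indices j. kernel_mass L \<kappa> (cell L j k) v) \<le> ennreal R"
proof -
  have m: "(\<lambda>u. ennreal (\<kappa> u v)) \<in> borel_measurable (lborel_bar L)"
    using measurable_Pair1[OF \<kappa>m, of v] v measurable_cong_sets[OF sets_lborel_bar refl] by auto
  have "(\<Sum>k\<in>cell_indices j. kernel_mass L \<kappa> (cell L j k) v)
      = (\<Sum>k\<in>cell_indices j. \<integral>\<^sup>+u. indicator (cell L j k) u * ennreal (\<kappa> u v) \<partial>lborel_bar L)"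
    by (simp add: kernel_mass_def mult.commute)
  also have "\<dots> \<le> (\<integral>\<^sup>+u. ennreal (\<kappa> u v) \<partial>lborel_bar L)"
    by (intro sum_set_nn_integral_le disjoint_cells m) (auto simp: sets_lborel_bar)
  also have "\<dots> = kernel_mass L \<kappa> (Omega_bar L) v"
    unfolding kernel_mass_def by (intro nn_integral_cong) (auto simp: space_restrict_space)
  finally show ?thesis using R by (rule order_trans)
qed

text \<open>The normalisation of the covariate kernel cancels, and the estimator is the mixture of the
  smoothed diagram measures with the Nadaraya-Watson weights.\<close>

lemma Lambda_hat_eq_mixture:
  fixes S :: "'a::euclidean_space set"
  assumes \<kappa>: "\<kappa> = kernel_corr KU (Omega_bar L) hU"
    and L: "L > 0" and hU: "hU > 0" and hZ: "hZ > 0" and R: "R \<ge> 0"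
    and \<kappa>m: "(\<lambda>x. \<kappa> (fst x) (snd x)) \<in> borel_measurable (borel_bar L \<Otimes>\<^sub>M borel_bar L)"
    and \<kappa>0: "\<And>u v. 0 \<le> \<kappa> u v"
    and supp: "\<And>u v. \<kappa> u v \<noteq> 0 \<Longrightarrow> norm (u - v) \<le> hU"
    and \<kappa>R: "\<And>v. kernel_mass L \<kappa> (Omega_bar L) v \<le> ennreal R"
    and \<kappa>B: "\<And>u v. u \<in> Omega_bar L \<Longrightarrow> \<kappa> u v \<le> R / hU\<^sup>2"
    and kc: "kernel_const KZ S hZ z > 0"
    and K0: "\<And>x. 0 \<le> KZ x" and T: "(\<Sum>i<n. KZ ((zs i - z) /\<^sub>R hZ)) > 0"
    and fin: "\<And>i. i < n \<Longrightarrow> finite_measure (weighted_dgm L w (D i))"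
  shows "Lambda_hat L w S KZ KU hZ hU n zs D z = mixture L n
    (\<lambda>i. KZ ((zs i - z) /\<^sub>R hZ) / (\<Sum>i<n. KZ ((zs i - z) /\<^sub>R hZ)))
    (\<lambda>i. smoothing L \<kappa> (weighted_dgm L w (D i)))"
proof (rule measure_eqI)
  define c where "c = 1 / (hZ ^ DIM('a) * kernel_const KZ S hZ z)"
  have c: "c > 0" using hZ kc by (simp add: c_def)
  define k where "k i = KZ ((zs i - z) /\<^sub>R hZ)" for i
  define T where "T = (\<Sum>i<n. k i)"
  have k: "0 \<le> k i" for i using K0 by (simp add: k_def)
  have T': "0 < T" using T by (simp add: T_def k_def)
  let ?\<mu> = "\<lambda>i. weighted_dgm L w (D i)"
  have cor: "kernel_corr KZ S hZ z (zs i) = c * k i" for i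
    by (simp add: kernel_corr_def c_def k_def)
  have Y: "ennreal (smoothed_dgm L w KU hU (D i) u) = (\<integral>\<^sup>+v. ennreal (\<kappa> u v) \<partial>?\<mu> i)"
    "0 \<le> smoothed_dgm L w KU hU (D i) u"
    if i: "i < n" and u: "u \<in> Omega_bar L" for i u
  proof -
    interpret finite_measure "?\<mu> i" by (rule fin[OF i])
    have "(\<lambda>v. \<kappa> u v) \<in> borel_measurable (borel_bar L)" using measurable_Pair2[OF \<kappa>m, of u] u by simp
    then have m: "(\<lambda>v. \<kappa> u v) \<in> borel_measurable (?\<mu> i)"
      using measurable_cong_sets[OF sets_weighted_dgm refl] by blast
    have "integrable (?\<mu> i) (\<lambda>v. \<kappa> u v)"
      using \<kappa>0 \<kappa>B[OF u] m by (intro integrable_const_bound[where B = "R / hU\<^sup>2"]) auto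
    then show "ennreal (smoothed_dgm L w KU hU (D i) u) = (\<integral>\<^sup>+v. ennreal (\<kappa> u v) \<partial>?\<mu> i)"
      unfolding smoothed_dgm_def \<kappa>[symmetric] using \<kappa>0 by (subst nn_integral_eq_integral) auto
    show "0 \<le> smoothed_dgm L w KU hU (D i) u"
      unfolding smoothed_dgm_def \<kappa>[symmetric] using \<kappa>0 by (intro Bochner_Integration.integral_nonneg) auto
  qed
  have lam: "ennreal (lambda_hat L w S KZ KU hZ hU n zs D z u)
      = (\<Sum>i<n. ennreal (k i / T) * (\<integral>\<^sup>+v. ennreal (\<kappa> u v) \<partial>?\<mu> i))" if u: "u \<in> Omega_bar L" for u
  proof -
    have "lambda_hat L w S KZ KU hZ hU n zs D z u
        = (c * (\<Sum>i<n. k i * smoothed_dgm L w KU hU (D i) u)) / (c * T)"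
      unfolding lambda_hat_def cor T_def by (simp add: sum_distrib_left mult.assoc)
    also have "\<dots> = (\<Sum>i<n. k i / T * smoothed_dgm L w KU hU (D i) u)"
      using c by (simp add: sum_divide_distrib)
    finally have "ennreal (lambda_hat L w S KZ KU hZ hU n zs D z u)
        = (\<Sum>i<n. ennreal (k i / T * smoothed_dgm L w KU hU (D i) u))"
      using k T' Y(2)[OF _ u] by (subst sum_ennreal) auto
    also have "\<dots> = (\<Sum>i<n. ennreal (k i / T) * (\<integral>\<^sup>+v. ennreal (\<kappa> u v) \<partial>?\<mu> i))"
    proof (intro sum.cong refl)
      fix i assume "i \<in> {..<n}"
      then show "ennreal (k i / T * smoothed_dgm L w KU hU (D i) u) = ennreal (k i / T) * (\<integral>\<^sup>+v. ennreal (\<kappa> u v) \<partial>?\<mu> i)"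
        using k T' Y(2)[OF _ u, of i]
        by (subst Y(1)[OF _ u, symmetric], simp, intro ennreal_mult) auto
    qed
    finally show ?thesis .
  qed
  show "sets (Lambda_hat L w S KZ KU hZ hU n zs D z) = sets (mixture L n
    (\<lambda>i. KZ ((zs i - z) /\<^sub>R hZ) / (\<Sum>i<n. KZ ((zs i - z) /\<^sub>R hZ))) (\<lambda>i. smoothing L \<kappa> (?\<mu> i)))"
    by (simp add: Lambda_hat_def sets_lborel_bar)
  fix A assume "A \<in> sets (Lambda_hat L w S KZ KU hZ hU n zs D z)"
  then have Ab: "A \<in> sets (borel_bar L)" by (simp add: Lambda_hat_def sets_lborel_bar)
  then have Al: "A \<in> sets (lborel_bar L)" by (simp add: sets_lborel_bar)
  have m: "(\<lambda>u. \<integral>\<^sup>+v. ennreal (\<kappa> u v) \<partial>?\<mu> i) \<in> borel_measurable (lborel_bar L)" if "i < n" for i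
  proof -
    interpret finite_measure "?\<mu> i" by (rule fin[OF that])
    have "sets (lborel_bar L \<Otimes>\<^sub>M ?\<mu> i) = sets (borel_bar L \<Otimes>\<^sub>M borel_bar L)"
      by (intro sets_pair_measure_cong sets_lborel_bar) simp
    then have "(\<lambda>x. ennreal (\<kappa> (fst x) (snd x))) \<in> borel_measurable (lborel_bar L \<Otimes>\<^sub>M ?\<mu> i)"
      using \<kappa>m measurable_cong_sets[OF _ refl] by (metis measurable_compose measurable_ennreal)
    from borel_measurable_nn_integral_fst[OF this] show ?thesis by simp
  qed
  have ms: "(\<lambda>u. \<Sum>i<n. ennreal (k i / T) * (\<integral>\<^sup>+v. ennreal (\<kappa> u v) \<partial>?\<mu> i)) \<in> borel_measurable (lborel_bar L)"
    using m by (intro borel_measurable_sum borel_measurable_times_ennreal borel_measurable_const) auto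
  have sp: "space (lborel_bar L) = Omega_bar L" by (simp add: space_restrict_space)
  have "Lambda_hat L w S KZ KU hZ hU n zs D z
      = density (lborel_bar L) (\<lambda>u. \<Sum>i<n. ennreal (k i / T) * (\<integral>\<^sup>+v. ennreal (\<kappa> u v) \<partial>?\<mu> i))"
    unfolding Lambda_hat_def using lam sp
    by (intro density_cong AE_I2 ms, subst measurable_cong[OF lam]) (auto intro: ms)
  then have "emeasure (Lambda_hat L w S KZ KU hZ hU n zs D z) A
     = (\<integral>\<^sup>+u. (\<Sum>i<n. ennreal (k i / T) * (\<integral>\<^sup>+v. ennreal (\<kappa> u v) \<partial>?\<mu> i)) * indicator A u \<partial>lborel_bar L)"
    using emeasure_density[OF ms Al] by simp
  also have "\<dots> = (\<integral>\<^sup>+u. (\<Sum>i<n. ennreal (k i / T) * ((\<integral>\<^sup>+v. ennreal (\<kappa> u v) \<partial>?\<mu> i) * indicator A u)) \<partial>lborel_bar L)"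
    by (simp add: sum_distrib_right mult.assoc)
  also have "\<dots> = (\<Sum>i<n. \<integral>\<^sup>+u. ennreal (k i / T) * ((\<integral>\<^sup>+v. ennreal (\<kappa> u v) \<partial>?\<mu> i) * indicator A u) \<partial>lborel_bar L)"
    using m Al by (intro nn_integral_sum borel_measurable_times_ennreal borel_measurable_const borel_measurable_indicator) auto
  also have "\<dots> = (\<Sum>i<n. ennreal (k i / T) * (\<integral>\<^sup>+u. (\<integral>\<^sup>+v. ennreal (\<kappa> u v) \<partial>?\<mu> i) * indicator A u \<partial>lborel_bar L))"
    using m Al by (intro sum.cong refl nn_integral_cmult borel_measurable_times_ennreal borel_measurable_indicator) auto
  also have "\<dots> = (\<Sum>i<n. ennreal (k i / T) * emeasure (smoothing L \<kappa> (?\<mu> i)) A)"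
    unfolding smoothing_def using m Al by (intro sum.cong refl, subst emeasure_density) auto
  also have "\<dots> = emeasure (mixture L n (\<lambda>i. k i / T) (\<lambda>i. smoothing L \<kappa> (?\<mu> i))) A"
    using Ab by (simp add: emeasure_mixture)
  finally show "emeasure (Lambda_hat L w S KZ KU hZ hU n zs D z) A = emeasure (mixture L n
    (\<lambda>i. KZ ((zs i - z) /\<^sub>R hZ) / (\<Sum>i<n. KZ ((zs i - z) /\<^sub>R hZ))) (\<lambda>i. smoothing L \<kappa> (?\<mu> i))) A"
    by (simp add: k_def T_def)
qed

context diagram_sample begin

text \<open>Three comparisons are chained: the estimator with the same mixture of smoothed conditional means (by
  the multiscale bound and the hypothesis on the scores), each smoothed conditional mean with the
  conditional mean itself, and that one with the conditional mean at \<open>z\<close>. Both the second and the third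
  pass through finite mixtures, so no measurable selection of couplings is needed.\<close>

lemma estimator_bound:
  assumes \<kappa>_eq: "\<kappa> = kernel_corr KU (Omega_bar L) hU"
    and L: "L > 0" and q: "q > 0" and hU: "hU > 0" and hZ: "hZ > 0" and R: "R \<ge> 1"
    and \<kappa>: "(\<lambda>x. \<kappa> (fst x) (snd x)) \<in> borel_measurable (borel_bar L \<Otimes>\<^sub>M borel_bar L)"
      "\<And>u v. 0 \<le> \<kappa> u v" "\<And>u v. \<kappa> u v \<noteq> 0 \<Longrightarrow> norm (u - v) \<le> hU"
      "\<And>v. kernel_mass L \<kappa> (Omega_bar L) v \<le> ennreal R"
      "\<And>u v. u \<in> Omega_bar L \<Longrightarrow> \<kappa> u v \<le> R / hU\<^sup>2"
    and kc: "kernel_const KZ S hZ z > 0" and K0: "\<And>x. 0 \<le> KZ x"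
    and z: "z \<in> S" and zs: "\<And>i. i < n \<Longrightarrow> zs i \<in> S"
    and mu: "\<And>i. i < n \<Longrightarrow> emeasure (weighted_dgm L w (D i)) (Omega_bar L) \<le> ennreal M0"
    and nu: "\<And>i. i < n \<Longrightarrow> emeasure (\<Lambda> (zs i)) (Omega_bar L) \<le> ennreal M0"
    and T: "0 < T" "T = (\<Sum>i<n. KZ ((zs i - z) /\<^sub>R hZ))"
    and d: "\<And>j. 0 \<le> d j"
    and dev: "\<And>j \<epsilon>. j \<le> J \<Longrightarrow> \<epsilon> \<in> cell_indices j \<rightarrow>\<^sub>E {-1, 1} \<Longrightarrow>
      (\<Sum>i<n. KZ ((zs i - z) /\<^sub>R hZ) * score (cell_indices j) (\<lambda>k. kernel_mass L \<kappa> (cell L j k)) \<epsilon> (zs i, D i)) \<le> T * d j"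
    and b: "0 \<le> b" "\<And>i. i < n \<Longrightarrow> partial_ot L q (smoothing L \<kappa> (\<Lambda> (zs i))) (\<Lambda> (zs i)) \<le> ennreal b"
    and H: "0 \<le> H" "\<And>i. i < n \<Longrightarrow> KZ ((zs i - z) /\<^sub>R hZ) \<noteq> 0 \<Longrightarrow> partial_ot L q (\<Lambda> (zs i)) (\<Lambda> z) \<le> ennreal H"
  shows "partial_ot L q (Lambda_hat L w S KZ KU hZ hU n zs D z) (\<Lambda> z) \<le> ennreal (3 powr q *
    (((4 * L / 2 ^ J) powr q * (R * M0) + (\<Sum>j\<le>J. (8 * L / 2 ^ j) powr q * d j)) + 3 powr q * (b + H)))"
proof -
  define a where "a i = KZ ((zs i - z) /\<^sub>R hZ) / T" for i
  let ?\<mu> = "\<lambda>i. weighted_dgm L w (D i)" and ?\<nu> = "\<lambda>i. \<Lambda> (zs i)"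
  have R0: "0 \<le> R" using R by simp
  have a: "0 \<le> a i" "(\<Sum>i<n. a i) = 1" for i
    using K0 T by (auto simp: a_def simp flip: sum_divide_distrib)
  have f\<mu>: "finite_measure (?\<mu> i)" if "i < n" for i
    using mu[OF that] sets_eq_imp_space_eq[OF sets_weighted_dgm, of L w "D i"]
    by (intro finite_measureI) (auto simp: top_unique)
  have f\<nu>: "finite_measure (?\<nu> i)" and s\<nu>: "sets (?\<nu> i) = sets (borel_bar L)" if "i < n" for i
    using Lambda_finite Lambda_sets zs[OF that] by auto
  have fs\<mu>: "finite_measure (smoothing L \<kappa> (?\<mu> i))" if "i < n" for i
    by (rule finite_smoothing[OF \<kappa>(1) R0 \<kappa>(4) f\<mu>[OF that] sets_weighted_dgm])
  have fs\<nu>: "finite_measure (smoothing L \<kappa> (?\<nu> i))" if "i < n" for i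
    by (rule finite_smoothing[OF \<kappa>(1) R0 \<kappa>(4) f\<nu>[OF that] s\<nu>[OF that]])
  define P where "P = mixture L n a (\<lambda>i. smoothing L \<kappa> (?\<mu> i))"
  define Q where "Q = mixture L n a (\<lambda>i. smoothing L \<kappa> (?\<nu> i))"
  have hat: "Lambda_hat L w S KZ KU hZ hU n zs D z = P"
    unfolding P_def a_def T(2)
    by (rule Lambda_hat_eq_mixture[OF \<kappa>_eq L hU hZ R0 \<kappa>(1,2) _ \<kappa>(4,5) kc K0 _ f\<mu>])
      (use \<kappa>(3) T in auto)
  have fP: "finite_measure P" and fQ: "finite_measure Q" and sP: "sets P = sets (borel_bar L)" and sQ: "sets Q = sets (borel_bar L)"
    unfolding P_def Q_def using fs\<mu> fs\<nu> by (auto intro!: mixture_finite)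
  have mP: "measure P A = (\<Sum>i<n. a i * measure (smoothing L \<kappa> (?\<mu> i)) A)"
    and mQ: "measure Q A = (\<Sum>i<n. a i * measure (smoothing L \<kappa> (?\<nu> i)) A)" if "A \<in> sets (borel_bar L)" for A
    unfolding P_def Q_def using fs\<mu> fs\<nu> a that by (auto intro!: measure_mixture)
  have cell_\<mu>: "measure (smoothing L \<kappa> (?\<mu> i)) A = dgm_functional (kernel_mass L \<kappa> A) (D i)"
    and cell_\<nu>: "measure (smoothing L \<kappa> (?\<nu> i)) A = mean_functional (kernel_mass L \<kappa> A) (zs i)"
    if "i < n" "A \<in> sets (borel_bar L)" for i A
  proof -
    have "emeasure (smoothing L \<kappa> (?\<mu> i)) A = (\<integral>\<^sup>+v. kernel_mass L \<kappa> A v \<partial>?\<mu> i)"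
      by (rule emeasure_smoothing[OF \<kappa>(1) f\<mu>[OF that(1)] sets_weighted_dgm that(2)])
    then show "measure (smoothing L \<kappa> (?\<mu> i)) A = dgm_functional (kernel_mass L \<kappa> A) (D i)"
      by (simp add: measure_def dgm_functional_def)
    have "emeasure (smoothing L \<kappa> (?\<nu> i)) A = (\<integral>\<^sup>+v. kernel_mass L \<kappa> A v \<partial>?\<nu> i)"
      by (rule emeasure_smoothing[OF \<kappa>(1) f\<nu>[OF that(1)] s\<nu>[OF that(1)] that(2)])
    then show "measure (smoothing L \<kappa> (?\<nu> i)) A = mean_functional (kernel_mass L \<kappa> A) (zs i)"
      by (simp add: measure_def mean_functional_def)
  qed
  have mass_P: "measure P (Omega L) \<le> R * M0"
  proof -
    have "measure (smoothing L \<kappa> (?\<mu> i)) (Omega L) \<le> R * M0" if "i < n" for i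
    proof -
      have "measure (smoothing L \<kappa> (?\<mu> i)) (Omega L) \<le> measure (smoothing L \<kappa> (?\<mu> i)) (Omega_bar L)"
        using fs\<mu>[OF that] Omega_subset by (intro finite_measure.finite_measure_mono) auto
      also have "\<dots> \<le> R * measure (?\<mu> i) (Omega_bar L)"
        unfolding measure_def[of "smoothing _ _ _"] using R0
        by (intro enn2real_leI emeasure_smoothing_le[OF \<kappa>(1) R0 \<kappa>(4) f\<mu>[OF that] sets_weighted_dgm]) auto
      also have "\<dots> \<le> R * M0"
        using mu[OF that] R0 M0 unfolding measure_def by (intro mult_left_mono enn2real_leI) auto
      finally show ?thesis .
    qed
    then have "measure P (Omega L) \<le> (\<Sum>i<n. a i * (R * M0))"
      unfolding mP[OF Omega_borel_bar] using a by (intro sum_mono mult_left_mono) auto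
    then show ?thesis using a(2) by (simp flip: sum_distrib_right)
  qed
  have D: "(\<Sum>k\<in>cell_indices j. \<bar>measure P (cell L j k) - measure Q (cell L j k)\<bar>) \<le> d j" if "j \<le> J" for j
  proof -
    define x where "x k = measure P (cell L j k) - measure Q (cell L j k)" for k
    \<comment> \<open>The sign pattern that turns the sum of absolute values into a linear functional.\<close>
    define \<epsilon> where "\<epsilon> = restrict (\<lambda>k. if 0 \<le> x k then 1 else - 1 :: real) (cell_indices j)"
    have \<epsilon>: "\<epsilon> \<in> cell_indices j \<rightarrow>\<^sub>E {-1, 1}" by (auto simp: \<epsilon>_def)
    have xk: "x k = (\<Sum>i<n. a i * (dgm_functional (kernel_mass L \<kappa> (cell L j k)) (D i)
       - mean_functional (kernel_mass L \<kappa> (cell L j k)) (zs i)))" for k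
      unfolding x_def mP[OF cell_borel_bar] mQ[OF cell_borel_bar]
      by (simp add: cell_\<mu> cell_\<nu> right_diff_distrib sum_subtractf)
    have "(\<Sum>k\<in>cell_indices j. \<bar>x k\<bar>) = (\<Sum>k\<in>cell_indices j. \<epsilon> k * x k)"
      by (intro sum.cong refl) (auto simp: \<epsilon>_def)
    also have "\<dots> = (\<Sum>i<n. a i * score (cell_indices j) (\<lambda>k. kernel_mass L \<kappa> (cell L j k)) \<epsilon> (zs i, D i))"
      unfolding xk score_def sum_distrib_left by (subst sum.swap) (simp add: mult_ac)
    also have "\<dots> = (\<Sum>i<n. KZ ((zs i - z) /\<^sub>R hZ) * score (cell_indices j) (\<lambda>k. kernel_mass L \<kappa> (cell L j k)) \<epsilon> (zs i, D i)) / T"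
      by (simp add: a_def sum_divide_distrib)
    also have "\<dots> \<le> d j" using dev[OF that \<epsilon>] T(1) by (simp add: divide_le_eq mult.commute)
    finally show ?thesis by (simp add: x_def)
  qed
  let ?X = "(4 * L / 2 ^ J) powr q * (R * M0) + (\<Sum>j\<le>J. (8 * L / 2 ^ j) powr q * d j)"
  have PQ: "partial_ot L q P Q \<le> ennreal ?X"
    by (rule order_trans[OF partial_ot_dyadic[OF L q fP fQ sP sQ, of J]])
      (use D mass_P in \<open>auto intro!: ennreal_leI add_mono sum_mono mult_left_mono\<close>)
  have "partial_ot L q Q (\<Lambda> z) \<le> ennreal (3 powr q * (b + H))"
    unfolding Q_def
  proof (rule partial_ot_mixture_le[OF _ fs\<nu> Lambda_finite[OF z] a])
    fix i assume i: "i < n" "0 < a i"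
    then have "KZ ((zs i - z) /\<^sub>R hZ) \<noteq> 0" by (auto simp: a_def)
    then show "partial_ot L q (smoothing L \<kappa> (?\<nu> i)) (\<Lambda> z) \<le> ennreal (3 powr q * (b + H))"
      using i b H by (intro partial_ot_triangle[OF L q fs\<nu> f\<nu> Lambda_finite[OF z] s\<nu>]) auto
  qed (use b H in auto)
  then have "partial_ot L q P (\<Lambda> z) \<le> ennreal (3 powr q * (?X + 3 powr q * (b + H)))"
    using R0 M0 b H d
    by (intro partial_ot_triangle[OF L q fP fQ Lambda_finite[OF z] sQ PQ]) (auto intro!: add_nonneg_nonneg sum_nonneg)
  then show ?thesis by (simp add: hat)
qed

end

section \<open>Deviations on a net of covariates\<close>

text \<open>One representative for each cell of a cubical grid that meets \<open>S\<close>.\<close>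

lemma finite_net:
  fixes S :: "'a::euclidean_space set"
  assumes "bounded S"
  obtains C :: real where "C > 0" "\<And>\<delta>. 0 < \<delta> \<Longrightarrow> \<delta> \<le> 1 \<Longrightarrow>
    \<exists>G. finite G \<and> G \<subseteq> S \<and> real (card G) \<le> (C / \<delta>) ^ DIM('a) \<and> (\<forall>z\<in>S. \<exists>g\<in>G. norm (z - g) \<le> \<delta>)"
proof -
  obtain B where B: "B > 0" "\<And>z. z \<in> S \<Longrightarrow> norm z \<le> B" using assms by (auto simp: bounded_pos)
  let ?D = "real DIM('a)"
  define C where "C = 2 * B * ?D + 3"
  have "\<exists>G. finite G \<and> G \<subseteq> S \<and> real (card G) \<le> (C / \<delta>) ^ DIM('a) \<and> (\<forall>z\<in>S. \<exists>g\<in>G. norm (z - g) \<le> \<delta>)"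
    if \<delta>: "0 < \<delta>" "\<delta> \<le> 1" for \<delta>
  proof -
    define idx where "idx z = (\<lambda>b\<in>Basis. \<lfloor>(z \<bullet> b) * (?D / \<delta>)\<rfloor>)" for z :: 'a
    define m where "m = \<lceil>B * ?D / \<delta>\<rceil>"
    have "0 \<le> B * ?D / \<delta>" using B \<delta> by simp
    then have m0: "0 \<le> m" unfolding m_def by linarith
    have bracket: "\<lfloor>t\<rfloor> \<in> {-\<lceil>x\<rceil>..\<lceil>x\<rceil>}" if "\<bar>t\<bar> \<le> x" for t x :: real
      using that by (simp add: le_floor_iff floor_le_iff) linarith
    have idx_mem: "idx z \<in> Basis \<rightarrow>\<^sub>E {-m..m}" if z: "z \<in> S" for z
    proof -
      have "\<lfloor>(z \<bullet> b) * (?D / \<delta>)\<rfloor> \<in> {-m..m}" if b: "b \<in> Basis" for b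
      proof -
        have "\<bar>z \<bullet> b\<bar> \<le> B" using Basis_le_norm[OF b, of z] B(2)[OF z] by linarith
        then have "\<bar>z \<bullet> b\<bar> * (?D / \<delta>) \<le> B * (?D / \<delta>)" using \<delta> by (intro mult_right_mono) auto
        then have "\<bar>(z \<bullet> b) * (?D / \<delta>)\<bar> \<le> B * ?D / \<delta>" using \<delta> by (simp add: abs_mult)
        then show ?thesis unfolding m_def by (rule bracket)
      qed
      then show ?thesis by (auto simp: idx_def)
    qed
    have near: "norm (z - g) \<le> \<delta>" if "idx z = idx g" for z g
    proof -
      have "\<bar>(z - g) \<bullet> b\<bar> \<le> \<delta> / ?D" if b: "b \<in> Basis" for b
      proof -
        have "\<lfloor>(z \<bullet> b) * (?D / \<delta>)\<rfloor> = \<lfloor>(g \<bullet> b) * (?D / \<delta>)\<rfloor>"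
          using fun_cong[OF \<open>idx z = idx g\<close>, of b] b by (simp add: idx_def)
        then have "\<bar>(z \<bullet> b) * (?D / \<delta>) - (g \<bullet> b) * (?D / \<delta>)\<bar> < 1" by linarith
        moreover have "(z \<bullet> b) * (?D / \<delta>) - (g \<bullet> b) * (?D / \<delta>) = ((z - g) \<bullet> b) * (?D / \<delta>)"
          by (simp only: inner_diff_left left_diff_distrib)
        moreover have "\<bar>?D / \<delta>\<bar> = ?D / \<delta>" using \<delta> by simp
        ultimately have "\<bar>(z - g) \<bullet> b\<bar> * (?D / \<delta>) < 1" by (simp only: abs_mult)
        then show ?thesis using \<delta> by (simp add: field_simps)
      qed
      then have "(\<Sum>b\<in>Basis. \<bar>(z - g) \<bullet> b\<bar>) \<le> (\<Sum>b\<in>(Basis :: 'a set). \<delta> / ?D)" by (intro sum_mono)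
      also have "\<dots> = \<delta>" by simp
      finally show ?thesis using norm_le_l1[of "z - g"] by simp
    qed
    define rep where "rep k = (SOME z. z \<in> S \<and> idx z = k)" for k
    have rep: "rep (idx z) \<in> S \<and> idx (rep (idx z)) = idx z" if "z \<in> S" for z
      unfolding rep_def by (rule someI[of _ z]) (use that in simp)
    let ?G = "rep ` (idx ` S)"
    have sub: "idx ` S \<subseteq> Basis \<rightarrow>\<^sub>E {-m..m}" using idx_mem by auto
    have fin: "finite (Basis \<rightarrow>\<^sub>E {-m..m} :: ('a \<Rightarrow> int) set)" by (intro finite_PiE) auto
    have "card ?G \<le> card (idx ` S)" by (intro card_image_le finite_subset[OF sub fin])
    also have "\<dots> \<le> card (Basis \<rightarrow>\<^sub>E {-m..m} :: ('a \<Rightarrow> int) set)" by (intro card_mono fin sub)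
    also have "\<dots> = nat (2 * m + 1) ^ DIM('a)" by (simp add: card_PiE algebra_simps)
    finally have "real (card ?G) \<le> real (nat (2 * m + 1) ^ DIM('a))" by (simp only: of_nat_le_iff)
    also have "\<dots> = real_of_int (2 * m + 1) ^ DIM('a)" using m0 by simp
    also have "\<dots> \<le> (C / \<delta>) ^ DIM('a)"
    proof (rule power_mono)
      have "real_of_int m \<le> B * ?D / \<delta> + 1" unfolding m_def by linarith
      moreover have "3 \<le> 3 / \<delta>" using \<delta> by (simp add: le_divide_eq)
      moreover have "C / \<delta> = 2 * (B * ?D / \<delta>) + 3 / \<delta>" by (simp add: C_def add_divide_distrib)
      ultimately show "real_of_int (2 * m + 1) \<le> C / \<delta>" by simp
    qed (use m0 in simp)
    finally have "real (card ?G) \<le> (C / \<delta>) ^ DIM('a)" .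
    moreover have "finite ?G" by (intro finite_imageI finite_subset[OF sub fin])
    moreover have "?G \<subseteq> S" using rep by auto
    moreover have "\<forall>z\<in>S. \<exists>g\<in>?G. norm (z - g) \<le> \<delta>" using rep near by (metis imageI)
    ultimately show ?thesis by blast
  qed
  moreover have "C > 0" using B by (simp add: C_def add_nonneg_pos)
  ultimately show thesis by (intro that)
qed

context diagram_sample begin

text \<open>A union bound over the net points, the levels and the \<open>2 ^ 4 ^ j\<close> sign patterns of level \<open>j\<close>. At level \<open>j\<close> the
  threshold grows like \<open>2 ^ j\<close>, so the exponent of the tail bound grows like \<open>4 ^ j * ln n\<close> and absorbs the number of sign
  patterns. The growth of the threshold is affordable since cells of level \<open>j\<close> are weighted by \<open>2 powr (- j * q)\<close> with \<open>q > 1\<close>.\<close>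

lemma exceptional_event:
  fixes KZ :: "'a \<Rightarrow> real" and \<phi> :: "nat \<Rightarrow> int \<times> int \<Rightarrow> real \<times> real \<Rightarrow> ennreal"
  assumes b_def: "b = 2 * R * M0 * B" and v_def: "v = (2 * R * M0)\<^sup>2 * (Cp * B\<^sup>2 * unit_ball_vol DIM('a))"
    and Km: "KZ \<in> borel_measurable borel" and K: "\<And>x. 0 \<le> KZ x" "\<And>x. KZ x \<le> B"
      "\<And>x. KZ x \<noteq> 0 \<Longrightarrow> norm x \<le> 1" and B: "0 < B" and h: "0 < h"
    and \<phi>: "\<And>j k. \<phi> j k \<in> borel_measurable (borel_bar L)"
      "\<And>j v. v \<in> Omega_bar L \<Longrightarrow> (\<Sum>k\<in>cell_indices j. \<phi> j k v) \<le> ennreal R" and R: "1 \<le> R"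
    and G: "finite G"
    and r: "0 < r" "2 ^ J * r \<le> 1" and n: "real n * h ^ DIM('a) * r\<^sup>2 = ln (real n)" "1 \<le> ln (real n)"
    and \<gamma>: "1 \<le> \<gamma>" and A: "A = b * (\<gamma> + v / b\<^sup>2)"
  obtains E where "E \<in> sets M" "emeasure M E \<le> ennreal (real (card G) * (real J + 2) * exp (- (\<gamma> - 1) * ln (real n)))"
    "\<And>\<omega> i. \<omega> \<in> space M - E \<Longrightarrow> i < n \<Longrightarrow> emeasure (\<mu> i \<omega>) (Omega_bar L) \<le> ennreal M0"
    "\<And>\<omega> i. \<omega> \<in> space M - E \<Longrightarrow> i < n \<Longrightarrow> emeasure (\<Lambda> (Zs i \<omega>)) (Omega_bar L) \<le> ennreal M0"
    "\<And>\<omega> g. \<omega> \<in> space M - E \<Longrightarrow> g \<in> G \<Longrightarrow>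
       (\<Sum>i<n. expectation (\<lambda>\<omega>. KZ ((Zs 0 \<omega> - g) /\<^sub>R h)) - KZ ((Zs i \<omega> - g) /\<^sub>R h)) \<le> real n * h ^ DIM('a) * A * r"
    "\<And>\<omega> g j \<epsilon>. \<omega> \<in> space M - E \<Longrightarrow> g \<in> G \<Longrightarrow> j \<le> J \<Longrightarrow> \<epsilon> \<in> cell_indices j \<rightarrow>\<^sub>E {-1, 1} \<Longrightarrow>
       (\<Sum>i<n. KZ ((Zs i \<omega> - g) /\<^sub>R h) * score (cell_indices j) (\<phi> j) \<epsilon> (Zs i \<omega>, Ds i \<omega>))
         \<le> real n * h ^ DIM('a) * A * (2 ^ j * r)"
proof -
  let ?K = "\<lambda>g z. KZ ((z - g) /\<^sub>R h)"
  have b0: "0 < b" using R M0 B by (simp add: b_def)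
  have Kg: "?K g \<in> borel_measurable borel" "0 \<le> ?K g x" "?K g x \<le> B" "?K g x \<noteq> 0 \<Longrightarrow> norm (x - g) \<le> h" for g x
  proof -
    have "(\<lambda>x. (x - g) /\<^sub>R h) \<in> borel_measurable borel"
      by (intro borel_measurable_continuous_onI continuous_intros)
    then show "?K g \<in> borel_measurable borel" using Km by (rule measurable_compose)
    assume "?K g x \<noteq> 0"
    then have "norm ((x - g) /\<^sub>R h) \<le> 1" by (rule K(3))
    then have "norm (x - g) \<le> 1 * h" by (simp only: norm_scaled_le[OF h])
    then show "norm (x - g) \<le> h" by simp
  qed (use K in auto)
  define s where "s j = real n * h ^ DIM('a) * A * (2 ^ j * r)" for j :: nat
  \<comment> \<open>Proportional to the threshold, and admissible because the levels stop at \<open>J\<close>.\<close>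
  define l where "l j = 2 ^ j * r / b" for j :: nat
  have l: "0 \<le> l j" "l j * (2 * R * M0 * B) \<le> 1" if "j \<le> J" for j
  proof -
    show "0 \<le> l j" using r b0 by (simp add: l_def)
    have "2 ^ j * r \<le> 2 ^ J * r" using r that by (intro mult_right_mono power_increasing) auto
    then have "2 ^ j * r \<le> 1" using r by linarith
    moreover have "l j * b = 2 ^ j * r" using b0 by (simp add: l_def)
    ultimately show "l j * (2 * R * M0 * B) \<le> 1" by (simp add: b_def)
  qed
  have ex: "- l j * s j + real n * (l j)\<^sup>2 * ((2 * R * M0)\<^sup>2 * (Cp * B\<^sup>2 * unit_ball_vol DIM('a) * h ^ DIM('a)))
      = - \<gamma> * (4 ^ j * ln (real n))" for j
  proof -
    have A': "A / b = \<gamma> + v / b\<^sup>2" using b0 by (simp add: A)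
    have "(2 * R * M0)\<^sup>2 * (Cp * B\<^sup>2 * unit_ball_vol DIM('a) * h ^ DIM('a)) = v * h ^ DIM('a)"
      by (simp add: v_def)
    moreover have "(2 ^ j)\<^sup>2 = (4::real) ^ j" by (simp add: power_mult[symmetric] mult.commute[of j] power_mult)
    ultimately have "- l j * s j + real n * (l j)\<^sup>2 * ((2 * R * M0)\<^sup>2 * (Cp * B\<^sup>2 * unit_ball_vol DIM('a) * h ^ DIM('a)))
       = (real n * h ^ DIM('a) * r\<^sup>2) * 4 ^ j * (v / b\<^sup>2 - A / b)"
      by (simp add: l_def s_def power_mult_distrib power_divide power2_eq_square[of r] algebra_simps power2_eq_square)
    also have "\<dots> = - \<gamma> * (4 ^ j * ln (real n))" unfolding n(1) A' by simp
    finally show ?thesis .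
  qed
  define E1 where "E1 g = {\<omega> \<in> space M. s 0 \<le> (\<Sum>i<n. expectation (\<lambda>\<omega>. ?K g (Zs 0 \<omega>)) - ?K g (Zs i \<omega>))}" for g
  define E2 where "E2 g j \<epsilon> = {\<omega> \<in> space M. s j \<le> (\<Sum>i<n. ?K g (Zs i \<omega>) * score (cell_indices j) (\<phi> j) \<epsilon> (Zs i \<omega>, Ds i \<omega>))}" for g j \<epsilon>
  have KZm: "(\<lambda>\<omega>. ?K g (Zs i \<omega>)) \<in> borel_measurable M" for g i
    using measurable_compose[OF Zs_measurable measurable_restrict_space1[OF Kg(1)]] .
  have scm: "(\<lambda>\<omega>. score (cell_indices j) (\<phi> j) \<epsilon> (Zs i \<omega>, Ds i \<omega>)) \<in> borel_measurable M" for i j \<epsilon>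
    using measurable_compose[OF pair_measurable score_measurable[OF \<phi>(1)]] .
  have E1m: "E1 g \<in> sets M" for g
  proof -
    note [measurable] = KZm
    show ?thesis unfolding E1_def by measurable
  qed
  have E2m: "E2 g j \<epsilon> \<in> sets M" for g j \<epsilon>
  proof -
    note [measurable] = KZm scm
    show ?thesis unfolding E2_def by measurable
  qed
  have P1: "emeasure M (E1 g) \<le> ennreal (exp (- (\<gamma> - 1) * ln (real n)))" for g
  proof -
    have "emeasure M (E1 g) \<le> ennreal (exp (- l 0 * s 0 + real n * (l 0)\<^sup>2 * ((2 * R * M0)\<^sup>2 * (Cp * B\<^sup>2 * unit_ball_vol DIM('a) * h ^ DIM('a)))))"
      unfolding E1_def
      by (rule kernel_sum_deviation[where g = g, OF Kg B h R l[of 0]]) auto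
    also have "\<dots> \<le> ennreal (exp (- (\<gamma> - 1) * ln (real n)))"
      unfolding ex using n(2) by (intro ennreal_leI) (simp add: algebra_simps)
    finally show ?thesis .
  qed
  have P2: "(\<Sum>\<epsilon>\<in>cell_indices j \<rightarrow>\<^sub>E {-1, 1}. emeasure M (E2 g j \<epsilon>)) \<le> ennreal (exp (- (\<gamma> - 1) * ln (real n)))"
    if j: "j \<le> J" for g j
  proof -
    have "(\<Sum>\<epsilon>\<in>cell_indices j \<rightarrow>\<^sub>E {-1, 1}. emeasure M (E2 g j \<epsilon>))
       \<le> (\<Sum>\<epsilon>\<in>cell_indices j \<rightarrow>\<^sub>E {-1, 1 :: real}. ennreal (exp (- \<gamma> * (4 ^ j * ln (real n)))))"
    proof (intro sum_mono)
      fix \<epsilon> :: "int \<times> int \<Rightarrow> real" assume "\<epsilon> \<in> cell_indices j \<rightarrow>\<^sub>E {-1, 1}"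
      then have "\<bar>\<epsilon> k\<bar> \<le> 1" if "k \<in> cell_indices j" for k using PiE_mem[OF _ that] by fastforce
      then show "emeasure M (E2 g j \<epsilon>) \<le> ennreal (exp (- \<gamma> * (4 ^ j * ln (real n))))"
        unfolding E2_def ex[symmetric]
        by (intro score_deviation[where g = g, OF Kg B h _ \<phi>(1) \<phi>(2) R _ l[OF j]]) auto
    qed
    also have "\<dots> = ennreal (2 ^ 4 ^ j * exp (- \<gamma> * (4 ^ j * ln (real n))))"
      by (simp add: card_PiE card_cell_indices ennreal_mult ennreal_power[symmetric])
    also have "2 ^ 4 ^ j * exp (- \<gamma> * (4 ^ j * ln (real n))) \<le> exp (- (\<gamma> - 1) * ln (real n))"
    proof -
      have "(2::real) ^ 4 ^ j \<le> exp 1 ^ 4 ^ j" using exp_ge_add_one_self[of 1] by (intro power_mono) auto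
      also have "\<dots> = exp (4 ^ j)" by (simp flip: exp_of_nat_mult)
      also have "\<dots> \<le> exp (4 ^ j * ln (real n))" using n(2) by simp
      finally have "2 ^ 4 ^ j * exp (- \<gamma> * (4 ^ j * ln (real n))) \<le> exp (4 ^ j * ln (real n)) * exp (- \<gamma> * (4 ^ j * ln (real n)))"
        by (intro mult_right_mono) auto
      also have "\<dots> = exp (- ((\<gamma> - 1) * (4 ^ j * ln (real n))))" by (simp add: algebra_simps flip: exp_add)
      also have "\<dots> \<le> exp (- ((\<gamma> - 1) * (1 * ln (real n))))"
      proof -
        have "(\<gamma> - 1) * (1 * ln (real n)) \<le> (\<gamma> - 1) * (4 ^ j * ln (real n))"
          using \<gamma> n(2) by (intro mult_left_mono mult_right_mono) auto
        then show ?thesis by simp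
      qed
      finally show ?thesis by (simp only: mult_1_left minus_mult_left)
    qed
    finally show ?thesis by (simp add: ennreal_leI)
  qed
  have "AE \<omega> in M. \<forall>i\<in>{..<n}. emeasure (\<mu> i \<omega>) (Omega_bar L) \<le> ennreal M0 \<and> emeasure (\<Lambda> (Zs i \<omega>)) (Omega_bar L) \<le> ennreal M0"
    using mass mass_Lambda by (intro AE_finite_allI) auto
  then obtain N where N: "N \<in> null_sets M" "{\<omega> \<in> space M. \<not> (\<forall>i\<in>{..<n}. emeasure (\<mu> i \<omega>) (Omega_bar L) \<le> ennreal M0
     \<and> emeasure (\<Lambda> (Zs i \<omega>)) (Omega_bar L) \<le> ennreal M0)} \<subseteq> N" by (auto elim!: AE_E simp: null_sets_def)
  define F where "F g = E1 g \<union> (\<Union>j\<in>{..J}. \<Union>\<epsilon>\<in>cell_indices j \<rightarrow>\<^sub>E {-1, 1}. E2 g j \<epsilon>)" for g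
  have fPi: "finite (cell_indices j \<rightarrow>\<^sub>E {-1, 1 :: real})" for j by (intro finite_PiE) auto
  have E2U: "(\<Union>\<epsilon>\<in>cell_indices j \<rightarrow>\<^sub>E {-1, 1}. E2 g j \<epsilon>) \<in> sets M" for g j
    using fPi E2m by (intro sets.finite_UN) auto
  have Fm: "F g \<in> sets M" for g unfolding F_def using E1m E2U fPi E2m by (intro sets.Un sets.finite_UN) auto
  have PF: "emeasure M (F g) \<le> ennreal ((real J + 2) * exp (- (\<gamma> - 1) * ln (real n)))" for g
  proof -
    let ?e = "exp (- (\<gamma> - 1) * ln (real n))"
    have "emeasure M (F g) \<le> emeasure M (E1 g) + emeasure M (\<Union>j\<in>{..J}. \<Union>\<epsilon>\<in>cell_indices j \<rightarrow>\<^sub>E {-1, 1}. E2 g j \<epsilon>)"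
      unfolding F_def using E1m E2U fPi E2m by (intro emeasure_subadditive sets.finite_UN) auto
    also have "emeasure M (\<Union>j\<in>{..J}. \<Union>\<epsilon>\<in>cell_indices j \<rightarrow>\<^sub>E {-1, 1}. E2 g j \<epsilon>)
       \<le> (\<Sum>j\<in>{..J}. emeasure M (\<Union>\<epsilon>\<in>cell_indices j \<rightarrow>\<^sub>E {-1, 1}. E2 g j \<epsilon>))"
      using E2U by (intro emeasure_subadditive_finite) auto
    also have "\<dots> \<le> (\<Sum>j\<in>{..J}. ennreal ?e)"
    proof (intro sum_mono)
      fix j assume "j \<in> {..J}"
      have "emeasure M (\<Union>\<epsilon>\<in>cell_indices j \<rightarrow>\<^sub>E {-1, 1}. E2 g j \<epsilon>) \<le> (\<Sum>\<epsilon>\<in>cell_indices j \<rightarrow>\<^sub>E {-1, 1}. emeasure M (E2 g j \<epsilon>))"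
        using fPi E2m by (intro emeasure_subadditive_finite) auto
      also have "\<dots> \<le> ennreal ?e" using \<open>j \<in> {..J}\<close> by (intro P2) simp
      finally show "emeasure M (\<Union>\<epsilon>\<in>cell_indices j \<rightarrow>\<^sub>E {-1, 1}. E2 g j \<epsilon>) \<le> ennreal ?e" .
    qed
    also have "(\<Sum>j\<in>{..J}. ennreal ?e) = ennreal ((real J + 1) * ?e)"
      by (simp add: ennreal_mult ennreal_of_nat_eq_real_of_nat add.commute[of 1] flip: ennreal_plus ennreal_1)
    finally have "emeasure M (F g) \<le> ennreal ?e + ennreal ((real J + 1) * ?e)"
      using P1[of g] by (meson add_right_mono order_trans add_left_mono add_mono)
    also have "\<dots> = ennreal ((real J + 2) * ?e)" by (simp add: algebra_simps flip: ennreal_plus)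
    finally show ?thesis .
  qed
  let ?E = "(\<Union>g\<in>G. F g) \<union> N"
  show thesis
  proof (rule that[of ?E])
    have N': "N \<in> sets M" "emeasure M N = 0" using N(1) by auto
    show "?E \<in> sets M" using G Fm N' by (intro sets.Un sets.finite_UN) auto
    have "emeasure M ?E \<le> emeasure M (\<Union>g\<in>G. F g) + emeasure M N"
      using G Fm N' by (intro emeasure_subadditive sets.finite_UN) auto
    also have "\<dots> \<le> (\<Sum>g\<in>G. emeasure M (F g))"
      using G Fm N' by (simp add: emeasure_subadditive_finite image_subset_iff)
    also have "\<dots> \<le> (\<Sum>g\<in>G. ennreal ((real J + 2) * exp (- (\<gamma> - 1) * ln (real n))))"
      by (intro sum_mono PF)
    also have "\<dots> = ennreal (real (card G) * (real J + 2) * exp (- (\<gamma> - 1) * ln (real n)))"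
      by (simp add: ennreal_of_nat_eq_real_of_nat mult.assoc ennreal_mult)
    finally show "emeasure M ?E \<le> ennreal (real (card G) * (real J + 2) * exp (- (\<gamma> - 1) * ln (real n)))" .
  next
    fix \<omega> i assume "\<omega> \<in> space M - ?E" "i < n"
    then show "emeasure (\<mu> i \<omega>) (Omega_bar L) \<le> ennreal M0" "emeasure (\<Lambda> (Zs i \<omega>)) (Omega_bar L) \<le> ennreal M0"
      using N(2) by auto
  next
    fix \<omega> g assume "\<omega> \<in> space M - ?E" "g \<in> G"
    then have "\<omega> \<notin> E1 g" "\<omega> \<in> space M" by (auto simp: F_def)
    then show "(\<Sum>i<n. expectation (\<lambda>\<omega>. ?K g (Zs 0 \<omega>)) - ?K g (Zs i \<omega>)) \<le> real n * h ^ DIM('a) * A * r"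
      by (simp add: E1_def s_def)
  next
    fix \<omega> g j and \<epsilon> :: "int \<times> int \<Rightarrow> real"
    assume "\<omega> \<in> space M - ?E" "g \<in> G" "j \<le> J" "\<epsilon> \<in> cell_indices j \<rightarrow>\<^sub>E {-1, 1}"
    then have "\<omega> \<notin> E2 g j \<epsilon>" "\<omega> \<in> space M" by (auto simp: F_def)
    then show "(\<Sum>i<n. ?K g (Zs i \<omega>) * score (cell_indices j) (\<phi> j) \<epsilon> (Zs i \<omega>, Ds i \<omega>))
         \<le> real n * h ^ DIM('a) * A * (2 ^ j * r)"
      by (simp add: E2_def s_def)
  qed
qed

end

section \<open>From the net to all covariates\<close>

text \<open>This is where \<open>q > 1\<close> enters: in the plane, the \<open>4 ^ j\<close> cells of level \<open>j\<close> contribute \<open>2 ^ j * r\<close>, weighted by the \<open>q\<close>-th power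
  of the cell size.\<close>

lemma geometric_level_sum:
  fixes c q D r :: real
  assumes q: "q > 1" and c: "0 < c" and D: "0 \<le> D" and r: "0 \<le> r"
  shows "(\<Sum>j\<le>J. (c / 2 ^ j) powr q * (D * (2 ^ j * r))) \<le> c powr q * D * r / (1 - 2 powr (1 - q))"
proof -
  define x :: real where "x = 2 powr (1 - q)"
  have x: "0 < x" "x < 1" using q powr_less_mono[of "1 - q" 0 2] by (auto simp: x_def)
  have e: "(c / 2 ^ j) powr q * (D * (2 ^ j * r)) = c powr q * D * r * x ^ j" for j
  proof -
    have "x ^ j = 2 powr (real j * (1 - q))" unfolding x_def by (simp add: powr_powr mult.commute flip: powr_realpow)
    also have "\<dots> = 2 powr (real j) / 2 powr (real j * q)" by (simp add: powr_diff[symmetric] right_diff_distrib)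
    also have "\<dots> = 2 ^ j / (2 ^ j) powr q" by (simp add: powr_powr flip: powr_realpow)
    finally have "x ^ j = 2 ^ j / (2 ^ j) powr q" .
    then show ?thesis using c by (simp add: powr_divide)
  qed
  have "(\<Sum>j\<le>J. (c / 2 ^ j) powr q * (D * (2 ^ j * r))) = c powr q * D * r * (\<Sum>j\<le>J. x ^ j)"
    unfolding e by (simp add: sum_distrib_left)
  also have "(\<Sum>j\<le>J. x ^ j) \<le> 1 / (1 - x)"
  proof -
    have "(\<Sum>j<Suc J. x ^ j) = (1 - x ^ Suc J) / (1 - x)" using x by (subst geometric_sum) (auto simp: field_simps)
    also have "\<dots> \<le> 1 / (1 - x)" using x by (intro divide_right_mono) auto
    finally show ?thesis by (simp add: lessThan_Suc_atMost)
  qed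
  finally show ?thesis using D r by (simp add: x_def mult_left_mono)
qed

context diagram_sample begin

text \<open>The deterministic core: on the event that the deviations are controlled at a net point \<open>g\<close>
  near \<open>z\<close>, the error at \<open>z\<close> is controlled.\<close>

lemma net_point_bound:
  assumes \<kappa>_eq: "\<kappa> = kernel_corr KU (Omega_bar L) hU"
    and L: "L > 0" and q: "q > 1" and hU: "hU > 0" and hZ: "hZ > 0" and R: "R \<ge> 1"
    and \<kappa>: "(\<lambda>x. \<kappa> (fst x) (snd x)) \<in> borel_measurable (borel_bar L \<Otimes>\<^sub>M borel_bar L)"
      "\<And>u v. 0 \<le> \<kappa> u v" "\<And>u v. \<kappa> u v \<noteq> 0 \<Longrightarrow> norm (u - v) \<le> hU"
      "\<And>v. kernel_mass L \<kappa> (Omega_bar L) v \<le> ennreal R"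
      "\<And>u v. u \<in> Omega_bar L \<Longrightarrow> \<kappa> u v \<le> R / hU\<^sup>2"
    and kc: "kernel_const KZ S hZ z > 0" and K0: "\<And>x. 0 \<le> KZ x"
    and lip: "\<And>x y. \<bar>KZ x - KZ y\<bar> \<le> Lp * norm (x - y)" "0 < Lp"
    and z: "z \<in> S" and zs: "\<And>i. i < n \<Longrightarrow> zs i \<in> S"
    and mu: "\<And>i. i < n \<Longrightarrow> emeasure (weighted_dgm L w (D i)) (Omega_bar L) \<le> ennreal M0"
    and nu: "\<And>i. i < n \<Longrightarrow> emeasure (\<Lambda> (zs i)) (Omega_bar L) \<le> ennreal M0"
    and g: "norm (z - g) \<le> hZ ^ (DIM('a) + 1) * r"
    and r: "0 < r" "r \<le> 1" "1 < 2 ^ Suc J * r" and n: "n > 0"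
    and A: "0 < A" and c1: "0 < c1" "(A + Lp) * r \<le> c1 / 2"
    and e0: "c1 * hZ ^ DIM('a) \<le> e0"
    and low: "(\<Sum>i<n. e0 - KZ ((zs i - g) /\<^sub>R hZ)) \<le> real n * hZ ^ DIM('a) * A * r"
    and dev: "\<And>j \<epsilon>. j \<le> J \<Longrightarrow> \<epsilon> \<in> cell_indices j \<rightarrow>\<^sub>E {-1, 1} \<Longrightarrow>
      (\<Sum>i<n. KZ ((zs i - g) /\<^sub>R hZ) * score (cell_indices j) (\<lambda>k. kernel_mass L \<kappa> (cell L j k)) \<epsilon> (zs i, D i))
         \<le> real n * hZ ^ DIM('a) * A * (2 ^ j * r)"
    and b: "0 \<le> b" "\<And>i. i < n \<Longrightarrow> partial_ot L q (smoothing L \<kappa> (\<Lambda> (zs i))) (\<Lambda> (zs i)) \<le> ennreal b"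
    and H: "0 \<le> H" "\<And>i. i < n \<Longrightarrow> KZ ((zs i - z) /\<^sub>R hZ) \<noteq> 0 \<Longrightarrow> partial_ot L q (\<Lambda> (zs i)) (\<Lambda> z) \<le> ennreal H"
  shows "partial_ot L q (Lambda_hat L w S KZ KU hZ hU n zs D z) (\<Lambda> z) \<le> ennreal (3 powr q *
    (((8 * L) powr q * (R * M0) + (8 * L) powr q * (2 / c1 * (A + 2 * R * M0 * Lp)) / (1 - 2 powr (1 - q))) * r
      + 3 powr q * (b + H)))"
proof -
  define N where "N = real n * hZ ^ DIM('a)"
  have N: "N > 0" using n hZ by (simp add: N_def)
  let ?k = "\<lambda>i. KZ ((zs i - z) /\<^sub>R hZ)" and ?kg = "\<lambda>i. KZ ((zs i - g) /\<^sub>R hZ)"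
  have RM: "0 < R * M0" using R M0 by simp
  have close: "\<bar>?k i - ?kg i\<bar> \<le> Lp * (hZ ^ DIM('a) * r)" for i
  proof -
    have "(zs i - z) /\<^sub>R hZ - (zs i - g) /\<^sub>R hZ = (g - z) /\<^sub>R hZ" by (simp add: algebra_simps)
    then have "\<bar>?k i - ?kg i\<bar> \<le> Lp * norm ((g - z) /\<^sub>R hZ)" using lip(1)[of "(zs i - z) /\<^sub>R hZ" "(zs i - g) /\<^sub>R hZ"] by simp
    also have "norm ((g - z) /\<^sub>R hZ) \<le> hZ ^ DIM('a) * r"
      using g by (subst norm_scaled_le[OF hZ]) (simp add: norm_minus_commute mult_ac)
    finally show ?thesis using lip(2) by simp
  qed
  define T where "T = (\<Sum>i<n. ?k i)"
  \<comment> \<open>The sum of the weights has the order of the expected number of covariates in the kernel window.\<close>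
  have T: "N * (c1 / 2) \<le> T"
  proof -
    have "(\<Sum>i<n. ?kg i) - T = (\<Sum>i<n. ?kg i - ?k i)" by (simp add: T_def sum_subtractf)
    also have "\<dots> \<le> (\<Sum>i<n. Lp * (hZ ^ DIM('a) * r))" using close by (intro sum_mono) (simp add: abs_le_iff)
    also have "\<dots> = N * (Lp * r)" by (simp add: N_def)
    finally have 1: "(\<Sum>i<n. ?kg i) \<le> T + N * (Lp * r)" by simp
    have "(\<Sum>i<n. e0 - ?kg i) = real n * e0 - (\<Sum>i<n. ?kg i)" by (simp add: sum_subtractf)
    then have 2: "real n * e0 \<le> N * (A * r) + (\<Sum>i<n. ?kg i)" using low by (simp add: N_def mult.assoc)
    have "N * c1 \<le> real n * e0" using e0 n by (simp add: N_def mult.assoc mult_left_mono mult.commute)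
    with 1 2 have "N * c1 \<le> T + N * ((A + Lp) * r)" by (simp add: algebra_simps)
    also have "N * ((A + Lp) * r) \<le> N * (c1 / 2)" using N c1 by (intro mult_left_mono) auto
    finally show ?thesis by (simp add: algebra_simps)
  qed
  then have T0: "0 < T" using N c1 by (intro less_le_trans[OF _ T]) simp
  define C where "C = 2 / c1 * (A + 2 * R * M0 * Lp)"
  have C0: "0 \<le> C" unfolding C_def using c1(1) A R M0 lip(2) by (intro mult_nonneg_nonneg add_nonneg_nonneg divide_nonneg_pos) auto
  have dev': "(\<Sum>i<n. ?k i * score (cell_indices j) (\<lambda>k. kernel_mass L \<kappa> (cell L j k)) \<epsilon> (zs i, D i)) \<le> T * (C * (2 ^ j * r))"
    if j: "j \<le> J" and \<epsilon>: "\<epsilon> \<in> cell_indices j \<rightarrow>\<^sub>E {-1, 1}" for j \<epsilon>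
  proof -
    let ?\<phi> = "\<lambda>k. kernel_mass L \<kappa> (cell L j k)"
    let ?s = "\<lambda>i. score (cell_indices j) ?\<phi> \<epsilon> (zs i, D i)"
    have \<epsilon>1: "\<bar>\<epsilon> k\<bar> \<le> 1" if "k \<in> cell_indices j" for k using PiE_mem[OF \<epsilon> that] by auto
    have \<phi>m: "?\<phi> k \<in> borel_measurable (borel_bar L)" for k
      by (rule kernel_mass_measurable[OF \<kappa>(1)]) simp
    have \<phi>s: "(\<Sum>k\<in>cell_indices j. ?\<phi> k v) \<le> ennreal R" if "v \<in> Omega_bar L" for v
      by (rule sum_kernel_mass_cells_le[OF L that \<kappa>(1,4)])
    have s: "\<bar>?s i\<bar> \<le> 2 * R * M0" if "i < n" for i
      by (rule score_bound[OF _ \<phi>m _ R _ zs[OF that] mu[OF that] nu[OF that]]) (use \<phi>s \<epsilon>1 in auto)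
    have "(\<Sum>i<n. ?k i * ?s i) - (\<Sum>i<n. ?kg i * ?s i) = (\<Sum>i<n. (?k i - ?kg i) * ?s i)"
      by (simp add: sum_subtractf left_diff_distrib)
    also have "\<dots> \<le> (\<Sum>i<n. Lp * (hZ ^ DIM('a) * r) * (2 * R * M0))"
    proof (intro sum_mono)
      fix i assume "i \<in> {..<n}"
      then have "\<bar>?k i - ?kg i\<bar> * \<bar>?s i\<bar> \<le> Lp * (hZ ^ DIM('a) * r) * (2 * R * M0)"
        using close s r hZ lip(2) by (intro mult_mono) auto
      then show "(?k i - ?kg i) * ?s i \<le> Lp * (hZ ^ DIM('a) * r) * (2 * R * M0)"
        by (simp flip: abs_mult)
    qed
    also have "\<dots> = N * (2 * R * M0 * Lp) * r" by (simp add: N_def)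
    also have "\<dots> \<le> N * (2 * R * M0 * Lp) * (2 ^ j * r)"
      using N R M0 lip(2) r by (intro mult_left_mono mult_nonneg_nonneg) auto
    finally have "(\<Sum>i<n. ?k i * ?s i) \<le> N * (A + 2 * R * M0 * Lp) * (2 ^ j * r)"
      using dev[OF j \<epsilon>] by (simp add: N_def algebra_simps)
    also have "\<dots> = (N * (c1 / 2)) * (C * (2 ^ j * r))" using c1 by (simp add: C_def)
    also have "\<dots> \<le> T * (C * (2 ^ j * r))" using T C0 r by (intro mult_right_mono) auto
    finally show ?thesis .
  qed
  have q0: "q > 0" using q by simp
  have "partial_ot L q (Lambda_hat L w S KZ KU hZ hU n zs D z) (\<Lambda> z) \<le> ennreal (3 powr q *
    (((4 * L / 2 ^ J) powr q * (R * M0) + (\<Sum>j\<le>J. (8 * L / 2 ^ j) powr q * (C * (2 ^ j * r)))) + 3 powr q * (b + H)))"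
    by (rule estimator_bound[OF \<kappa>_eq L q0 hU hZ R \<kappa>(1,2) _ \<kappa>(4,5) kc K0 z zs mu nu T0 T_def _ dev' b H])
      (use \<kappa>(3) C0 r in auto)
  also have "\<dots> \<le> ennreal (3 powr q *
    (((8 * L) powr q * r * (R * M0) + (8 * L) powr q * C * r / (1 - 2 powr (1 - q))) + 3 powr q * (b + H)))"
  proof (intro ennreal_leI mult_left_mono add_mono mult_right_mono geometric_level_sum[OF q])
    have "4 * L / 2 ^ J \<le> 8 * L * r"
    proof -
      have "1 / 2 ^ J \<le> 2 * r" using r(3) by (simp add: field_simps)
      then have "4 * L * (1 / 2 ^ J) \<le> 4 * L * (2 * r)" using L by (intro mult_left_mono) auto
      then show ?thesis by simp
    qed
    then have "(4 * L / 2 ^ J) powr q \<le> (8 * L * r) powr q" using L q0 by (intro powr_mono2) auto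
    also have "\<dots> = (8 * L) powr q * r powr q" by (rule powr_mult)
    also have "r powr q \<le> r powr 1" using r q by (intro powr_mono') auto
    finally show "(4 * L / 2 ^ J) powr q \<le> (8 * L) powr q * r" using r by (simp add: mult_left_mono)
  qed (use L C0 r RM in auto)
  also have "3 powr q * (((8 * L) powr q * r * (R * M0) + (8 * L) powr q * C * r / (1 - 2 powr (1 - q))) + 3 powr q * (b + H))
    = 3 powr q * (((8 * L) powr q * (R * M0) + (8 * L) powr q * C / (1 - 2 powr (1 - q))) * r + 3 powr q * (b + H))"
    by (simp add: algebra_simps)
  finally show ?thesis by (simp add: C_def)
qed

end

section \<open>Asymptotics\<close>

text \<open>Refining stops when the mesh has reached the stochastic error; below that scale matching inside cells
  costs no more than the error itself.\<close>

lemma exists_dyadic_level: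
  fixes r :: real
  assumes "0 < r" "r \<le> 1"
  obtains J where "2 ^ J * r \<le> 1" "1 < 2 ^ Suc J * r"
proof -
  obtain m where "1 / r < 2 ^ m" using real_arch_pow[of 2 "1 / r"] by auto
  then have ex: "1 < 2 ^ m * r" using assms by (simp add: field_simps)
  define m0 where "m0 = (LEAST m. 1 < 2 ^ m * r)"
  have m0: "1 < 2 ^ m0 * r" unfolding m0_def by (rule LeastI[of _ m]) (rule ex)
  then obtain J where J: "m0 = Suc J" using assms by (cases m0) auto
  have "\<not> 1 < 2 ^ J * r" using not_less_Least[of J "\<lambda>m. 1 < 2 ^ m * r"] J by (simp add: m0_def)
  then show thesis using that[of J] m0 J by simp
qed

text \<open>Turns the lower bound on the normalisation into one on the expected kernel weight.\<close>

lemma kernel_const_le_nn_integral: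
  fixes K :: "'a::euclidean_space \<Rightarrow> real"
  assumes "\<And>x. 0 \<le> K x" "0 < h"
  shows "ennreal (kernel_const K S h z * h ^ DIM('a)) \<le> (\<integral>\<^sup>+z'. ennreal (K ((z' - z) /\<^sub>R h)) * indicator S z' \<partial>lborel)"
proof -
  let ?f = "\<lambda>z'. K ((z' - z) /\<^sub>R h) * indicator S z'"
  have "kernel_const K S h z * h ^ DIM('a) = (LINT z'|lborel. (indicator S z' *\<^sub>R (K ((z' - z) /\<^sub>R h) / h ^ DIM('a))) * h ^ DIM('a))"
    unfolding kernel_const_def set_lebesgue_integral_def by (rule integral_mult_left_zero[symmetric])
  also have "\<dots> = (LINT z'|lborel. ?f z')"
    using assms(2) by (intro Bochner_Integration.integral_cong refl) simp
  finally have e: "kernel_const K S h z * h ^ DIM('a) = (LINT z'|lborel. ?f z')" .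
  have nn: "(\<integral>\<^sup>+z'. ennreal (?f z') \<partial>lborel) = (\<integral>\<^sup>+z'. ennreal (K ((z' - z) /\<^sub>R h)) * indicator S z' \<partial>lborel)"
    by (intro nn_integral_cong) (simp add: indicator_def)
  show ?thesis
  proof (cases "integrable lborel ?f")
    case True
    then show ?thesis using nn_integral_eq_integral[OF True] assms(1) nn e by simp
  next
    case False
    then have "(LINT z'|lborel. ?f z') = 0" by (rule not_integrable_integral_eq)
    then show ?thesis unfolding e by simp
  qed
qed

text \<open>The net has polynomially many points, so the exponent in the deviation bound beats it.\<close>

lemma net_union_bound_le:
  fixes n h r \<delta> C G J :: real and d :: nat
  assumes n: "1 \<le> n" "1 \<le> ln n" and d: "0 < d" and h: "0 < h" "h \<le> 1" and r: "0 < r" "r \<le> 1"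
    and nh: "n * h ^ d * r\<^sup>2 = ln n" and \<delta>: "\<delta> = h ^ (d + 1) * r" and C: "0 < C"
    and G: "0 \<le> G" "G \<le> (C / \<delta>) ^ d" and J: "0 \<le> J" "J \<le> n"
  shows "G * (J + 2) * exp (- (real ((d + 2) * d + 2)) * ln n) \<le> 3 * C ^ d / n"
proof -
  have "r\<^sup>2 \<le> 1" using r by (simp add: power_le_one)
  have "1 \<le> n * h ^ d * r\<^sup>2" using nh n by simp
  also have "\<dots> \<le> n * h ^ d * 1" using n h \<open>r\<^sup>2 \<le> 1\<close> by (intro mult_left_mono) auto
  also have "\<dots> \<le> n * h ^ 1"
    using n h d power_decreasing[of 1 d h] unfolding mult_1_right by (intro mult_left_mono) auto
  finally have hn: "1 / n \<le> h" using n by (simp add: field_simps)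
  have "1 \<le> n * h ^ d * r\<^sup>2" using nh n by simp
  also have "\<dots> \<le> n * 1 * r\<^sup>2" using n h by (intro mult_left_mono mult_right_mono) (auto simp: power_le_one)
  also have "\<dots> \<le> n * 1 * r" using n r by (intro mult_left_mono) (auto simp: power2_eq_square mult_left_le)
  finally have rn: "1 / n \<le> r" using n by (simp add: field_simps)
  have "(1 / n) ^ (d + 1) * (1 / n) \<le> \<delta>"
    unfolding \<delta> using hn rn n h r by (intro mult_mono power_mono) auto
  then have dn: "1 / n ^ (d + 2) \<le> \<delta>" by (simp add: power_one_over mult_ac)
  have \<delta>0: "0 < \<delta>" using h r by (simp add: \<delta>)
  have "C / \<delta> \<le> C * n ^ (d + 2)"
  proof -
    have "1 \<le> \<delta> * n ^ (d + 2)" using dn n by (simp add: divide_le_eq)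
    then have "C * 1 \<le> C * (\<delta> * n ^ (d + 2))" using C by (intro mult_left_mono) auto
    then show ?thesis using \<delta>0 by (simp add: divide_le_eq mult_ac)
  qed
  then have "(C / \<delta>) ^ d \<le> (C * n ^ (d + 2)) ^ d" using C \<delta>0 by (intro power_mono) auto
  also have "(C * n ^ (d + 2)) ^ d = C ^ d * n ^ ((d + 2) * d)" by (simp only: power_mult_distrib power_mult)
  finally have G': "G \<le> C ^ d * n ^ ((d + 2) * d)" using G by linarith
  have e: "exp (- (real ((d + 2) * d + 2)) * ln n) = 1 / n ^ ((d + 2) * d + 2)"
  proof -
    have "exp (- real m * ln n) = 1 / exp (ln n) ^ m" for m
      by (simp add: exp_minus divide_inverse exp_of_nat_mult)
    from this[of "(d + 2) * d + 2"] show ?thesis using n by (simp only: exp_ln)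
  qed
  have "G * (J + 2) \<le> (C ^ d * n ^ ((d + 2) * d)) * (3 * n)"
    using G G' J n C by (intro mult_mono) auto
  then have "G * (J + 2) * (1 / n ^ ((d + 2) * d + 2)) \<le> (C ^ d * n ^ ((d + 2) * d)) * (3 * n) * (1 / n ^ ((d + 2) * d + 2))"
    using n by (intro mult_right_mono) auto
  also have "\<dots> = 3 * C ^ d / n" using n by (simp add: power_add power2_eq_square)
  finally show ?thesis unfolding e .
qed

context diagram_sample begin

text \<open>For small bandwidths the constants of the deterministic bound do not depend on \<open>n\<close>, and the exceptional
  event has vanishing probability, so one constant serves every confidence level.\<close>

lemma estimator_rate:
  fixes KZ :: "'a \<Rightarrow> real"
  assumes L: "L > 0" and q: "q > 1" and KZ: "admissible_kernel KZ" and KU: "admissible_kernel KU"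
    and bS: "bounded S" and iS: "inner_balls S"
    and hZ: "\<And>n. hZ n > 0" and hU: "\<And>n. hU n > 0" and hZ0: "hZ \<longlonglongrightarrow> 0" and hU0: "hU \<longlonglongrightarrow> 0"
    and nh: "filterlim (\<lambda>n. real n * hZ n ^ DIM('a) / ln (real n)) at_top sequentially"
    and holder: "\<And>z z'. z \<in> S \<Longrightarrow> z' \<in> S \<Longrightarrow> partial_ot L q (\<Lambda> z) (\<Lambda> z') \<le> ennreal (LO * norm (z - z') powr \<beta>)"
    and \<beta>: "\<beta> > 0"
    and bias: "\<forall>\<^sub>F n in sequentially. bias_U L q KU S \<Lambda> (hU n) \<le> ennreal (Cb * hU n powr q)"
  shows "\<exists>C>0. \<forall>\<epsilon>>0. \<forall>\<^sub>F n in sequentially. \<exists>E\<in>sets M. emeasure M E \<le> ennreal \<epsilon> \<and>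
    (\<forall>\<omega>\<in>space M - E. \<forall>z\<in>S. partial_ot L q
       (Lambda_hat L w S KZ KU (hZ n) (hU n) n (\<lambda>i. Zs i \<omega>) (\<lambda>i. Ds i \<omega>) z) (\<Lambda> z)
     \<le> ennreal (C * (sqrt (ln (real n) / (real n * hZ n ^ DIM('a))) + hZ n powr \<beta> + hU n powr q)))"
proof -
  let ?d = "DIM('a)"
  obtain B Lp where B: "B > 0" and Lp: "Lp > 0" and K: "\<And>x. 0 \<le> KZ x" "\<And>x. KZ x \<le> B" "\<And>x. KZ x \<noteq> 0 \<Longrightarrow> norm x \<le> 1"
    and lip: "\<And>x y. \<bar>KZ x - KZ y\<bar> \<le> Lp * norm (x - y)" and Km: "KZ \<in> borel_measurable borel"
    using admissible_kernelE[OF KZ] by metis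
  obtain cK hz0 where cK: "cK > 0" "hz0 > 0" and kc: "\<And>h z. 0 < h \<Longrightarrow> h \<le> hz0 \<Longrightarrow> z \<in> S \<Longrightarrow> cK \<le> kernel_const KZ S h z"
    using kernel_const_ge[OF KZ iS S] by blast
  obtain R0 hu0 where R0: "R0 > 0" "hu0 > 0"
    and \<kappa>: "\<And>h. 0 < h \<Longrightarrow> (\<lambda>x. kernel_corr KU (Omega_bar L) h (fst x) (snd x)) \<in> borel_measurable (borel_bar L \<Otimes>\<^sub>M borel_bar L)"
      "\<And>h u v. 0 < h \<Longrightarrow> 0 \<le> kernel_corr KU (Omega_bar L) h u v"
      "\<And>h u v. 0 < h \<Longrightarrow> kernel_corr KU (Omega_bar L) h u v \<noteq> 0 \<Longrightarrow> norm (u - v) \<le> h"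
      "\<And>h v. 0 < h \<Longrightarrow> h \<le> hu0 \<Longrightarrow> kernel_mass L (kernel_corr KU (Omega_bar L) h) (Omega_bar L) v \<le> ennreal R0"
      "\<And>h u v. 0 < h \<Longrightarrow> h \<le> hu0 \<Longrightarrow> u \<in> Omega_bar L \<Longrightarrow> kernel_corr KU (Omega_bar L) h u v \<le> R0 / h\<^sup>2"
    by (rule kernel_corr_bounds[OF KU L], rule that, assumption+)
  obtain Cg where Cg: "Cg > 0" and net: "\<And>\<delta>. 0 < \<delta> \<Longrightarrow> \<delta> \<le> 1 \<Longrightarrow>
    \<exists>G. finite G \<and> G \<subseteq> S \<and> real (card G) \<le> (Cg / \<delta>) ^ ?d \<and> (\<forall>z\<in>S. \<exists>g\<in>G. norm (z - g) \<le> \<delta>)"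
    by (rule finite_net[OF bS], rule that, assumption+)
  define R where "R = max R0 1"
  have R: "1 \<le> R" "R0 \<le> R" "0 < R" by (auto simp: R_def)
  have \<kappa>R: "kernel_mass L (kernel_corr KU (Omega_bar L) h) (Omega_bar L) v \<le> ennreal R" if "0 < h" "h \<le> hu0" for h v
    using order_trans[OF \<kappa>(4)[OF that]] R by (simp add: ennreal_leI)
  have \<kappa>B: "kernel_corr KU (Omega_bar L) h u v \<le> R / h\<^sup>2" if "0 < h" "h \<le> hu0" "u \<in> Omega_bar L" for h u v
    using order_trans[OF \<kappa>(5)[OF that]] R by (simp add: divide_right_mono)
  define c1 where "c1 = cp * cK"
  have c1: "c1 > 0" using cK p(3) by (simp add: c1_def)
  \<comment> \<open>The net has at most a multiple of \<open>n ^ ((d + 2) * d)\<close> points, and there are at most \<open>n + 1\<close> levels; the remaining power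
    of \<open>n\<close> makes the probability tend to zero.\<close>
  define \<gamma> where "\<gamma> = real ((?d + 2) * ?d + 2) + 1"
  have \<gamma>1: "1 \<le> \<gamma>" unfolding \<gamma>_def by (simp only: le_add_same_cancel2 of_nat_0_le_iff)
  define b v where "b = 2 * R * M0 * B" and "v = (2 * R * M0)\<^sup>2 * (Cp * B\<^sup>2 * unit_ball_vol DIM('a))"
  define A where "A = b * (\<gamma> + v / b\<^sup>2)"
  have "S \<noteq> {}" using Zs_in not_empty by blast
  then have Cp: "0 < Cp" using p by (metis all_not_in_conv less_le_trans order_trans)
  have b0: "0 < b" and v0: "0 \<le> v" using R M0 B Cp by (auto simp: b_def v_def)
  have A0: "0 < A" unfolding A_def using b0 v0 by (intro mult_pos_pos add_pos_nonneg) (use \<gamma>1 in auto)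
  \<comment> \<open>Negative constants are allowed in the hypotheses, where \<open>ennreal\<close> truncates them to zero.\<close>
  define LO' Cb' where "LO' = max LO 0" and "Cb' = max Cb 0"
  define r where "r n = sqrt (ln (real n) / (real n * hZ n ^ ?d))" for n
  define Y where "Y = (8 * L) powr q * (R * M0) + (8 * L) powr q * (2 / c1 * (A + 2 * R * M0 * Lp)) / (1 - 2 powr (1 - q))"
  have "2 powr (1 - q) < 1" using q powr_less_mono[of "1 - q" 0 2] by simp
  then have Y: "0 \<le> Y"
    unfolding Y_def using A0 R M0 Lp c1 by (intro add_nonneg_nonneg mult_nonneg_nonneg divide_nonneg_nonneg) auto
  define k1 k2 k3 where "k1 = 3 powr q * Y" and "k2 = 3 powr q * (3 powr q * LO')"
    and "k3 = 3 powr q * (3 powr q * ((1 + 3 powr q * R) * M0 + (3 powr q + 1) * Cb'))"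
  have k: "0 \<le> k1" "0 \<le> k2" "0 \<le> k3" using Y R M0 by (auto simp: k1_def k2_def k3_def LO'_def Cb'_def)
  define C where "C = k1 + k2 + k3 + 1"
  have r_lim: "r \<longlonglongrightarrow> 0"
  proof -
    have "(\<lambda>n. inverse (real n * hZ n ^ ?d / ln (real n))) \<longlonglongrightarrow> 0"
      by (rule tendsto_inverse_0_at_top[OF nh])
    then have "(\<lambda>n. sqrt (inverse (real n * hZ n ^ ?d / ln (real n)))) \<longlonglongrightarrow> sqrt 0" by (rule tendsto_real_sqrt)
    then show ?thesis unfolding r_def[abs_def] by simp
  qed
  have "\<forall>\<^sub>F n in sequentially. \<exists>E\<in>sets M. emeasure M E \<le> ennreal \<epsilon> \<and>
    (\<forall>\<omega>\<in>space M - E. \<forall>z\<in>S. partial_ot L q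
       (Lambda_hat L w S KZ KU (hZ n) (hU n) n (\<lambda>i. Zs i \<omega>) (\<lambda>i. Ds i \<omega>) z) (\<Lambda> z)
     \<le> ennreal (C * (r n + hZ n powr \<beta> + hU n powr q)))" if \<epsilon>: "\<epsilon> > 0" for \<epsilon>
  proof -
    have "\<forall>\<^sub>F n in sequentially. hZ n < min hz0 1"
      using hZ0 cK by (intro order_tendstoD(2)) auto
    moreover have "\<forall>\<^sub>F n in sequentially. hU n < hu0" using hU0 R0 by (intro order_tendstoD(2)) auto
    moreover have "\<forall>\<^sub>F n in sequentially. r n < min 1 (c1 / (2 * (A + Lp)))"
      using r_lim c1 A0 Lp by (intro order_tendstoD(2)) auto
    moreover have "\<forall>\<^sub>F n in sequentially. 3 \<le> n \<and> 3 * Cg ^ ?d / \<epsilon> \<le> real n"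
      using eventually_ge_at_top[of "nat \<lceil>3 * Cg ^ ?d / \<epsilon>\<rceil>"] eventually_ge_at_top[of 3]
      by eventually_elim linarith
    ultimately show ?thesis using bias
    proof eventually_elim
      case (elim n)
      define h where "h = hZ n"
      have h: "0 < h" "h \<le> hz0" "h \<le> 1" using elim(1) hZ[of n] by (auto simp: h_def)
      have hu: "0 < hU n" "hU n \<le> hu0" using elim(2) hU[of n] by auto
      have n: "1 \<le> real n" "0 < n" "1 \<le> ln (real n)"
      proof -
        have "exp 1 \<le> (3::real)" by (rule exp_le)
        then have "exp 1 \<le> real n" using elim(4) by linarith
        then show "1 \<le> ln (real n)" using elim(4) by (subst ln_ge_iff) auto
      qed (use elim(4) in auto)
      define rn where "rn = r n"
      have rsq: "real n * h ^ ?d * rn\<^sup>2 = ln (real n)"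
        using n h by (simp add: rn_def r_def h_def)
      have rn: "0 < rn" "rn \<le> 1" "(A + Lp) * rn \<le> c1 / 2"
      proof -
        have "0 < ln (real n)" using n by linarith
        then show "0 < rn" unfolding rn_def r_def using n hZ[of n]
          by (intro real_sqrt_gt_zero divide_pos_pos mult_pos_pos zero_less_power) auto
        show "rn \<le> 1" using elim(3) by (simp add: rn_def)
        have "rn \<le> c1 / (2 * (A + Lp))" using elim(3) by (simp add: rn_def)
        then show "(A + Lp) * rn \<le> c1 / 2" using A0 Lp by (simp add: field_simps)
      qed
      obtain J where J: "2 ^ J * rn \<le> 1" "1 < 2 ^ Suc J * rn" using exists_dyadic_level[OF rn(1,2)] .
      \<comment> \<open>At this mesh the Lipschitz error of the kernel weights, \<open>\<delta> / h\<close> per observation, is \<open>h ^ d * rn\<close>.\<close>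
      define \<delta> where "\<delta> = h ^ (?d + 1) * rn"
      have "\<delta> \<le> 1 * 1" unfolding \<delta>_def using h rn by (intro mult_mono power_le_one) auto
      then have \<delta>: "0 < \<delta>" "\<delta> \<le> 1" using h rn by (auto simp: \<delta>_def)
      obtain G where G: "finite G" "G \<subseteq> S" "real (card G) \<le> (Cg / \<delta>) ^ ?d" "\<And>z. z \<in> S \<Longrightarrow> \<exists>g\<in>G. norm (z - g) \<le> \<delta>"
        using net[OF \<delta>] by blast
      let ?\<kappa> = "kernel_corr KU (Omega_bar L) (hU n)"
      let ?\<phi> = "\<lambda>j k. kernel_mass L ?\<kappa> (cell L j k)"
      have \<phi>m: "?\<phi> j k \<in> borel_measurable (borel_bar L)" for j k
        by (rule kernel_mass_measurable[OF \<kappa>(1)[OF hu(1)]]) simp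
      have \<phi>s: "(\<Sum>k\<in>cell_indices j. ?\<phi> j k v) \<le> ennreal R" if "v \<in> Omega_bar L" for j v
        by (rule sum_kernel_mass_cells_le[OF L that \<kappa>(1)[OF hu(1)] \<kappa>R[OF hu]])
      obtain E where E: "E \<in> sets M" "emeasure M E \<le> ennreal (real (card G) * (real J + 2) * exp (- (\<gamma> - 1) * ln (real n)))"
        and mu: "\<And>\<omega> i. \<omega> \<in> space M - E \<Longrightarrow> i < n \<Longrightarrow> emeasure (\<mu> i \<omega>) (Omega_bar L) \<le> ennreal M0"
        and nu: "\<And>\<omega> i. \<omega> \<in> space M - E \<Longrightarrow> i < n \<Longrightarrow> emeasure (\<Lambda> (Zs i \<omega>)) (Omega_bar L) \<le> ennreal M0"
        and low: "\<And>\<omega> g. \<omega> \<in> space M - E \<Longrightarrow> g \<in> G \<Longrightarrow>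
           (\<Sum>i<n. expectation (\<lambda>\<omega>. KZ ((Zs 0 \<omega> - g) /\<^sub>R h)) - KZ ((Zs i \<omega> - g) /\<^sub>R h)) \<le> real n * h ^ DIM('a) * A * rn"
        and dev: "\<And>\<omega> g j \<epsilon>. \<omega> \<in> space M - E \<Longrightarrow> g \<in> G \<Longrightarrow> j \<le> J \<Longrightarrow> \<epsilon> \<in> cell_indices j \<rightarrow>\<^sub>E {-1, 1} \<Longrightarrow>
           (\<Sum>i<n. KZ ((Zs i \<omega> - g) /\<^sub>R h) * score (cell_indices j) (?\<phi> j) \<epsilon> (Zs i \<omega>, Ds i \<omega>))
             \<le> real n * h ^ DIM('a) * A * (2 ^ j * rn)"
        by (rule exceptional_event[OF b_def v_def Km K(1,2) _ B h(1) \<phi>m _ R(1) G(1) rn(1) J(1) rsq n(3) \<gamma>1 A_def],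
            erule K(3), erule \<phi>s, rule that, assumption+)
      have e0: "c1 * h ^ ?d \<le> expectation (\<lambda>\<omega>. KZ ((Zs 0 \<omega> - g) /\<^sub>R h))" if g: "g \<in> G" for g
      proof -
        let ?K = "\<lambda>z. KZ ((z - g) /\<^sub>R h)"
        have m: "?K \<in> borel_measurable borel"
          by (rule measurable_compose[OF _ Km]) (intro borel_measurable_continuous_onI continuous_intros)
        have s: "norm (x - g) \<le> h" if "?K x \<noteq> 0" for x
        proof -
          have "norm ((x - g) /\<^sub>R h) \<le> 1" using that by (rule K(3))
          then have "norm (x - g) \<le> 1 * h" by (simp only: norm_scaled_le[OF h(1)])
          then show ?thesis by simp
        qed
        have "ennreal (c1 * h ^ ?d) \<le> ennreal (cp * (kernel_const KZ S h g * h ^ ?d))"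
          unfolding c1_def using kc[OF h(1,2), of g] g G(2) p(3) h
          by (intro ennreal_leI) (auto simp: mult.assoc intro!: mult_left_mono mult_right_mono)
        also have "\<dots> = ennreal cp * ennreal (kernel_const KZ S h g * h ^ ?d)"
          using p(3) by (intro ennreal_mult') auto
        also have "\<dots> \<le> ennreal cp * (\<integral>\<^sup>+z'. ennreal (?K z') * indicator S z' \<partial>lborel)"
          by (intro mult_left_mono kernel_const_le_nn_integral K(1) h) auto
        also have "\<dots> \<le> ennreal (expectation (\<lambda>\<omega>. ?K (Zs 0 \<omega>)))"
          by (rule expectation_Kf(3)[where g = g, OF m K(1) K(2) s B h(1)])
        finally show ?thesis
          using K(1) by (subst (asm) ennreal_le_iff) (auto intro!: Bochner_Integration.integral_nonneg)
      qed
      have "emeasure M E \<le> ennreal \<epsilon>"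
      proof -
        have "real J \<le> real n"
        proof -
          have "real J < 2 ^ J" by (rule of_nat_less_two_power)
          also have "(2::real) ^ J \<le> 1 / rn" using J(1) rn by (simp add: le_divide_eq)
          also have "\<dots> \<le> real n"
          proof -
            have "1 \<le> real n * h ^ ?d * rn\<^sup>2" using rsq n by simp
            also have "\<dots> \<le> real n * 1 * rn\<^sup>2" using n h by (intro mult_left_mono mult_right_mono) (auto simp: power_le_one)
            also have "\<dots> \<le> real n * 1 * rn" using n rn by (intro mult_left_mono) (auto simp: power2_eq_square mult_left_le)
            finally show ?thesis using rn by (simp add: divide_le_eq)
          qed
          finally show ?thesis by simp
        qed
        then have "real (card G) * (real J + 2) * exp (- (real ((?d + 2) * ?d + 2)) * ln (real n)) \<le> 3 * Cg ^ ?d / real n"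
          by (intro net_union_bound_le[OF n(1,3) _ h(1,3) rn(1,2) rsq \<delta>_def Cg _ G(3)]) auto
        also have "\<dots> \<le> \<epsilon>" using elim(4) \<epsilon> n by (simp add: field_simps)
        finally show ?thesis using E(2) by (simp add: \<gamma>_def) (meson ennreal_leI order_trans)
      qed
      moreover have "partial_ot L q (Lambda_hat L w S KZ KU (hZ n) (hU n) n (\<lambda>i. Zs i \<omega>) (\<lambda>i. Ds i \<omega>) z) (\<Lambda> z)
         \<le> ennreal (C * (r n + hZ n powr \<beta> + hU n powr q))" if \<omega>: "\<omega> \<in> space M - E" and z: "z \<in> S" for \<omega> z
      proof -
        obtain g where g: "g \<in> G" "norm (z - g) \<le> \<delta>" using G(4)[OF z] by blast
        have zs: "Zs i \<omega> \<in> S" for i using \<omega> Zs_in by auto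
        define bb where "bb = (1 + 3 powr q * R) * M0 * hU n powr q + (3 powr q + 1) * (Cb' * hU n powr q)"
        define H where "H = LO' * h powr \<beta>"
        have bb: "0 \<le> bb" using R M0 by (auto simp: bb_def Cb'_def intro!: add_nonneg_nonneg mult_nonneg_nonneg)
        have H: "0 \<le> H" by (simp add: H_def LO'_def)
        have biasn: "bias_U L q KU S \<Lambda> (hU n) \<le> ennreal (Cb' * hU n powr q)"
          using elim(5) by (rule order_trans) (intro ennreal_leI mult_right_mono, auto simp: Cb'_def)
        have b1: "partial_ot L q (smoothing L ?\<kappa> (\<Lambda> (Zs i \<omega>))) (\<Lambda> (Zs i \<omega>)) \<le> ennreal bb" if "i < n" for i
          unfolding bb_def using q
          by (intro smoothing_bias[OF _ R(3) \<kappa>(1)[OF hu(1)] \<kappa>(2)[OF hu(1)] \<kappa>(3)[OF hu(1)] \<kappa>R[OF hu] hu(1)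
              Lambda_finite[OF zs] Lambda_sets[OF zs] nu[OF \<omega> that] _ zs biasn]) (use M0 in \<open>auto simp: Cb'_def\<close>)
        have H1: "partial_ot L q (\<Lambda> (Zs i \<omega>)) (\<Lambda> z) \<le> ennreal H" if "KZ ((Zs i \<omega> - z) /\<^sub>R h) \<noteq> 0" for i
        proof -
          have "norm ((Zs i \<omega> - z) /\<^sub>R h) \<le> 1" using that by (rule K(3))
          then have "norm (Zs i \<omega> - z) \<le> 1 * h" by (simp only: norm_scaled_le[OF h(1)])
          then have "norm (Zs i \<omega> - z) powr \<beta> \<le> h powr \<beta>" using \<beta> by (intro powr_mono2) auto
          then have "LO * norm (Zs i \<omega> - z) powr \<beta> \<le> H"
            unfolding H_def LO'_def by (intro mult_mono) auto
          with holder[OF zs z, of i] show ?thesis by (meson ennreal_leI order_trans)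
        qed
        have kcz: "0 < kernel_const KZ S h z" using kc[OF h(1,2) z] cK by linarith
        have "partial_ot L q (Lambda_hat L w S KZ KU h (hU n) n (\<lambda>i. Zs i \<omega>) (\<lambda>i. Ds i \<omega>) z) (\<Lambda> z)
          \<le> ennreal (3 powr q * (Y * rn + 3 powr q * (bb + H)))"
          unfolding Y_def
          by (rule net_point_bound[OF refl L q hu(1) h(1) R(1) \<kappa>(1)[OF hu(1)] \<kappa>(2)[OF hu(1)] _ \<kappa>R[OF hu] \<kappa>B[OF hu]
               kcz K(1) lip Lp z zs mu[OF \<omega>] nu[OF \<omega>] g(2)[unfolded \<delta>_def] rn(1,2) J(2) n(2) A0 c1 rn(3)
               e0[OF g(1)] low[OF \<omega> g(1)] dev[OF \<omega> g(1)] bb b1 H H1])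
            (use \<kappa>(3)[OF hu(1)] in auto)
        also have "3 powr q * (Y * rn + 3 powr q * (bb + H)) = k1 * rn + k2 * h powr \<beta> + k3 * hU n powr q"
          by (simp add: k1_def k2_def k3_def bb_def H_def algebra_simps)
        also have "\<dots> \<le> C * rn + C * h powr \<beta> + C * hU n powr q"
          unfolding C_def using k rn by (intro add_mono mult_right_mono) auto
        also have "\<dots> = C * (rn + h powr \<beta> + hU n powr q)" by (simp add: distrib_left)
        finally show ?thesis by (simp add: h_def rn_def ennreal_leI)
      qed
      ultimately show ?case using E(1) by blast
    qed
  qed
  moreover have "C > 0" using k by (simp add: C_def)
  ultimately show ?thesis unfolding r_def by (intro exI[of _ C]) auto
qed

end

lemma epowr_le:
  assumes "T \<le> ennreal (c * a)" "0 \<le> c" "0 \<le> a" "0 < s"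
  shows "epowr T s \<le> ennreal (c powr s * a powr s)"
proof -
  have T: "T \<noteq> \<infinity>" using assms(1) by (auto simp: top_unique)
  have "enn2real T \<le> c * a" using assms by (intro enn2real_leI) auto
  then have "enn2real T powr s \<le> (c * a) powr s" using assms by (intro powr_mono2) auto
  then show ?thesis using T assms by (simp add: epowr_def powr_mult ennreal_leI)
qed

text \<open>The choice of the covariate bandwidth balances the stochastic and the Hoelder term.\<close>

lemma balanced_rate:
  fixes hZ hU :: "nat \<Rightarrow> real" and \<beta> q :: real and d :: nat
  defines "a \<equiv> \<lambda>n. (ln (real n) / real n) powr (\<beta> / (2 * \<beta> + real d))"
  assumes \<beta>: "\<beta> > 0" and hZ: "\<And>n. hZ n > 0" and hU: "\<And>n. hU n > 0"
    and hZ_rate: "hZ \<in> \<Theta>(\<lambda>n. (ln (real n) / real n) powr (1 / (2 * \<beta> + real d)))"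
    and hU_rate: "(\<lambda>n. hU n powr q) \<in> O(a)"
  shows "\<exists>C>0. \<forall>\<^sub>F n in sequentially.
    sqrt (ln (real n) / (real n * hZ n ^ d)) + hZ n powr \<beta> + hU n powr q \<le> C * a n"
proof -
  let ?s = "2 * \<beta> + real d"
  let ?\<rho> = "\<lambda>n. (ln (real n) / real n) powr (1 / ?s)"
  have s: "?s > 0" using \<beta> by simp
  from hZ_rate obtain c2 where c2: "c2 > 0" "\<forall>\<^sub>F n in sequentially. norm (hZ n) \<le> c2 * norm (?\<rho> n)"
    by (auto elim!: landau_o.bigE dest!: bigthetaD1)
  from hZ_rate obtain c1 where c1: "c1 > 0" "\<forall>\<^sub>F n in sequentially. norm (?\<rho> n) \<le> c1 * norm (hZ n)"
    by (auto elim!: landau_o.bigE dest!: bigthetaD2 simp: bigomega_iff_bigo)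
  from hU_rate obtain c3 where c3: "c3 > 0" "\<forall>\<^sub>F n in sequentially. norm (hU n powr q) \<le> c3 * norm (a n)"
    by (auto elim!: landau_o.bigE)
  define C where "C = sqrt (c1 ^ d) + c2 powr \<beta> + c3"
  have "\<forall>\<^sub>F n in sequentially. sqrt (ln (real n) / (real n * hZ n ^ d)) + hZ n powr \<beta> + hU n powr q \<le> C * a n"
    using c1(2) c2(2) c3(2) eventually_ge_at_top[of 2]
  proof eventually_elim
    case (elim n)
    define x where "x = ln (real n) / real n"
    have x: "x > 0" using elim(4) by (simp add: x_def)
    have \<rho>: "?\<rho> n = x powr (1 / ?s)" and a: "a n = x powr (\<beta> / ?s)" by (simp_all add: x_def a_def)
    have "hZ n powr \<beta> \<le> (c2 * ?\<rho> n) powr \<beta>"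
      using elim(2) hZ[of n] \<beta> by (intro powr_mono2) auto
    also have "\<dots> = c2 powr \<beta> * a n" unfolding \<rho> a by (simp add: powr_mult powr_powr)
    finally have 1: "hZ n powr \<beta> \<le> c2 powr \<beta> * a n" .
    have "x powr (real d / ?s) = (?\<rho> n) ^ d" unfolding \<rho>
      using powr_realpow[of "x powr (1 / ?s)" d] x by (simp add: powr_powr)
    also have "\<dots> \<le> (c1 * hZ n) ^ d" using elim(1) hZ[of n] by (intro power_mono) auto
    finally have "x powr (real d / ?s) \<le> c1 ^ d * hZ n ^ d" by (simp add: power_mult_distrib)
    then have "x / hZ n ^ d \<le> c1 ^ d * (x / x powr (real d / ?s))"
      using x hZ[of n] c1(1) by (simp add: divide_simps mult_ac)
    also have "x / x powr (real d / ?s) = x powr (1 - real d / ?s)" using x by (simp add: powr_diff)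
    also have "1 - real d / ?s = 2 * (\<beta> / ?s)" using s by (simp add: field_simps)
    also have "x powr (2 * (\<beta> / ?s)) = (a n)\<^sup>2" unfolding a using x by (simp add: powr_powr power2_eq_square flip: powr_add)
    finally have "sqrt (x / hZ n ^ d) \<le> sqrt (c1 ^ d * (a n)\<^sup>2)" by (rule real_sqrt_le_mono)
    also have "\<dots> = sqrt (c1 ^ d) * a n" by (simp add: real_sqrt_mult a)
    finally have 2: "sqrt (ln (real n) / (real n * hZ n ^ d)) \<le> sqrt (c1 ^ d) * a n" by (simp add: x_def)
    have 3: "hU n powr q \<le> c3 * a n" using elim(3) by (simp add: a)
    show ?case using 1 2 3 by (simp add: C_def algebra_simps)
  qed
  moreover have "C > 0" using c1 c2 c3 by (simp add: C_def add_nonneg_pos)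
  ultimately show ?thesis by blast
qed

theorem corollary2:
  fixes L q \<beta> L_OT :: real
    and w :: "real \<times> real \<Rightarrow> real"
    and M :: "'w measure"
    and S :: "(real ^ 'd) set"
    and Z :: "'w \<Rightarrow> real ^ 'd" and Zs :: "nat \<Rightarrow> 'w \<Rightarrow> real ^ 'd"
    and D :: "'w \<Rightarrow> real \<times> real \<Rightarrow> nat" and Ds :: "nat \<Rightarrow> 'w \<Rightarrow> real \<times> real \<Rightarrow> nat"
    and \<Lambda> :: "real ^ 'd \<Rightarrow> (real \<times> real) measure"
    and p :: "real ^ 'd \<Rightarrow> real"
    and KZ :: "real ^ 'd \<Rightarrow> real" and KU :: "real \<times> real \<Rightarrow> real"
    and hZ hU :: "nat \<Rightarrow> real"
  assumes L: "L > 0" and q: "q > 1"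
    and M: "prob_space M"
    and iid: "iid_copies M (restrict_space borel S \<Otimes>\<^sub>M diagram_space L)
                (\<lambda>i \<omega>. (Zs i \<omega>, Ds i \<omega>)) (\<lambda>\<omega>. (Z \<omega>, D \<omega>))"
    and Lambda: "\<And>i. cond_expected_measure M (restrict_space borel S) (borel_bar L) (Zs i)
                (\<lambda>\<omega>. weighted_dgm L w (Ds i \<omega>)) \<Lambda>"
    and weight: "is_weight L w" "bounded (w ` Omega_bar L)" "\<exists>C. C-lipschitz_on (Omega_bar L) w"
    and S: "compact S" "cone_condition S"
    and density: "distributed M (restrict_space lborel S) Z (\<lambda>z. ennreal (p z))"
                 "\<exists>c>0. \<exists>C. \<forall>z\<in>S. c \<le> p z \<and> p z \<le> C"
    and mass: "\<exists>Mw::real. \<forall>i. AE \<omega> in M. emeasure (weighted_dgm L w (Ds i \<omega>)) (Omega_bar L) \<le> ennreal Mw"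
    and kernels: "admissible_kernel KZ" "admissible_kernel KU"
    and bandwidths: "\<And>n. hZ n > 0" "\<And>n. hU n > 0" "hZ \<longlonglongrightarrow> 0" "hU \<longlonglongrightarrow> 0"
                 "filterlim (\<lambda>n. real n * hZ n ^ CARD('d) / ln (real n)) at_top sequentially"
    and omega_OT: "(omega_OT L q S \<Lambda> \<longlongrightarrow> 0) (at_right 0)"
    and bias: "(\<lambda>n. bias_U L q KU S \<Lambda> (hU n)) \<longlonglongrightarrow> 0"
    and beta: "\<beta> > 0"
    and holder: "\<And>z z'. z \<in> S \<Longrightarrow> z' \<in> S \<Longrightarrow>
                   epowr (OT L q (\<Lambda> z) (\<Lambda> z')) q \<le> ennreal (L_OT * norm (z - z') powr \<beta>)"
    and bias_rate: "\<exists>C::real. \<forall>\<^sub>F n in sequentially. bias_U L q KU S \<Lambda> (hU n) \<le> ennreal (C * hU n powr q)"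
    and hZ_rate: "hZ \<in> \<Theta>(\<lambda>n. (ln (real n) / real n) powr (1 / (2 * \<beta> + real CARD('d))))"
    and hU_rate: "(\<lambda>n. hU n powr q) \<in> O(\<lambda>n. (ln (real n) / real n) powr (\<beta> / (2 * \<beta> + real CARD('d))))"
  shows "bigO_prob M
           (\<lambda>n \<omega>. SUP z\<in>S. epowr (OT L q
              (Lambda_hat L w S KZ KU (hZ n) (hU n) n (\<lambda>i. Zs i \<omega>) (\<lambda>i. Ds i \<omega>) z) (\<Lambda> z)) q)
           (\<lambda>n. (ln (real n) / real n) powr (\<beta> / (2 * \<beta> + real CARD('d))))
       \<and> bigO_prob M
           (\<lambda>n \<omega>. SUP z\<in>S. OT L q
              (Lambda_hat L w S KZ KU (hZ n) (hU n) n (\<lambda>i. Zs i \<omega>) (\<lambda>i. Ds i \<omega>) z) (\<Lambda> z))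
           (\<lambda>n. (ln (real n) / real n) powr (\<beta> / (q * (2 * \<beta> + real CARD('d)))))"
proof -
  interpret prob_space M by fact
  let ?N = "restrict_space borel S \<Otimes>\<^sub>M diagram_space L"
  have Sb: "S \<in> sets borel" and bS: "bounded S" using S(1) by (auto intro: borel_compact compact_imp_bounded)
  have iS: "inner_balls S" by (rule inner_balls_cone[OF S(2)])
  have dims: "DIM(real ^ 'd) = CARD('d)" by simp
  obtain Mw where Mw: "\<And>i. AE \<omega> in M. emeasure (weighted_dgm L w (Ds i \<omega>)) (Omega_bar L) \<le> ennreal Mw"
    using mass by blast
  obtain c C where p: "c > 0" "\<And>z. z \<in> S \<Longrightarrow> c \<le> p z" "\<And>z. z \<in> S \<Longrightarrow> p z \<le> C" using density(2) by blast
  have indep: "indep_vars (\<lambda>_. ?N) (\<lambda>i \<omega>. (Zs i \<omega>, Ds i \<omega>)) UNIV"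
    and ZD: "(\<lambda>\<omega>. (Z \<omega>, D \<omega>)) \<in> M \<rightarrow>\<^sub>M ?N"
    and same: "distr M ?N (\<lambda>\<omega>. (Zs i \<omega>, Ds i \<omega>)) = distr M ?N (\<lambda>\<omega>. (Z \<omega>, D \<omega>))" for i
    using iid by (auto simp: iid_copies_def)
  have law: "(\<integral>\<^sup>+\<omega>. f (Zs i \<omega>) \<partial>M) = (\<integral>\<^sup>+z. ennreal (p z) * f z * indicator S z \<partial>lborel)"
    if f: "f \<in> borel_measurable borel" for i f
  proof -
    have ff: "(\<lambda>x. f (fst x)) \<in> borel_measurable ?N"
      by (rule measurable_compose[OF measurable_fst measurable_restrict_space1[OF f]])
    have Zi: "(\<lambda>\<omega>. (Zs i \<omega>, Ds i \<omega>)) \<in> M \<rightarrow>\<^sub>M ?N" using indep by (auto simp: indep_vars_def)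
    have "(\<integral>\<^sup>+\<omega>. f (Zs i \<omega>) \<partial>M) = (\<integral>\<^sup>+x. f (fst x) \<partial>distr M ?N (\<lambda>\<omega>. (Zs i \<omega>, Ds i \<omega>)))"
      using nn_integral_distr[OF Zi, of "\<lambda>x. f (fst x)"] ff by simp
    also have "\<dots> = (\<integral>\<^sup>+\<omega>. f (Z \<omega>) \<partial>M)"
      unfolding same using nn_integral_distr[OF ZD, of "\<lambda>x. f (fst x)"] ff by simp
    also have "\<dots> = (\<integral>\<^sup>+z. ennreal (p z) * f z \<partial>restrict_space lborel S)"
      using f by (intro distributed_nn_integral[OF density(1), symmetric] measurable_restrict_space1) simp
    also have "\<dots> = (\<integral>\<^sup>+z. ennreal (p z) * f z * indicator S z \<partial>lborel)"
      using Sb by (intro nn_integral_restrict_space) simp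
    finally show ?thesis .
  qed
  interpret diagram_sample M L w S Zs Ds \<Lambda> "max Mw 1" p c C
  proof
    show "w \<in> borel_measurable (borel_bar L)" using weight(1) by (simp add: is_weight_def)
    show "AE \<omega> in M. emeasure (weighted_dgm L w (Ds i \<omega>)) (Omega_bar L) \<le> ennreal (max Mw 1)" for i
      using Mw[of i] by eventually_elim (erule order_trans, simp add: ennreal_leI)
  qed (use Sb indep Lambda law p in auto)
  have q0: "q > 0" using q by simp
  obtain Cb where Cb: "\<forall>\<^sub>F n in sequentially. bias_U L q KU S \<Lambda> (hU n) \<le> ennreal (Cb * hU n powr q)"
    using bias_rate by blast
  have holder': "partial_ot L q (\<Lambda> z) (\<Lambda> z') \<le> ennreal (L_OT * norm (z - z') powr \<beta>)" if "z \<in> S" "z' \<in> S" for z z'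
    using holder[OF that] by (simp add: epowr_OT q0)
  let ?a = "\<lambda>n. (ln (real n) / real n) powr (\<beta> / (2 * \<beta> + real CARD('d)))"
  let ?hat = "\<lambda>n \<omega> z. Lambda_hat L w S KZ KU (hZ n) (hU n) n (\<lambda>i. Zs i \<omega>) (\<lambda>i. Ds i \<omega>) z"
  obtain C1 where C1: "C1 > 0" and good: "\<And>\<epsilon>. \<epsilon> > 0 \<Longrightarrow> \<forall>\<^sub>F n in sequentially. \<exists>E\<in>sets M. emeasure M E \<le> ennreal \<epsilon> \<and>
    (\<forall>\<omega>\<in>space M - E. \<forall>z\<in>S. partial_ot L q (?hat n \<omega> z) (\<Lambda> z)
     \<le> ennreal (C1 * (sqrt (ln (real n) / (real n * hZ n ^ CARD('d))) + hZ n powr \<beta> + hU n powr q)))"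
    using estimator_rate[OF L q kernels bS iS bandwidths(1-4) bandwidths(5)[folded dims] holder' beta Cb]
    unfolding dims by blast
  obtain C2 where C2: "C2 > 0" and rate: "\<forall>\<^sub>F n in sequentially.
      sqrt (ln (real n) / (real n * hZ n ^ CARD('d))) + hZ n powr \<beta> + hU n powr q \<le> C2 * ?a n"
    using balanced_rate[OF beta bandwidths(1,2) hZ_rate hU_rate] by blast
  define K where "K = C1 * C2"
  have K: "K > 0" using C1 C2 by (simp add: K_def)
  have final: "\<forall>\<^sub>F n in sequentially. \<exists>E\<in>sets M. emeasure M E \<le> ennreal \<epsilon> \<and>
    (\<forall>\<omega>\<in>space M - E. \<forall>z\<in>S. partial_ot L q (?hat n \<omega> z) (\<Lambda> z) \<le> ennreal (K * ?a n))" if "\<epsilon> > 0" for \<epsilon>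
    using good[OF that] rate
  proof eventually_elim
    case (elim n)
    have le: "C1 * (sqrt (ln (real n) / (real n * hZ n ^ CARD('d))) + hZ n powr \<beta> + hU n powr q) \<le> K * ?a n"
      using mult_left_mono[OF elim(2), of C1] C1 by (simp add: K_def mult.assoc)
    from elim(1) show ?case by (meson ennreal_leI[OF le] order_trans)
  qed
  have bigO: "bigO_prob M (\<lambda>n \<omega>. SUP z\<in>S. X n \<omega> z) a'"
    if K': "K' > 0" and X: "\<And>n \<omega> z. partial_ot L q (?hat n \<omega> z) (\<Lambda> z) \<le> ennreal (K * ?a n) \<Longrightarrow> X n \<omega> z \<le> ennreal (K' * a' n)"
    for X K' a'
    unfolding bigO_prob_def
  proof (intro allI impI exI[of _ K'] conjI K')
    fix \<epsilon> :: real assume "\<epsilon> > 0"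
    from final[OF this]
    show "\<forall>\<^sub>F n in sequentially. \<exists>B\<in>sets M. {\<omega> \<in> space M. (SUP z\<in>S. X n \<omega> z) > ennreal (K' * a' n)} \<subseteq> B \<and> emeasure M B \<le> ennreal \<epsilon>"
    proof eventually_elim
      case (elim n)
      then obtain E where E: "E \<in> sets M" "emeasure M E \<le> ennreal \<epsilon>"
        and le: "\<And>\<omega> z. \<omega> \<in> space M - E \<Longrightarrow> z \<in> S \<Longrightarrow> partial_ot L q (?hat n \<omega> z) (\<Lambda> z) \<le> ennreal (K * ?a n)" by blast
      have "(SUP z\<in>S. X n \<omega> z) \<le> ennreal (K' * a' n)" if "\<omega> \<in> space M - E" for \<omega>
        by (intro SUP_least X le that)
      then have "{\<omega> \<in> space M. (SUP z\<in>S. X n \<omega> z) > ennreal (K' * a' n)} \<subseteq> E" by (auto simp: not_less[symmetric])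
      with E show ?case by blast
    qed
  qed
  show ?thesis
  proof (intro conjI)
    show "bigO_prob M (\<lambda>n \<omega>. SUP z\<in>S. epowr (OT L q (?hat n \<omega> z) (\<Lambda> z)) q) ?a"
      by (rule bigO[OF K]) (simp add: epowr_OT q0)
    show "bigO_prob M (\<lambda>n \<omega>. SUP z\<in>S. OT L q (?hat n \<omega> z) (\<Lambda> z))
           (\<lambda>n. (ln (real n) / real n) powr (\<beta> / (q * (2 * \<beta> + real CARD('d)))))"
    proof (rule bigO[of "K powr (1 / q)"])
      fix n \<omega> z assume "partial_ot L q (?hat n \<omega> z) (\<Lambda> z) \<le> ennreal (K * ?a n)"
      from epowr_le[OF this, of "1 / q"] K q0
      show "OT L q (?hat n \<omega> z) (\<Lambda> z) \<le> ennreal (K powr (1 / q) * (ln (real n) / real n) powr (\<beta> / (q * (2 * \<beta> + real CARD('d)))))"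
        by (simp add: OT_eq powr_powr mult.commute)
    qed (use K in simp)
  qed
qed

end
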